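(* Let $A_1, A_2,\dots,A_n$ ($n\ge 2$) be braided sub-Hopf algebras of a finite-dimensional braided Hopf algebra $H$ in $(\mathcal{C},C)$, with $H=A_1A_2\cdots A_n$, and let $\sigma$ be a method of adding brackets for $n$ factors. Then the following statements are equivalent. (i) $H=A_1A_2\cdots A_n$ is an inner double factorization of $H$ with respect to $\sigma$. (ii) $\dim H=\dim(A_1)\dim(A_2)\cdots\dim(A_n)$, and for every pair of brackets $(A_t\otimes A_{t+1}\otimes\cdots\otimes A_{t+l})$ in $\sigma$, $A_tA_{t+1}\cdots A_{t+l}$ is a sub-Hopf algebra of $H$. (iii) For every pair of brackets $(A_t\otimes A_{t+1}\otimes\cdots\otimes A_{t+l})$ in $\sigma$, $A_tA_{t+1}\cdots A_{t+l}$ is a sub-Hopf algebra of $H$, and there exists a set $\{\alpha_i,\beta_i\mid i=1,2,\dots,n-1\}$ of morphisms such that $$\sigma\left( A_1 \;{}_{\alpha_1}\!\bowtie_{\beta_1} A_2 \;{}_{\alpha_2}\!\bowtie_{\beta_2} A_3 \;{}_{\alpha_3}\!\bowtie_{\beta_3} \cdots \;{}_{\alpha_{n-1}}\!\bowtie_{\beta_{n-1}} A_n \right) \cong H$$ as Hopf algebras, and the isomorphism is $m_H^{n-1}$.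
   Context: Standing setting: $(\mathcal{C}, C)$ is a braided tensor category with braiding $C$, where $\mathcal{C}$ is a concrete category in which the underlying set of every object is a vector space over a field $k$. Braided bialgebras and braided Hopf algebras are bialgebras and Hopf algebras in $(\mathcal{C}, C)$; sub-Hopf algebras are taken in this category. Double cross product. Let $X$ and $Y$ be braided bialgebras, and let $\alpha: Y\otimes X \to X$ and $\beta: Y \otimes X \to Y$ be morphisms such that $(X,\alpha)$ is a left $Y$-module coalgebra and $(Y,\beta)$ is a right $X$-module coalgebra. The double cross product $X\;{}_\alpha\!\bowtie_\beta Y$ is the object $X\otimes Y$ with $$m = (m_X\otimes m_Y)(id_X\otimes\alpha\otimes\beta\otimes id_Y)(id_X\otimes id_Y\otimes C_{Y,X}\otimes id_X\otimes id_Y)(id_X\otimes\Delta_Y\otimes\Delta_X\otimes id_Y),$$ $$\Delta = (id_X\otimes C_{X,Y}\otimes id_Y)(\Delta_X\otimes\Delta_Y),\quad \epsilon = \epsilon_X\otimes\epsilon_Y,\quad \eta=\eta_X\otimes\eta_Y.$$ Methods of adding brackets. The operation $\bowtie$ is not associative in general; a method $\sigma$ of adding brackets for $n$ factors is a complete (binary) bracketing of an ordered list of $n$ factors, the outermost pair of brackets included; e.g. for $n=3$ the two methods give $((A_1\bowtie A_2)\bowtie A_3)$ and $(A_1\bowtie(A_2\bowtie A_3))$. In $\sigma(A_1\;{}_{\alpha_1}\!\bowtie_{\beta_1} A_2\cdots \;{}_{\alpha_{n-1}}\!\bowtie_{\beta_{n-1}}A_n)$ the double cross products are formed in the order prescribed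 by $\sigma$; if the $i$-th symbol $\bowtie$ combines a left factor $X$ with a right factor $Y$, then $\alpha_i: Y\otimes X\to X$ and $\beta_i: Y\otimes X\to Y$. Notation: $m_H^{t}: H^{\otimes (t+1)}\to H$ is the iterated multiplication; in (iii), $m_H^{n-1}$ is restricted to $A_1\otimes\cdots\otimes A_n$. Products of subspaces of $H$ are spans of products of elements. Inner double factorization. For sub-Hopf algebras $A_1,\dots,A_n$ of $H$, $H=A_1A_2\cdots A_n$ is an inner double factorization of $H$ with respect to $\sigma$ if $A_1A_2\cdots A_n=H$ and, for every pair of brackets $(A_l\otimes A_{l+1}\otimes\cdots\otimes A_{l+t})$ of $\sigma$, the product $A_lA_{l+1}\cdots A_{l+t}$ is a sub-Hopf algebra of $H$ and $m_H^t$ restricts to a bijective map from $A_l\otimes\cdots\otimes A_{l+t}$ onto $A_lA_{l+1}\cdots A_{l+t}$.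
   Formalization: Added assumption on the category: every bijective morphism between finite-dimensional objects is an isomorphism. Without it (ii)⇒(iii) fails, e.g. for filtered vector spaces in characteristic p with H=k[x,y]/(x^p,y^p), x+y in degree 1, x and y in degree 2. *)

theory Defs
  imports Complex_Main "HOL-Library.FuncSet"
begin

section \<open>Concrete braided tensor categories over a field\<close>

text \<open>
  The objects are the elements of a type \<open>'o\<close>.  The underlying vector space of an object is a
  subspace of an arbitrary ambient vector space \<open>'v\<close> over \<open>'k\<close>; this is no restriction, because any
  family of vector spaces embeds into its direct sum (different objects may have the same or
  disjoint underlying spaces).  A morphism is determined by its underlying map, which is
  extensional, i.e. \<open>undefined\<close> outside the underlying space of its source.
  \<open>pure C X Y x y\<close> is the pure tensor \<open>x \<otimes> y\<close> in the underlying space of \<open>X \<otimes> Y\<close>, and \<open>gen C\<close> is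
  the element of the unit object that corresponds to the scalar 1 of the field.
\<close>

record ('k, 'o, 'v) ccat =
  scal :: "'k \<Rightarrow> 'v \<Rightarrow> 'v"
  und :: "'o \<Rightarrow> 'v set"
  mor :: "'o \<Rightarrow> 'o \<Rightarrow> ('v \<Rightarrow> 'v) set"
  tobj :: "'o \<Rightarrow> 'o \<Rightarrow> 'o" (infixr "\<otimes>\<index>" 75)
  pure :: "'o \<Rightarrow> 'o \<Rightarrow> 'v \<Rightarrow> 'v \<Rightarrow> 'v"
  unitobj :: "'o" ("\<I>\<index>")
  gen :: "'v"
  braid :: "'o \<Rightarrow> 'o \<Rightarrow> 'v \<Rightarrow> 'v"

text \<open>Arrows carry their source and target, so that tensor products and composites of arrows
  can be written without annotating objects.\<close>

datatype ('o, 'v) arr = Arr (src: "'o") (trg: "'o") (fn: "'v \<Rightarrow> 'v")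

definition hom :: "('k, 'o, 'v, 'm) ccat_scheme \<Rightarrow> 'o \<Rightarrow> 'o \<Rightarrow> ('o, 'v) arr set" where
  "hom C X Y = {f. src f = X \<and> trg f = Y \<and> fn f \<in> mor C X Y}"

definition ident :: "('k, 'o, 'v, 'm) ccat_scheme \<Rightarrow> 'o \<Rightarrow> ('o, 'v) arr" ("\<one>\<index>") where
  "ident C X = Arr X X (restrict id (und C X))"

definition comp :: "('k, 'o, 'v, 'm) ccat_scheme \<Rightarrow> ('o, 'v) arr \<Rightarrow> ('o, 'v) arr \<Rightarrow> ('o, 'v) arr"
    (infixr "\<cdot>\<index>" 60) where
  "comp C g f = Arr (src f) (trg g) (compose (und C (src f)) (fn g) (fn f))"

definition is_iso :: "('k, 'o, 'v, 'm) ccat_scheme \<Rightarrow> ('o, 'v) arr \<Rightarrow> bool" where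
  "is_iso C f \<longleftrightarrow> f \<in> hom C (src f) (trg f) \<and>
     (\<exists>g \<in> hom C (trg f) (src f). comp C g f = ident C (src f) \<and> comp C f g = ident C (trg f))"

definition inv_arr :: "('k, 'o, 'v, 'm) ccat_scheme \<Rightarrow> ('o, 'v) arr \<Rightarrow> ('o, 'v) arr" where
  "inv_arr C f = Arr (trg f) (src f)
     (restrict (inv_into (und C (src f)) (fn f)) (und C (trg f)))"

definition linmaps ::
    "('k, 'o, 'v::ab_group_add, 'm) ccat_scheme \<Rightarrow> 'v set \<Rightarrow> 'v set \<Rightarrow> ('v \<Rightarrow> 'v) set" where
  "linmaps C V W = {f \<in> V \<rightarrow>\<^sub>E W. (\<forall>x\<in>V. \<forall>y\<in>V. f (x + y) = f x + f y) \<and>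
                                (\<forall>a. \<forall>x\<in>V. f (scal C a x) = scal C a (f x))}"

definition bilinear_on ::
    "('k, 'o, 'v::ab_group_add, 'm) ccat_scheme \<Rightarrow> 'v set \<Rightarrow> 'v set \<Rightarrow> ('v \<Rightarrow> 'v \<Rightarrow> 'v) \<Rightarrow> bool" where
  "bilinear_on C V W b \<longleftrightarrow>
     (\<forall>x\<in>V. restrict (\<lambda>y. b x y) W \<in> linmaps C W UNIV) \<and>
     (\<forall>y\<in>W. restrict (\<lambda>x. b x y) V \<in> linmaps C V UNIV)"

text \<open>The arrows below are the linear maps with the prescribed values on pure tensors; they exist
  and are unique by the universal property of the tensor product required in
  \<open>concrete_tensor_category\<close>.\<close>

definition tarr :: "('k, 'o, 'v::ab_group_add, 'm) ccat_scheme \<Rightarrow> ('o, 'v) arr \<Rightarrow> ('o, 'v) arr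
    \<Rightarrow> ('o, 'v) arr" (infixr "\<boxtimes>\<index>" 75) where
  "tarr C f g = Arr (tobj C (src f) (src g)) (tobj C (trg f) (trg g))
     (THE h. h \<in> linmaps C (und C (tobj C (src f) (src g))) (und C (tobj C (trg f) (trg g))) \<and>
        (\<forall>x\<in>und C (src f). \<forall>y\<in>und C (src g).
           h (pure C (src f) (src g) x y) = pure C (trg f) (trg g) (fn f x) (fn g y)))"

definition assoc :: "('k, 'o, 'v::ab_group_add, 'm) ccat_scheme \<Rightarrow> 'o \<Rightarrow> 'o \<Rightarrow> 'o
    \<Rightarrow> ('o, 'v) arr" ("\<a>\<index>") where
  "assoc C X Y Z = Arr (tobj C (tobj C X Y) Z) (tobj C X (tobj C Y Z))
     (THE h. h \<in> linmaps C (und C (tobj C (tobj C X Y) Z)) (und C (tobj C X (tobj C Y Z))) \<and>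
        (\<forall>x\<in>und C X. \<forall>y\<in>und C Y. \<forall>z\<in>und C Z.
           h (pure C (tobj C X Y) Z (pure C X Y x y) z) =
           pure C X (tobj C Y Z) x (pure C Y Z y z)))"

definition lunit :: "('k, 'o, 'v::ab_group_add, 'm) ccat_scheme \<Rightarrow> 'o \<Rightarrow> ('o, 'v) arr"
    ("\<l>\<index>") where
  "lunit C X = Arr (tobj C (unitobj C) X) X
     (THE h. h \<in> linmaps C (und C (tobj C (unitobj C) X)) (und C X) \<and>
        (\<forall>x\<in>und C X. h (pure C (unitobj C) X (gen C) x) = x))"

definition runit :: "('k, 'o, 'v::ab_group_add, 'm) ccat_scheme \<Rightarrow> 'o \<Rightarrow> ('o, 'v) arr"
    ("\<r>\<index>") where
  "runit C X = Arr (tobj C X (unitobj C)) X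
     (THE h. h \<in> linmaps C (und C (tobj C X (unitobj C))) (und C X) \<and>
        (\<forall>x\<in>und C X. h (pure C X (unitobj C) x (gen C)) = x))"

definition braiding :: "('k, 'o, 'v, 'm) ccat_scheme \<Rightarrow> 'o \<Rightarrow> 'o \<Rightarrow> ('o, 'v) arr" ("\<c>\<index>") where
  "braiding C X Y = Arr (tobj C X Y) (tobj C Y X) (braid C X Y)"

locale concrete_linear_category =
  fixes C :: "('k::field, 'o, 'v::ab_group_add, 'm) ccat_scheme" (structure)
  assumes vector_space_ambient: "vector_space (scal C)"
    and subspace_und: "module.subspace (scal C) (und C X)"
    and mor_linear: "mor C X Y \<subseteq> linmaps C (und C X) (und C Y)"
    and ident_hom: "\<one> X \<in> hom C X X"
    and comp_hom: "\<lbrakk>f \<in> hom C X Y; g \<in> hom C Y Z\<rbrakk> \<Longrightarrow> g \<cdot> f \<in> hom C X Z"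

text \<open>The tensor product is the tensor product of vector spaces, with the usual associativity and
  unit identifications; these only have to be isomorphisms of the category, since their
  naturality and coherence hold on pure tensors.  In \<open>pure_universal\<close> it suffices to let bilinear
  maps take values in the ambient space, which contains a line (\<open>gen_nonzero\<close>).\<close>

locale concrete_tensor_category = concrete_linear_category +
  assumes pure_in: "\<lbrakk>x \<in> und C X; y \<in> und C Y\<rbrakk> \<Longrightarrow> pure C X Y x y \<in> und C (X \<otimes> Y)"
    and pure_bilinear: "bilinear_on C (und C X) (und C Y) (pure C X Y)"
    and pure_universal: "bilinear_on C (und C X) (und C Y) b \<Longrightarrow>
          \<exists>!h. h \<in> linmaps C (und C (X \<otimes> Y)) UNIV \<and>
               (\<forall>x\<in>und C X. \<forall>y\<in>und C Y. h (pure C X Y x y) = b x y)"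
    and und_unit: "und C \<I> = module.span (scal C) {gen C}"
    and gen_nonzero: "gen C \<noteq> 0"
    and tarr_hom: "\<lbrakk>f \<in> hom C X X'; g \<in> hom C Y Y'\<rbrakk> \<Longrightarrow> f \<boxtimes> g \<in> hom C (X \<otimes> Y) (X' \<otimes> Y')"
    and assoc_iso: "is_iso C (\<a> X Y Z)"
    and lunit_iso: "is_iso C (\<l> X)"
    and runit_iso: "is_iso C (\<r> X)"

locale concrete_braided_category = concrete_tensor_category +
  assumes braiding_iso: "is_iso C (\<c> X Y)"
    and braiding_natural: "\<lbrakk>f \<in> hom C X X'; g \<in> hom C Y Y'\<rbrakk> \<Longrightarrow>
          \<c> X' Y' \<cdot> (f \<boxtimes> g) = (g \<boxtimes> f) \<cdot> \<c> X Y"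
    and hexagon1: "\<a> Y Z X \<cdot> \<c> X (Y \<otimes> Z) \<cdot> \<a> X Y Z =
          (\<one> Y \<boxtimes> \<c> X Z) \<cdot> \<a> Y X Z \<cdot> (\<c> X Y \<boxtimes> \<one> Z)"
    and hexagon2: "inv_arr C (\<a> Z X Y) \<cdot> \<c> (X \<otimes> Y) Z \<cdot> inv_arr C (\<a> X Y Z) =
          (\<c> X Z \<boxtimes> \<one> Y) \<cdot> inv_arr C (\<a> X Z Y) \<cdot> (\<one> X \<boxtimes> \<c> Y Z)"

definition fin_dim :: "('k::field, 'o, 'v::ab_group_add, 'm) ccat_scheme \<Rightarrow> 'o \<Rightarrow> bool" where
  "fin_dim C X \<longleftrightarrow> (\<exists>B. finite B \<and> B \<subseteq> und C X \<and> und C X = module.span (scal C) B)"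

definition vdim :: "('k::field, 'o, 'v::ab_group_add, 'm) ccat_scheme \<Rightarrow> 'o \<Rightarrow> nat" where
  "vdim C X = vector_space.dim (scal C) (und C X)"

text \<open>In an arbitrary concrete category a bijective morphism need not be invertible (e.g. for
  filtered vector spaces), so bijectivity of a multiplication map would say nothing about its
  inverse being a morphism.\<close>

definition bijective_morphisms_iso :: "('k::field, 'o, 'v::ab_group_add, 'm) ccat_scheme \<Rightarrow> bool" where
  "bijective_morphisms_iso C \<longleftrightarrow>
     (\<forall>X Y. \<forall>f\<in>hom C X Y. fin_dim C X \<longrightarrow> fin_dim C Y \<longrightarrow>
        bij_betw (fn f) (und C X) (und C Y) \<longrightarrow> is_iso C f)"


section \<open>Bialgebras and Hopf algebras in the category\<close>

record ('o, 'v) bialg =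
  obj :: "'o"
  mlt :: "('o, 'v) arr"
  unt :: "('o, 'v) arr"
  cml :: "('o, 'v) arr"
  cnt :: "('o, 'v) arr"

context
  fixes C :: "('k::field, 'o, 'v::ab_group_add, 'm) ccat_scheme" (structure)
begin

text \<open>The canonical map \<open>(X \<otimes> Y) \<otimes> (Z \<otimes> W) \<rightarrow> X \<otimes> ((Y \<otimes> Z) \<otimes> W)\<close>.\<close>

definition regroup :: "'o \<Rightarrow> 'o \<Rightarrow> 'o \<Rightarrow> 'o \<Rightarrow> ('o, 'v) arr" where
  "regroup X Y Z W = (\<one> X \<boxtimes> inv_arr C (\<a> Y Z W)) \<cdot> \<a> X Y (Z \<otimes> W)"

text \<open>The map \<open>id \<otimes> C \<otimes> id : (X \<otimes> Y) \<otimes> (Z \<otimes> W) \<rightarrow> (X \<otimes> Z) \<otimes> (Y \<otimes> W)\<close>.\<close>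

definition mid_braid :: "'o \<Rightarrow> 'o \<Rightarrow> 'o \<Rightarrow> 'o \<Rightarrow> ('o, 'v) arr" where
  "mid_braid X Y Z W =
     inv_arr C (regroup X Z Y W) \<cdot> (\<one> X \<boxtimes> \<c> Y Z \<boxtimes> \<one> W) \<cdot> regroup X Y Z W"

definition algebra :: "('o, 'v) bialg \<Rightarrow> bool" where
  "algebra A \<longleftrightarrow>
     mlt A \<in> hom C (obj A \<otimes> obj A) (obj A) \<and> unt A \<in> hom C \<I> (obj A) \<and>
     mlt A \<cdot> (mlt A \<boxtimes> \<one> (obj A)) = mlt A \<cdot> (\<one> (obj A) \<boxtimes> mlt A) \<cdot> \<a> (obj A) (obj A) (obj A) \<and>
     mlt A \<cdot> (unt A \<boxtimes> \<one> (obj A)) = \<l> (obj A) \<and>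
     mlt A \<cdot> (\<one> (obj A) \<boxtimes> unt A) = \<r> (obj A)"

definition coalgebra :: "('o, 'v) bialg \<Rightarrow> bool" where
  "coalgebra A \<longleftrightarrow>
     cml A \<in> hom C (obj A) (obj A \<otimes> obj A) \<and> cnt A \<in> hom C (obj A) \<I> \<and>
     \<a> (obj A) (obj A) (obj A) \<cdot> (cml A \<boxtimes> \<one> (obj A)) \<cdot> cml A = (\<one> (obj A) \<boxtimes> cml A) \<cdot> cml A \<and>
     \<l> (obj A) \<cdot> (cnt A \<boxtimes> \<one> (obj A)) \<cdot> cml A = \<one> (obj A) \<and>
     \<r> (obj A) \<cdot> (\<one> (obj A) \<boxtimes> cnt A) \<cdot> cml A = \<one> (obj A)"

definition bialgebra :: "('o, 'v) bialg \<Rightarrow> bool" where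
  "bialgebra A \<longleftrightarrow> algebra A \<and> coalgebra A \<and>
     cml A \<cdot> mlt A = (mlt A \<boxtimes> mlt A) \<cdot> mid_braid (obj A) (obj A) (obj A) (obj A) \<cdot> (cml A \<boxtimes> cml A) \<and>
     cml A \<cdot> unt A = (unt A \<boxtimes> unt A) \<cdot> inv_arr C (\<l> \<I>) \<and>
     cnt A \<cdot> mlt A = \<l> \<I> \<cdot> (cnt A \<boxtimes> cnt A) \<and>
     cnt A \<cdot> unt A = \<one> \<I>"

definition antipode :: "('o, 'v) bialg \<Rightarrow> ('o, 'v) arr \<Rightarrow> bool" where
  "antipode A S \<longleftrightarrow> S \<in> hom C (obj A) (obj A) \<and>
     mlt A \<cdot> (S \<boxtimes> \<one> (obj A)) \<cdot> cml A = unt A \<cdot> cnt A \<and>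
     mlt A \<cdot> (\<one> (obj A) \<boxtimes> S) \<cdot> cml A = unt A \<cdot> cnt A"

text \<open>The antipode is unique, so it is not part of the data.\<close>

definition hopf_algebra :: "('o, 'v) bialg \<Rightarrow> bool" where
  "hopf_algebra A \<longleftrightarrow> bialgebra A \<and> (\<exists>S. antipode A S)"

definition hopf_morphism :: "('o, 'v) bialg \<Rightarrow> ('o, 'v) bialg \<Rightarrow> ('o, 'v) arr \<Rightarrow> bool" where
  "hopf_morphism A B f \<longleftrightarrow> f \<in> hom C (obj A) (obj B) \<and>
     f \<cdot> mlt A = mlt B \<cdot> (f \<boxtimes> f) \<and> f \<cdot> unt A = unt B \<and>
     cml B \<cdot> f = (f \<boxtimes> f) \<cdot> cml A \<and> cnt B \<cdot> f = cnt A \<and>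
     (\<forall>S T. antipode A S \<longrightarrow> antipode B T \<longrightarrow> f \<cdot> S = T \<cdot> f)"

definition hopf_isomorphism :: "('o, 'v) bialg \<Rightarrow> ('o, 'v) bialg \<Rightarrow> ('o, 'v) arr \<Rightarrow> bool" where
  "hopf_isomorphism A B f \<longleftrightarrow>
     hopf_algebra A \<and> hopf_algebra B \<and> hopf_morphism A B f \<and> is_iso C f"

text \<open>A sub-Hopf algebra of \<open>H\<close> is a Hopf algebra \<open>A\<close> in the category together with its inclusion
  \<open>j\<close>, an injective Hopf algebra morphism; the subspace of \<open>H\<close> in question is the image of \<open>j\<close>.\<close>

definition sub_hopf :: "('o, 'v) bialg \<Rightarrow> ('o, 'v) bialg \<Rightarrow> ('o, 'v) arr \<Rightarrow> bool" where
  "sub_hopf H A j \<longleftrightarrow> hopf_algebra A \<and> hopf_morphism A H j \<and> inj_on (fn j) (und C (obj A))"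

definition sub_hopf_subspace :: "('o, 'v) bialg \<Rightarrow> 'v set \<Rightarrow> bool" where
  "sub_hopf_subspace H V \<longleftrightarrow> (\<exists>B j. sub_hopf H B j \<and> fn j ` und C (obj B) = V)"

definition mul :: "('o, 'v) bialg \<Rightarrow> 'v \<Rightarrow> 'v \<Rightarrow> 'v" where
  "mul H x y = fn (mlt H) (pure C (obj H) (obj H) x y)"

text \<open>\<open>V\<^sub>1 V\<^sub>2 \<dots> V\<^sub>r\<close> for a nonempty list of subspaces of \<open>H\<close>; \<open>listset\<close> is the set of lists
  \<open>[v\<^sub>1, \<dots>, v\<^sub>r]\<close> with \<open>v\<^sub>i \<in> V\<^sub>i\<close>.\<close>

definition subspace_product :: "('o, 'v) bialg \<Rightarrow> 'v set list \<Rightarrow> 'v set" where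
  "subspace_product H Vs = module.span (scal C) ((\<lambda>xs. foldl (mul H) (hd xs) (tl xs)) ` listset Vs)"


section \<open>Double cross products\<close>

definition left_module_coalgebra ::
    "('o, 'v) bialg \<Rightarrow> ('o, 'v) bialg \<Rightarrow> ('o, 'v) arr \<Rightarrow> bool" where
  "left_module_coalgebra Y X \<alpha> \<longleftrightarrow> \<alpha> \<in> hom C (obj Y \<otimes> obj X) (obj X) \<and>
     \<alpha> \<cdot> (mlt Y \<boxtimes> \<one> (obj X)) = \<alpha> \<cdot> (\<one> (obj Y) \<boxtimes> \<alpha>) \<cdot> \<a> (obj Y) (obj Y) (obj X) \<and>
     \<alpha> \<cdot> (unt Y \<boxtimes> \<one> (obj X)) = \<l> (obj X) \<and>
     cml X \<cdot> \<alpha> = (\<alpha> \<boxtimes> \<alpha>) \<cdot> mid_braid (obj Y) (obj Y) (obj X) (obj X) \<cdot> (cml Y \<boxtimes> cml X) \<and>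
     cnt X \<cdot> \<alpha> = \<l> \<I> \<cdot> (cnt Y \<boxtimes> cnt X)"

definition right_module_coalgebra ::
    "('o, 'v) bialg \<Rightarrow> ('o, 'v) bialg \<Rightarrow> ('o, 'v) arr \<Rightarrow> bool" where
  "right_module_coalgebra X Y \<beta> \<longleftrightarrow> \<beta> \<in> hom C (obj Y \<otimes> obj X) (obj Y) \<and>
     \<beta> \<cdot> (\<beta> \<boxtimes> \<one> (obj X)) = \<beta> \<cdot> (\<one> (obj Y) \<boxtimes> mlt X) \<cdot> \<a> (obj Y) (obj X) (obj X) \<and>
     \<beta> \<cdot> (\<one> (obj Y) \<boxtimes> unt X) = \<r> (obj Y) \<and>
     cml Y \<cdot> \<beta> = (\<beta> \<boxtimes> \<beta>) \<cdot> mid_braid (obj Y) (obj Y) (obj X) (obj X) \<cdot> (cml Y \<boxtimes> cml X) \<and>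
     cnt Y \<cdot> \<beta> = \<l> \<I> \<cdot> (cnt Y \<boxtimes> cnt X)"

text \<open>The six-fold tensor products of the multiplication are grouped as \<open>X \<otimes> ((\<dots>) \<otimes> Y)\<close>.\<close>

definition double_cross_product ::
    "('o, 'v) bialg \<Rightarrow> ('o, 'v) arr \<Rightarrow> ('o, 'v) arr \<Rightarrow> ('o, 'v) bialg \<Rightarrow> ('o, 'v) bialg" where
  "double_cross_product X \<alpha> \<beta> Y = \<lparr>
     obj = obj X \<otimes> obj Y,
     mlt = (mlt X \<boxtimes> mlt Y) \<cdot>
           inv_arr C (regroup (obj X) (obj X) (obj Y) (obj Y)) \<cdot>
           (\<one> (obj X) \<boxtimes> (\<alpha> \<boxtimes> \<beta>) \<boxtimes> \<one> (obj Y)) \<cdot>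
           (\<one> (obj X) \<boxtimes> mid_braid (obj Y) (obj Y) (obj X) (obj X) \<boxtimes> \<one> (obj Y)) \<cdot>
           (\<one> (obj X) \<boxtimes> (cml Y \<boxtimes> cml X) \<boxtimes> \<one> (obj Y)) \<cdot>
           regroup (obj X) (obj Y) (obj X) (obj Y),
     unt = (unt X \<boxtimes> unt Y) \<cdot> inv_arr C (\<l> \<I>),
     cml = mid_braid (obj X) (obj X) (obj Y) (obj Y) \<cdot> (cml X \<boxtimes> cml Y),
     cnt = \<l> \<I> \<cdot> (cnt X \<boxtimes> cnt Y)\<rparr>"

end


section \<open>Methods of adding brackets\<close>

datatype bracketing = Factor | Pair bracketing bracketing

fun factors :: "bracketing \<Rightarrow> nat" where
  "factors Factor = 1"
| "factors (Pair \<sigma> \<tau>) = factors \<sigma> + factors \<tau>"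

text \<open>\<open>(l, \<tau>) \<in> brackets s \<sigma>\<close>: if the factors of \<open>\<sigma>\<close> are numbered from \<open>s\<close> on, then \<open>\<sigma>\<close> has a pair
  of brackets around the factors \<open>l, \<dots>, l + factors \<tau> - 1\<close>, bracketed by \<open>\<tau>\<close> inside.\<close>

fun brackets :: "nat \<Rightarrow> bracketing \<Rightarrow> (nat \<times> bracketing) set" where
  "brackets s Factor = {}"
| "brackets s (Pair \<sigma> \<tau>) =
     insert (s, Pair \<sigma> \<tau>) (brackets s \<sigma> \<union> brackets (s + factors \<sigma>) \<tau>)"

context
  fixes C :: "('k::field, 'o, 'v::ab_group_add, 'm) ccat_scheme" (structure)
begin

text \<open>A multiple tensor product has to be bracketed in some way: \<open>multi_mult H \<tau>\<close> is the iterated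
  multiplication of \<open>H\<close> on the tensor power of \<open>H\<close> bracketed by \<open>\<tau>\<close>, and
  \<open>mult_on H A j l \<tau>\<close> is its restriction along the inclusions \<open>j\<^sub>l \<otimes> j\<^sub>l\<^sub>+\<^sub>1 \<otimes> \<dots>\<close>
  to \<open>A\<^sub>l \<otimes> A\<^sub>l\<^sub>+\<^sub>1 \<otimes> \<dots>\<close>.\<close>

fun multi_obj :: "(nat \<Rightarrow> ('o, 'v) bialg) \<Rightarrow> nat \<Rightarrow> bracketing \<Rightarrow> 'o" where
  "multi_obj A l Factor = obj (A l)"
| "multi_obj A l (Pair \<sigma> \<tau>) = multi_obj A l \<sigma> \<otimes> multi_obj A (l + factors \<sigma>) \<tau>"

fun multi_arr :: "(nat \<Rightarrow> ('o, 'v) arr) \<Rightarrow> nat \<Rightarrow> bracketing \<Rightarrow> ('o, 'v) arr" where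
  "multi_arr j l Factor = j l"
| "multi_arr j l (Pair \<sigma> \<tau>) = multi_arr j l \<sigma> \<boxtimes> multi_arr j (l + factors \<sigma>) \<tau>"

fun multi_mult :: "('o, 'v) bialg \<Rightarrow> bracketing \<Rightarrow> ('o, 'v) arr" where
  "multi_mult H Factor = \<one> (obj H)"
| "multi_mult H (Pair \<sigma> \<tau>) = mlt H \<cdot> (multi_mult H \<sigma> \<boxtimes> multi_mult H \<tau>)"

definition mult_on :: "('o, 'v) bialg \<Rightarrow> (nat \<Rightarrow> ('o, 'v) arr) \<Rightarrow> nat \<Rightarrow> bracketing \<Rightarrow> ('o, 'v) arr" where
  "mult_on H j l \<tau> = multi_mult H \<tau> \<cdot> multi_arr j l \<tau>"

text \<open>The product \<open>A\<^sub>l A\<^sub>l\<^sub>+\<^sub>1 \<dots>\<close> of \<open>r\<close> consecutive sub-Hopf algebras.\<close>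

definition factor_product ::
    "('o, 'v) bialg \<Rightarrow> (nat \<Rightarrow> ('o, 'v) bialg) \<Rightarrow> (nat \<Rightarrow> ('o, 'v) arr) \<Rightarrow> nat \<Rightarrow> nat \<Rightarrow> 'v set" where
  "factor_product H A j l r =
     subspace_product C H (map (\<lambda>i. fn (j i) ` und C (obj (A i))) [l..<l + r])"

definition brackets_sub_hopf ::
    "('o, 'v) bialg \<Rightarrow> (nat \<Rightarrow> ('o, 'v) bialg) \<Rightarrow> (nat \<Rightarrow> ('o, 'v) arr) \<Rightarrow> bracketing \<Rightarrow> bool" where
  "brackets_sub_hopf H A j \<sigma> \<longleftrightarrow>
     (\<forall>(l, \<tau>) \<in> brackets 1 \<sigma>. sub_hopf_subspace C H (factor_product H A j l (factors \<tau>)))"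

definition inner_double_factorization ::
    "('o, 'v) bialg \<Rightarrow> (nat \<Rightarrow> ('o, 'v) bialg) \<Rightarrow> (nat \<Rightarrow> ('o, 'v) arr) \<Rightarrow> bracketing \<Rightarrow> bool" where
  "inner_double_factorization H A j \<sigma> \<longleftrightarrow>
     factor_product H A j 1 (factors \<sigma>) = und C (obj H) \<and>
     (\<forall>(l, \<tau>) \<in> brackets 1 \<sigma>.
        sub_hopf_subspace C H (factor_product H A j l (factors \<tau>)) \<and>
        bij_betw (fn (mult_on H j l \<tau>)) (und C (multi_obj A l \<tau>))
                 (factor_product H A j l (factors \<tau>)))"

text \<open>The double cross products of the factors numbered from \<open>l\<close> on, formed as prescribed by the
  bracketing.  The symbol joining the two parts of \<open>Pair \<sigma> \<tau>\<close> stands between the factors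
  \<open>l + factors \<sigma> - 1\<close> and \<open>l + factors \<sigma>\<close>, and its index is the former number.\<close>

fun multi_dcp :: "(nat \<Rightarrow> ('o, 'v) bialg) \<Rightarrow> (nat \<Rightarrow> ('o, 'v) arr) \<Rightarrow> (nat \<Rightarrow> ('o, 'v) arr)
    \<Rightarrow> nat \<Rightarrow> bracketing \<Rightarrow> ('o, 'v) bialg" where
  "multi_dcp A \<alpha> \<beta> l Factor = A l"
| "multi_dcp A \<alpha> \<beta> l (Pair \<sigma> \<tau>) =
     double_cross_product C (multi_dcp A \<alpha> \<beta> l \<sigma>)
       (\<alpha> (l + factors \<sigma> - 1)) (\<beta> (l + factors \<sigma> - 1))
       (multi_dcp A \<alpha> \<beta> (l + factors \<sigma>) \<tau>)"

text \<open>All the double cross products occurring in \<open>multi_dcp\<close> are legitimate: their factors are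
  bialgebras and the actions are module coalgebra structures.\<close>

fun multi_dcp_defined :: "(nat \<Rightarrow> ('o, 'v) bialg) \<Rightarrow> (nat \<Rightarrow> ('o, 'v) arr) \<Rightarrow> (nat \<Rightarrow> ('o, 'v) arr)
    \<Rightarrow> nat \<Rightarrow> bracketing \<Rightarrow> bool" where
  "multi_dcp_defined A \<alpha> \<beta> l Factor \<longleftrightarrow> bialgebra C (A l)"
| "multi_dcp_defined A \<alpha> \<beta> l (Pair \<sigma> \<tau>) \<longleftrightarrow>
     multi_dcp_defined A \<alpha> \<beta> l \<sigma> \<and> multi_dcp_defined A \<alpha> \<beta> (l + factors \<sigma>) \<tau> \<and>
     (let i = l + factors \<sigma> - 1;
          X = multi_dcp A \<alpha> \<beta> l \<sigma>;
          Y = multi_dcp A \<alpha> \<beta> (l + factors \<sigma>) \<tau>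
      in bialgebra C X \<and> bialgebra C Y \<and>
         left_module_coalgebra C Y X (\<alpha> i) \<and> right_module_coalgebra C X Y (\<beta> i))"

end

end

theory Submission
  imports Defs
begin

text \<open>
  Write \<open>\<mu>\<close> for the multiplication map of all factors,
  \<open>A\<^sub>1 \<otimes> \<dots> \<otimes> A\<^sub>n \<rightarrow> H\<close>, the source being bracketed by \<open>\<sigma>\<close>.  It is onto, since
  \<open>H = A\<^sub>1 \<dots> A\<^sub>n\<close>.  Hence the dimension formula says that \<open>\<mu>\<close> is bijective, and it remains to
  see what bijectivity of \<open>\<mu>\<close> means for the inner brackets and for the double cross products.

  For an inner bracket, its multiplication map is \<open>\<mu>\<close> restricted to tensors with entry \<open>1\<close> in all
  other places; as those entries can be removed again by counits, it is injective whenever \<open>\<mu>\<close> is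
  (\<open>inj_on_brackets\<close>).  This settles the equivalence of the first two statements, and an
  isomorphism is bijective, so the third implies the second.

  For the remaining implication let \<open>X\<close> and \<open>Y\<close> be the two parts of a bracket, with
  multiplication map \<open>\<theta> : X \<otimes> Y \<rightarrow> H\<close>.  The image \<open>XY\<close> is closed under multiplication, so it
  contains \<open>YX\<close>, and a product \<open>y x\<close> can be rewritten as a sum of products in the other order; this
  is a map \<open>\<zeta> : Y \<otimes> X \<rightarrow> X \<otimes> Y\<close> with \<open>\<theta> (\<zeta> (y \<otimes> x)) = y x\<close>.  Since \<open>\<theta>\<close> is a coalgebra morphism,
  so is \<open>\<zeta>\<close>, and therefore \<open>\<zeta> = (\<alpha> \<otimes> \<beta>) \<Delta>\<close> where \<open>\<alpha>\<close> and \<open>\<beta>\<close> are the components of \<open>\<zeta>\<close>,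
  obtained by applying the counit of \<open>Y\<close> and of \<open>X\<close>.  Multiplying in \<open>H\<close> as
  \<open>(x y) (x' y') = x (y x') y'\<close> then shows that \<open>\<theta>\<close> is multiplicative on the double cross product.
  All axioms of a bialgebra hold in it because they hold in \<open>H\<close> and \<open>\<theta>\<close> is a split monomorphism
  (\<open>bialgebra_transport\<close>), and the module axioms for \<open>\<alpha>\<close> and \<open>\<beta>\<close> express associativity of \<open>H\<close>.
  An induction along the bracketing concludes (\<open>ex_multi_dcp\<close>).

  The delicate point is that \<open>\<alpha>\<close> and \<open>\<beta>\<close> have to be morphisms of the category and not only linear
  maps.  At an inner bracket \<open>\<theta>\<close> need not map onto \<open>H\<close>, and a morphism to \<open>H\<close> with image in
  \<open>XY\<close> need not factor, within the category, through the inclusion of \<open>XY\<close>.  But \<open>\<mu>\<close> as a whole is an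
  isomorphism of the category, and composing its inverse with the counits of the other factors
  yields a morphism \<open>p : H \<rightarrow> X \<otimes> Y\<close> with \<open>p \<theta> = id\<close>.  So \<open>\<zeta>\<close> can be taken to be \<open>p\<close> after the
  multiplication of \<open>Y\<close> and \<open>X\<close>.  The case of two factors is therefore treated relative to
  such a retraction, in the locale \<open>split_product\<close>.
\<close>

section \<open>Arrows as linear maps\<close>

text \<open>Membership in \<open>hom\<close> with source and target read off from the arrow itself: composability
  becomes an equation between \<open>src\<close> and \<open>trg\<close>, which the simplifier can decide.\<close>

definition is_arr :: "('k, 'o, 'v, 'm) ccat_scheme \<Rightarrow> ('o, 'v) arr \<Rightarrow> bool" where
  "is_arr C f \<longleftrightarrow> f \<in> hom C (src f) (trg f)"

context
  fixes C :: "('k::field, 'o, 'v::ab_group_add, 'm) ccat_scheme" (structure)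
begin

lemma src_trg_simps [simp]:
  "src (g \<cdot> f) = src f" "trg (g \<cdot> f) = trg g"
  "src (\<one> X) = X" "trg (\<one> X) = X"
  "src (f \<boxtimes> g) = src f \<otimes> src g" "trg (f \<boxtimes> g) = trg f \<otimes> trg g"
  "src (\<a> X Y Z) = (X \<otimes> Y) \<otimes> Z" "trg (\<a> X Y Z) = X \<otimes> (Y \<otimes> Z)"
  "src (\<l> X) = \<I> \<otimes> X" "trg (\<l> X) = X"
  "src (\<r> X) = X \<otimes> \<I>" "trg (\<r> X) = X"
  "src (\<c> X Y) = X \<otimes> Y" "trg (\<c> X Y) = Y \<otimes> X"
  "src (inv_arr C f) = trg f" "trg (inv_arr C f) = src f"
  by (simp_all add: comp_def ident_def tarr_def assoc_def lunit_def runit_def braiding_def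
      inv_arr_def)

lemma homI: "is_arr C f \<Longrightarrow> src f = X \<Longrightarrow> trg f = Y \<Longrightarrow> f \<in> hom C X Y"
  by (auto simp: is_arr_def)

lemma homD:
  assumes "f \<in> hom C X Y"
  shows "is_arr C f" "src f = X" "trg f = Y"
  using assms by (auto simp: is_arr_def hom_def)

lemma fn_comp [simp]: "x \<in> und C (src f) \<Longrightarrow> fn (g \<cdot> f) x = fn g (fn f x)"
  by (simp add: comp_def compose_def)

lemma fn_ident [simp]: "x \<in> und C X \<Longrightarrow> fn (\<one> X) x = x"
  by (simp add: ident_def)

lemma linmaps_D:
  assumes "f \<in> linmaps C V W"
  shows "x \<in> V \<Longrightarrow> f x \<in> W" "x \<in> V \<Longrightarrow> y \<in> V \<Longrightarrow> f (x + y) = f x + f y"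
    "x \<in> V \<Longrightarrow> f (scal C a x) = scal C a (f x)" "f \<in> extensional V"
  using assms by (auto simp: linmaps_def PiE_def)

end

context concrete_linear_category
begin

sublocale VS: vector_space "scal C" by (rule vector_space_ambient)
sublocale VP: vector_space_pair "scal C" "scal C" ..

declare subspace_und [simp]

lemma und_add [simp]: "x \<in> und C X \<Longrightarrow> y \<in> und C X \<Longrightarrow> x + y \<in> und C X"
  by (rule VS.subspace_add[OF subspace_und])

lemma und_scal [simp]: "x \<in> und C X \<Longrightarrow> scal C a x \<in> und C X"
  by (rule VS.subspace_scale[OF subspace_und])

lemma und_zero [simp]: "0 \<in> und C X"
  by (rule VS.subspace_0[OF subspace_und])

lemma linmaps_zero: "f \<in> linmaps C V W \<Longrightarrow> VS.subspace V \<Longrightarrow> f 0 = 0"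
  using linmaps_D(3)[of f C V W 0 0] VS.subspace_0[of V] by simp

text \<open>Extension to the ambient space, from a basis, makes results on total linear maps applicable to
  linear maps between underlying spaces.\<close>

lemma linmaps_extend:
  assumes f: "f \<in> linmaps C V W" and V: "VS.subspace V"
  obtains g where "Vector_Spaces.linear (scal C) (scal C) g" "\<And>x. x \<in> V \<Longrightarrow> g x = f x"
proof -
  obtain B where B: "B \<subseteq> V" "VS.independent B" "V \<subseteq> VS.span B"
    using VS.maximal_independent_subset by blast
  obtain g where g: "Vector_Spaces.linear (scal C) (scal C) g" "\<forall>x\<in>B. g x = f x"
    using VP.linear_independent_extend[OF B(2)] by blast
  have "VS.subspace {x \<in> V. g x = f x}"
    unfolding VS.subspace_def
    using V g(1) f
    by (auto simp: VS.subspace_0 VS.subspace_add VS.subspace_scale linmaps_zero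
        VP.linear_0 VP.linear_add VP.linear_scale linmaps_D)
  then have "VS.span B \<subseteq> {x \<in> V. g x = f x}"
    using B(1) g(2) by (intro VS.span_minimal) auto
  then show thesis using that[of g] g(1) B(3) by blast
qed

lemma is_arr_linmaps: "is_arr C f \<Longrightarrow> fn f \<in> linmaps C (und C (src f)) (und C (trg f))"
  using mor_linear by (auto simp: is_arr_def hom_def)

lemma fn_in [simp]: "is_arr C f \<Longrightarrow> trg f = Y \<Longrightarrow> x \<in> und C (src f) \<Longrightarrow> fn f x \<in> und C Y"
  using linmaps_D(1)[OF is_arr_linmaps] by auto

lemma fn_add: "is_arr C f \<Longrightarrow> x \<in> und C (src f) \<Longrightarrow> y \<in> und C (src f) \<Longrightarrow>
    fn f (x + y) = fn f x + fn f y"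
  using linmaps_D(2)[OF is_arr_linmaps] by blast

lemma fn_scal: "is_arr C f \<Longrightarrow> x \<in> und C (src f) \<Longrightarrow> fn f (scal C a x) = scal C a (fn f x)"
  using linmaps_D(3)[OF is_arr_linmaps] by blast

lemma is_arr_ident [simp]: "is_arr C (\<one> X)"
  using ident_hom[of X] by (auto simp: is_arr_def)

lemma is_arr_comp [simp]: "is_arr C f \<Longrightarrow> is_arr C g \<Longrightarrow> trg f = src g \<Longrightarrow> is_arr C (g \<cdot> f)"
  using comp_hom[of f "src f" "trg f" g "trg g"] by (auto simp: is_arr_def)

lemma arr_eqI:
  assumes "is_arr C f" "is_arr C g" "src f = src g" "trg f = trg g"
    "\<And>x. x \<in> und C (src f) \<Longrightarrow> fn f x = fn g x"
  shows "f = g"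
proof -
  have "fn f = fn g"
    using assms linmaps_D(4)[OF is_arr_linmaps, of f] linmaps_D(4)[OF is_arr_linmaps, of g]
    by (intro extensionalityI[of _ "und C (src f)"]) auto
  then show ?thesis using assms by (cases f; cases g) auto
qed

lemma comp_assoc [simp]:
  assumes "is_arr C f" "trg f = src g"
  shows "(h \<cdot> g) \<cdot> f = h \<cdot> (g \<cdot> f)"
  using assms fn_in[OF assms(1) assms(2)] unfolding comp_def
  by (auto simp: compose_def restrict_def fun_eq_iff)

lemma comp_ident_left [simp]: "is_arr C f \<Longrightarrow> trg f = X \<Longrightarrow> \<one> X \<cdot> f = f"
  by (rule arr_eqI) auto

lemma comp_ident_right [simp]: "is_arr C f \<Longrightarrow> src f = X \<Longrightarrow> f \<cdot> \<one> X = f"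
  by (rule arr_eqI) auto

lemma is_iso_is_arr: "is_iso C f \<Longrightarrow> is_arr C f"
  by (auto simp: is_iso_def is_arr_def)

lemma is_iso_bij:
  assumes "is_iso C f"
  shows "bij_betw (fn f) (und C (src f)) (und C (trg f))"
proof -
  obtain g where g: "g \<in> hom C (trg f) (src f)" "g \<cdot> f = \<one> (src f)" "f \<cdot> g = \<one> (trg f)"
    using assms by (auto simp: is_iso_def)
  note gD = homD[OF g(1)] and fa = is_iso_is_arr[OF assms]
  have "fn g (fn f x) = x" if "x \<in> und C (src f)" for x
    using arg_cong[OF g(2), of "\<lambda>h. fn h x"] that by simp
  moreover have "fn f (fn g x) = x" if "x \<in> und C (trg f)" for x
    using arg_cong[OF g(3), of "\<lambda>h. fn h x"] that gD by simp
  ultimately show ?thesis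
    using fa gD by (intro bij_betwI[of _ _ _ "fn g"]) auto
qed

text \<open>The inverse function is again a morphism, because it coincides with the inverse arrow that exists
  by definition of an isomorphism.\<close>

lemma inv_arr_props:
  assumes "is_iso C f"
  shows is_arr_inv: "is_arr C (inv_arr C f)"
    and inv_comp: "inv_arr C f \<cdot> f = \<one> (src f)"
    and comp_inv: "f \<cdot> inv_arr C f = \<one> (trg f)"
proof -
  obtain g where g: "g \<in> hom C (trg f) (src f)" "g \<cdot> f = \<one> (src f)" "f \<cdot> g = \<one> (trg f)"
    using assms by (auto simp: is_iso_def)
  note gD = homD[OF g(1)] and fa = is_iso_is_arr[OF assms]
  have fg: "fn f (fn g x) = x" if "x \<in> und C (trg f)" for x
    using arg_cong[OF g(3), of "\<lambda>h. fn h x"] that gD by simp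
  have "inv_into (und C (src f)) (fn f) x = fn g x" if "x \<in> und C (trg f)" for x
    using that fg[OF that] bij_betw_imp_inj_on[OF is_iso_bij[OF assms]] gD
    by (intro inv_into_f_eq) auto
  then have "fn (inv_arr C f) = fn g"
    using linmaps_D(4)[OF is_arr_linmaps, of g] gD
    by (intro extensionalityI[of _ "und C (trg f)"]) (auto simp: inv_arr_def)
  then have "inv_arr C f = g" using gD by (cases g) (auto simp: inv_arr_def)
  then show "is_arr C (inv_arr C f)" "inv_arr C f \<cdot> f = \<one> (src f)"
    "f \<cdot> inv_arr C f = \<one> (trg f)" using g gD by auto
qed

lemma fn_inv: "is_iso C f \<Longrightarrow> x \<in> und C (src f) \<Longrightarrow> fn f x = y \<Longrightarrow> fn (inv_arr C f) y = x"
  using arg_cong[OF inv_comp, of f "\<lambda>h. fn h x"] by auto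

lemma is_isoI:
  assumes "is_arr C f" "is_arr C g" "src g = trg f" "trg g = src f"
    "g \<cdot> f = \<one> (src f)" "f \<cdot> g = \<one> (trg f)"
  shows "is_iso C f"
  unfolding is_iso_def using assms by (auto simp: is_arr_def)

lemma inv_comp_tail: "is_iso C f \<Longrightarrow> is_arr C h \<Longrightarrow> trg h = src f \<Longrightarrow> inv_arr C f \<cdot> (f \<cdot> h) = h"
  using is_iso_is_arr[of f] is_arr_inv[of f] inv_comp[of f]
  by (simp flip: comp_assoc)

lemma comp_inv_tail: "is_iso C f \<Longrightarrow> is_arr C h \<Longrightarrow> trg h = trg f \<Longrightarrow> f \<cdot> (inv_arr C f \<cdot> h) = h"
  using is_iso_is_arr[of f] is_arr_inv[of f] comp_inv[of f]
  by (simp flip: comp_assoc)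

lemma is_iso_comp:
  assumes "is_iso C f" "is_iso C g" "trg f = src g"
  shows "is_iso C (g \<cdot> f)"
  using assms is_iso_is_arr[of f] is_iso_is_arr[of g] is_arr_inv[of f] is_arr_inv[of g]
  by (intro is_isoI[of _ "inv_arr C f \<cdot> inv_arr C g"])
    (auto simp: comp_inv_tail inv_comp_tail comp_inv inv_comp)

lemma is_iso_ident [simp]: "is_iso C (\<one> X)"
  by (rule is_isoI[of _ "\<one> X"]) auto

lemma is_iso_inv: "is_iso C f \<Longrightarrow> is_iso C (inv_arr C f)"
  using is_iso_is_arr[of f] is_arr_inv[of f]
  by (intro is_isoI[of _ f]) (auto simp: comp_inv inv_comp)

end

section \<open>Tensor products of spaces and of arrows\<close>

context concrete_tensor_category
begin

declare pure_in [simp]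

lemma pure_simps:
  "x \<in> und C X \<Longrightarrow> x' \<in> und C X \<Longrightarrow> y \<in> und C Y \<Longrightarrow>
    pure C X Y (x + x') y = pure C X Y x y + pure C X Y x' y"
  "x \<in> und C X \<Longrightarrow> y \<in> und C Y \<Longrightarrow> y' \<in> und C Y \<Longrightarrow>
    pure C X Y x (y + y') = pure C X Y x y + pure C X Y x y'"
  "x \<in> und C X \<Longrightarrow> y \<in> und C Y \<Longrightarrow> pure C X Y (scal C a x) y = scal C a (pure C X Y x y)"
  "x \<in> und C X \<Longrightarrow> y \<in> und C Y \<Longrightarrow> pure C X Y x (scal C a y) = scal C a (pure C X Y x y)"
proof -
  have L: "restrict (\<lambda>x. pure C X Y x y) (und C X) \<in> linmaps C (und C X) UNIV"
    if "y \<in> und C Y" for y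
    using pure_bilinear that by (auto simp: bilinear_on_def)
  have R: "restrict (\<lambda>y. pure C X Y x y) (und C Y) \<in> linmaps C (und C Y) UNIV"
    if "x \<in> und C X" for x
    using pure_bilinear that by (auto simp: bilinear_on_def)
  show "x \<in> und C X \<Longrightarrow> x' \<in> und C X \<Longrightarrow> y \<in> und C Y \<Longrightarrow>
    pure C X Y (x + x') y = pure C X Y x y + pure C X Y x' y"
    using linmaps_D(2)[OF L, of y x x'] by simp
  show "x \<in> und C X \<Longrightarrow> y \<in> und C Y \<Longrightarrow> y' \<in> und C Y \<Longrightarrow>
    pure C X Y x (y + y') = pure C X Y x y + pure C X Y x y'"
    using linmaps_D(2)[OF R, of x y y'] by simp
  show "x \<in> und C X \<Longrightarrow> y \<in> und C Y \<Longrightarrow> pure C X Y (scal C a x) y = scal C a (pure C X Y x y)"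
    using linmaps_D(3)[OF L, of y x a] by simp
  show "x \<in> und C X \<Longrightarrow> y \<in> und C Y \<Longrightarrow> pure C X Y x (scal C a y) = scal C a (pure C X Y x y)"
    using linmaps_D(3)[OF R, of x y a] by simp
qed

lemma bilinear_onI:
  assumes "VS.subspace V" "VS.subspace W"
    "\<And>x x' y. x \<in> V \<Longrightarrow> x' \<in> V \<Longrightarrow> y \<in> W \<Longrightarrow> b (x + x') y = b x y + b x' y"
    "\<And>x y y'. x \<in> V \<Longrightarrow> y \<in> W \<Longrightarrow> y' \<in> W \<Longrightarrow> b x (y + y') = b x y + b x y'"
    "\<And>a x y. x \<in> V \<Longrightarrow> y \<in> W \<Longrightarrow> b (scal C a x) y = scal C a (b x y)"
    "\<And>a x y. x \<in> V \<Longrightarrow> y \<in> W \<Longrightarrow> b x (scal C a y) = scal C a (b x y)"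
  shows "bilinear_on C V W b"
  unfolding bilinear_on_def linmaps_def
  using assms by (auto simp: VS.subspace_add VS.subspace_scale)

lemma ex1_unique: "\<exists>!h. Q h \<Longrightarrow> Q a \<Longrightarrow> Q b \<Longrightarrow> a = b"
  by blast

text \<open>If the pure tensors spanned a proper subspace, the zero map and some nonzero linear map would
  agree on all of them, against the uniqueness in the universal property.\<close>

lemma und_tensor: "und C (X \<otimes> Y) = VS.span {pure C X Y x y | x y. x \<in> und C X \<and> y \<in> und C Y}"
    (is "?T = VS.span ?P")
proof
  show "VS.span ?P \<subseteq> ?T" by (rule VS.span_minimal) auto
  show "?T \<subseteq> VS.span ?P"
  proof (rule ccontr)
    assume "\<not> ?T \<subseteq> VS.span ?P"
    then obtain w where w: "w \<in> ?T" "w \<notin> VS.span ?P" by blast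
    (* A linear map that kills the pure tensors and fixes w. *)
    obtain B where B: "B \<subseteq> ?P" "VS.independent B" "?P \<subseteq> VS.span B"
      using VS.maximal_independent_subset by blast
    have sp: "VS.span B = VS.span ?P"
      using B VS.span_mono[OF B(1)] VS.span_minimal[OF B(3) VS.subspace_span] by blast
    then have wB: "w \<notin> VS.span B" using w by simp
    then have "VS.independent (insert w B)" using B(2) by (simp add: VS.independent_insert)
    then obtain g where g: "Vector_Spaces.linear (scal C) (scal C) g" "\<forall>x\<in>insert w B. g x = (if x = w then w else 0)"
      using VP.linear_independent_extend[of "insert w B" "\<lambda>x. if x = w then w else 0"] by blast
    have "w \<notin> B" using wB VS.span_base by blast
    then have "\<forall>x\<in>B. g x = 0" using g(2) by auto
    then have gz: "g x = 0" if "x \<in> ?P" for x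
      using VP.linear_eq_0_on_span[OF g(1), of B x] that B(3) by blast
    have gw: "g w \<noteq> 0" using g(2) w(2) VS.span_zero by auto
    have lin: "restrict g ?T \<in> linmaps C ?T UNIV" "restrict (scal C 0) ?T \<in> linmaps C ?T UNIV"
      using g(1) by (auto simp: linmaps_def VP.linear_add VP.linear_scale)
    have "bilinear_on C (und C X) (und C Y) (\<lambda>_ _. 0)" by (rule bilinear_onI) auto
    then have ex1: "\<exists>!h. h \<in> linmaps C ?T UNIV \<and> (\<forall>x\<in>und C X. \<forall>y\<in>und C Y. h (pure C X Y x y) = 0)"
      by (rule pure_universal)
    have 0: "\<forall>x\<in>und C X. \<forall>y\<in>und C Y. restrict g ?T (pure C X Y x y) = 0"
      "\<forall>x\<in>und C X. \<forall>y\<in>und C Y. restrict (scal C 0) ?T (pure C X Y x y) = 0"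
      using gz by auto
    have "restrict g ?T = restrict (scal C 0) ?T"
      by (rule ex1_unique[OF ex1, OF conjI[OF lin(1) 0(1)] conjI[OF lin(2) 0(2)]])
    from fun_cong[OF this, of w] have "g w = 0" using w(1) by simp
    then show False using gw by simp
  qed
qed

text \<open>The case of pure tensors covers scalar multiples, as a scalar multiple of a pure tensor is
  pure.\<close>

lemma tensor_induct [consumes 1, case_names pure add]:
  assumes "t \<in> und C (X \<otimes> Y)"
    and p: "\<And>x y. x \<in> und C X \<Longrightarrow> y \<in> und C Y \<Longrightarrow> P (pure C X Y x y)"
    and a: "\<And>s t. s \<in> und C (X \<otimes> Y) \<Longrightarrow> t \<in> und C (X \<otimes> Y) \<Longrightarrow> P s \<Longrightarrow> P t \<Longrightarrow> P (s + t)"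
  shows "P t"
proof -
  let ?P = "{pure C X Y x y | x y. x \<in> und C X \<and> y \<in> und C Y}"
  have "t \<in> VS.span ?P" using assms(1) by (simp add: und_tensor)
  then have "P t \<and> t \<in> und C (X \<otimes> Y)"
  proof (induction rule: VS.span_induct_alt)
    case base
    show ?case using p[of 0 0] pure_simps(3)[of 0 X 0 Y 0] by auto
  next
    case (step c x t)
    then obtain u v where uv: "u \<in> und C X" "v \<in> und C Y" "x = pure C X Y u v" by blast
    then have "P (scal C c x)" using p[of "scal C c u" v] by (simp add: pure_simps)
    then show ?case using step uv a by auto
  qed
  then show ?thesis ..
qed

lemma linmaps_tensor_eqI:
  assumes "h \<in> linmaps C (und C (X \<otimes> Y)) W" "h' \<in> linmaps C (und C (X \<otimes> Y)) W'"
    "\<And>x y. x \<in> und C X \<Longrightarrow> y \<in> und C Y \<Longrightarrow> h (pure C X Y x y) = h' (pure C X Y x y)"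
  shows "h = h'"
proof (rule extensionalityI[OF linmaps_D(4)[OF assms(1)] linmaps_D(4)[OF assms(2)]])
  fix t assume "t \<in> und C (X \<otimes> Y)"
  then show "h t = h' t"
  proof (induction t rule: tensor_induct)
    case (pure x y)
    then show ?case by (rule assms(3))
  next
    case (add s t)
    then show ?case
      by (simp only: linmaps_D(2)[OF assms(1)] linmaps_D(2)[OF assms(2)])
  qed
qed

lemma bilinear_lift:
  assumes b: "bilinear_on C (und C X) (und C Y) b" and W: "VS.subspace W"
    "\<And>x y. x \<in> und C X \<Longrightarrow> y \<in> und C Y \<Longrightarrow> b x y \<in> W"
  obtains h where "h \<in> linmaps C (und C (X \<otimes> Y)) W"
    "\<And>x y. x \<in> und C X \<Longrightarrow> y \<in> und C Y \<Longrightarrow> h (pure C X Y x y) = b x y"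
proof -
  obtain h where h: "h \<in> linmaps C (und C (X \<otimes> Y)) UNIV"
    "\<forall>x\<in>und C X. \<forall>y\<in>und C Y. h (pure C X Y x y) = b x y"
    using pure_universal[OF b] by blast
  have "h t \<in> W" if "t \<in> und C (X \<otimes> Y)" for t
    using that
    by (induction t rule: tensor_induct)
      (simp_all add: h(2) W linmaps_D(2)[OF h(1)] VS.subspace_add)
  then have "h \<in> linmaps C (und C (X \<otimes> Y)) W" using h(1) by (auto simp: linmaps_def)
  then show thesis using h(2) that by blast
qed

lemma is_arr_tarr [simp]: "is_arr C f \<Longrightarrow> is_arr C g \<Longrightarrow> is_arr C (f \<boxtimes> g)"
  using tarr_hom[of f "src f" "trg f" g "src g" "trg g"] by (auto simp: is_arr_def)

lemma fn_tarr [simp]: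
  assumes fg: "is_arr C f" "is_arr C g" and st: "src f = X" "src g = Y"
    and xy: "x \<in> und C X" "y \<in> und C Y"
  shows "fn (f \<boxtimes> g) (pure C X Y x y) = pure C (trg f) (trg g) (fn f x) (fn g y)"
proof -
  let ?P = "\<lambda>h. h \<in> linmaps C (und C (src f \<otimes> src g)) (und C (trg f \<otimes> trg g)) \<and>
     (\<forall>x\<in>und C (src f). \<forall>y\<in>und C (src g).
           h (pure C (src f) (src g) x y) = pure C (trg f) (trg g) (fn f x) (fn g y))"
  have "bilinear_on C (und C (src f)) (und C (src g)) (\<lambda>x y. pure C (trg f) (trg g) (fn f x) (fn g y))"
    using fg by (intro bilinear_onI) (auto simp: fn_add fn_scal pure_simps)
  then obtain h where h: "?P h"
    by (rule bilinear_lift[where W = "und C (trg f \<otimes> trg g)"]) (use fg in auto)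
  have "?P (THE h. ?P h)"
    by (rule theI[of ?P, OF h]) (use h in \<open>intro linmaps_tensor_eqI[of _ "src f" "src g"], auto\<close>)
  then show ?thesis using st xy by (simp add: tarr_def)
qed

text \<open>The associativity map exists: for fixed \<open>z\<close> the value is bilinear in \<open>x\<close> and \<open>y\<close>, and the
  resulting linear map on \<open>X \<otimes> Y\<close> depends linearly on \<open>z\<close>.\<close>

lemma fn_assoc [simp]:
  assumes xyz: "x \<in> und C X" "y \<in> und C Y" "z \<in> und C Z"
  shows "fn (\<a> X Y Z) (pure C (X \<otimes> Y) Z (pure C X Y x y) z) = pure C X (Y \<otimes> Z) x (pure C Y Z y z)"
proof -
  let ?W = "und C (X \<otimes> (Y \<otimes> Z))"
  let ?P = "\<lambda>h. h \<in> linmaps C (und C ((X \<otimes> Y) \<otimes> Z)) ?W \<and>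
     (\<forall>x\<in>und C X. \<forall>y\<in>und C Y. \<forall>z\<in>und C Z.
           h (pure C (tobj C X Y) Z (pure C X Y x y) z) =
           pure C X (tobj C Y Z) x (pure C Y Z y z))"
  have "\<exists>k. k \<in> linmaps C (und C (X \<otimes> Y)) ?W \<and>
      (\<forall>x\<in>und C X. \<forall>y\<in>und C Y. k (pure C X Y x y) = pure C X (Y \<otimes> Z) x (pure C Y Z y z))"
    if z: "z \<in> und C Z" for z
  proof -
    have "bilinear_on C (und C X) (und C Y) (\<lambda>x y. pure C X (Y \<otimes> Z) x (pure C Y Z y z))"
      using z by (intro bilinear_onI) (auto simp: pure_simps)
    then show ?thesis
      by (rule bilinear_lift[where W = ?W]) (use z in auto)
  qed
  then obtain k where k: "\<And>z. z \<in> und C Z \<Longrightarrow> k z \<in> linmaps C (und C (X \<otimes> Y)) ?W"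
    "\<And>x y z. x \<in> und C X \<Longrightarrow> y \<in> und C Y \<Longrightarrow> z \<in> und C Z \<Longrightarrow>
      k z (pure C X Y x y) = pure C X (Y \<otimes> Z) x (pure C Y Z y z)"
    by metis
  note kD = linmaps_D[OF k(1)]
  have kadd: "k (z + z') t = k z t + k z' t"
    if "t \<in> und C (X \<otimes> Y)" "z \<in> und C Z" "z' \<in> und C Z" for t z z'
    using that(1)
    by (induction t rule: tensor_induct) (use that(2,3) in \<open>auto simp: k(2) kD(2) pure_simps\<close>)
  have kscal: "k (scal C a z) t = scal C a (k z t)"
    if "t \<in> und C (X \<otimes> Y)" "z \<in> und C Z" for t z a
    using that(1)
    by (induction t rule: tensor_induct)
      (use that(2) in \<open>auto simp: k(2) kD(2) pure_simps VS.scale_right_distrib\<close>)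
  have "bilinear_on C (und C (X \<otimes> Y)) (und C Z) (\<lambda>t z. k z t)"
    by (intro bilinear_onI) (auto simp: kadd kscal kD)
  then obtain h where h0: "h \<in> linmaps C (und C ((X \<otimes> Y) \<otimes> Z)) ?W"
    "\<And>t z. t \<in> und C (X \<otimes> Y) \<Longrightarrow> z \<in> und C Z \<Longrightarrow> h (pure C (X \<otimes> Y) Z t z) = k z t"
    by (rule bilinear_lift[where W = ?W]) (auto simp: kD)
  then have h: "?P h" by (auto simp: k(2))
  have "h1 = h2" if 12: "?P h1" "?P h2" for h1 h2
  proof (rule linmaps_tensor_eqI[of _ "X \<otimes> Y" Z])
    show lin: "h1 \<in> linmaps C (und C ((X \<otimes> Y) \<otimes> Z)) ?W"
      "h2 \<in> linmaps C (und C ((X \<otimes> Y) \<otimes> Z)) ?W" using 12 by auto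
    fix t z assume tz: "t \<in> und C (X \<otimes> Y)" "z \<in> und C Z"
    show "h1 (pure C (X \<otimes> Y) Z t z) = h2 (pure C (X \<otimes> Y) Z t z)"
      using tz(1)
      by (induction t rule: tensor_induct)
        (use 12 tz(2) in \<open>auto simp: pure_simps linmaps_D(2)[OF lin(1)] linmaps_D(2)[OF lin(2)]\<close>)
  qed
  then have "?P (THE h. ?P h)" by (intro theI[of ?P, OF h]) (use h in blast)
  then show ?thesis using xyz by (simp add: assoc_def)
qed

lemma gen_in [simp]: "gen C \<in> und C \<I>"
  by (simp add: und_unit VS.span_base)

lemma unit_scalE:
  assumes "t \<in> und C \<I>"
  obtains a where "t = scal C a (gen C)"
  using assms by (auto simp: und_unit VS.span_singleton)

text \<open>The scalar that corresponds to an element of the unit object.\<close>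

definition \<kappa> where "\<kappa> t = (THE a. t = scal C a (gen C))"

lemma \<kappa>_scal_gen [simp]: "\<kappa> (scal C a (gen C)) = a"
  unfolding \<kappa>_def using gen_nonzero by (intro the_equality) auto

lemma \<kappa>_gen [simp]: "\<kappa> (gen C) = 1"
  using \<kappa>_scal_gen[of 1] by simp

lemma \<kappa>_add: "s \<in> und C \<I> \<Longrightarrow> t \<in> und C \<I> \<Longrightarrow> \<kappa> (s + t) = \<kappa> s + \<kappa> t"
  by (erule unit_scalE, erule unit_scalE) (simp only: \<kappa>_scal_gen VS.scale_left_distrib[symmetric])

lemma \<kappa>_scal: "t \<in> und C \<I> \<Longrightarrow> \<kappa> (scal C a t) = a * \<kappa> t"
  by (erule unit_scalE) (simp only: \<kappa>_scal_gen VS.scale_scale)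

lemma fn_lunit [simp]:
  assumes x: "x \<in> und C X"
  shows "fn (\<l> X) (pure C \<I> X (gen C) x) = x"
proof -
  let ?P = "\<lambda>h. h \<in> linmaps C (und C (\<I> \<otimes> X)) (und C X) \<and> 
      (\<forall>x\<in>und C X. h (pure C \<I> X (gen C) x) = x)"
  have "bilinear_on C (und C \<I>) (und C X) (\<lambda>t x. scal C (\<kappa> t) x)"
    by (intro bilinear_onI)
      (auto simp: \<kappa>_add \<kappa>_scal VS.scale_left_distrib VS.scale_right_distrib mult.commute)
  then obtain h where "h \<in> linmaps C (und C (\<I> \<otimes> X)) (und C X)"
    "\<And>t x. t \<in> und C \<I> \<Longrightarrow> x \<in> und C X \<Longrightarrow> h (pure C \<I> X t x) = scal C (\<kappa> t) x"
    by (rule bilinear_lift[where W = "und C X"]) auto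
  then have h: "?P h" by simp
  have "h1 = h2" if "?P h1" "?P h2" for h1 h2
  proof (rule linmaps_tensor_eqI[of _ "\<I>" X])
    fix t x assume t: "t \<in> und C \<I>" and x: "x \<in> und C X"
    from t obtain a where a: "t = scal C a (gen C)" by (rule unit_scalE)
    show "h1 (pure C \<I> X t x) = h2 (pure C \<I> X t x)"
      using that x linmaps_D(3)[of h1 C "und C (\<I> \<otimes> X)" "und C X" _ a]
        linmaps_D(3)[of h2 C "und C (\<I> \<otimes> X)" "und C X" _ a]
      by (simp add: a pure_simps)
  qed (use that in auto)
  then have "?P (THE h. ?P h)" by (intro theI[of ?P, OF h]) (use h in blast)
  then show ?thesis using x by (simp add: lunit_def)
qed

lemma fn_runit [simp]:
  assumes x: "x \<in> und C X"
  shows "fn (\<r> X) (pure C X \<I> x (gen C)) = x"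
proof -
  let ?P = "\<lambda>h. h \<in> linmaps C (und C (X \<otimes> \<I>)) (und C X) \<and> 
      (\<forall>x\<in>und C X. h (pure C X \<I> x (gen C)) = x)"
  have "bilinear_on C (und C X) (und C \<I>) (\<lambda>x t. scal C (\<kappa> t) x)"
    by (intro bilinear_onI)
      (auto simp: \<kappa>_add \<kappa>_scal VS.scale_left_distrib VS.scale_right_distrib mult.commute)
  then obtain h where "h \<in> linmaps C (und C (X \<otimes> \<I>)) (und C X)"
    "\<And>t x. t \<in> und C \<I> \<Longrightarrow> x \<in> und C X \<Longrightarrow> h (pure C X \<I> x t) = scal C (\<kappa> t) x"
    by (rule bilinear_lift[where W = "und C X"]) auto
  then have h: "?P h" by simp
  have "h1 = h2" if "?P h1" "?P h2" for h1 h2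
  proof (rule linmaps_tensor_eqI[of _ X "\<I>"])
    fix t x assume t: "t \<in> und C \<I>" and x: "x \<in> und C X"
    from t obtain a where a: "t = scal C a (gen C)" by (rule unit_scalE)
    show "h1 (pure C X \<I> x t) = h2 (pure C X \<I> x t)"
      using that x linmaps_D(3)[of h1 C "und C (X \<otimes> \<I>)" "und C X" _ a]
        linmaps_D(3)[of h2 C "und C (X \<otimes> \<I>)" "und C X" _ a]
      by (simp add: a pure_simps)
  qed (use that in auto)
  then have "?P (THE h. ?P h)" by (intro theI[of ?P, OF h]) (use h in blast)
  then show ?thesis using x by (simp add: runit_def)
qed

lemmas struct_iso [simp] = assoc_iso lunit_iso runit_iso
lemmas struct_arr [simp] = assoc_iso[THEN is_iso_is_arr] lunit_iso[THEN is_iso_is_arr]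
  runit_iso[THEN is_iso_is_arr] assoc_iso[THEN is_arr_inv] lunit_iso[THEN is_arr_inv]
  runit_iso[THEN is_arr_inv]

text \<open>Arrows out of a tensor product are compared on pure tensors, where the structural constraints
  merely move brackets and units.\<close>

lemma tens_arr_eqI:
  assumes "is_arr C f" "is_arr C g" "src f = X \<otimes> Y" "src g = X \<otimes> Y" "trg f = trg g"
    "\<And>x y. x \<in> und C X \<Longrightarrow> y \<in> und C Y \<Longrightarrow> fn f (pure C X Y x y) = fn g (pure C X Y x y)"
  shows "f = g"
proof (rule arr_eqI)
  fix t assume "t \<in> und C (src f)"
  then have "t \<in> und C (X \<otimes> Y)" using assms by simp
  then show "fn f t = fn g t"
    by (induction t rule: tensor_induct) (use assms in \<open>simp_all add: fn_add\<close>)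
qed (use assms in auto)

lemma tens_left_arr_eqI:
  assumes "is_arr C f" "is_arr C g" "src f = (X \<otimes> Y) \<otimes> Z" "src g = (X \<otimes> Y) \<otimes> Z" "trg f = trg g"
    "\<And>x y z. x \<in> und C X \<Longrightarrow> y \<in> und C Y \<Longrightarrow> z \<in> und C Z \<Longrightarrow>
      fn f (pure C (X \<otimes> Y) Z (pure C X Y x y) z) = fn g (pure C (X \<otimes> Y) Z (pure C X Y x y) z)"
  shows "f = g"
proof (rule tens_arr_eqI[OF assms(1-5)])
  fix t z assume "t \<in> und C (X \<otimes> Y)" and z: "z \<in> und C Z"
  then show "fn f (pure C (X \<otimes> Y) Z t z) = fn g (pure C (X \<otimes> Y) Z t z)"
    by (induction t rule: tensor_induct) (use assms z in \<open>simp_all add: fn_add pure_simps\<close>)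
qed

lemma tens_22_arr_eqI:
  assumes "is_arr C f" "is_arr C g" "src f = (X \<otimes> Y) \<otimes> (Z \<otimes> W)" "src g = (X \<otimes> Y) \<otimes> (Z \<otimes> W)"
    "trg f = trg g"
    "\<And>x y z w. x \<in> und C X \<Longrightarrow> y \<in> und C Y \<Longrightarrow> z \<in> und C Z \<Longrightarrow> w \<in> und C W \<Longrightarrow>
      fn f (pure C (X \<otimes> Y) (Z \<otimes> W) (pure C X Y x y) (pure C Z W z w)) =
      fn g (pure C (X \<otimes> Y) (Z \<otimes> W) (pure C X Y x y) (pure C Z W z w))"
  shows "f = g"
proof (rule tens_left_arr_eqI[OF assms(1-5)])
  fix x y t assume "t \<in> und C (Z \<otimes> W)" and xy: "x \<in> und C X" "y \<in> und C Y"
  then show "fn f (pure C (X \<otimes> Y) (Z \<otimes> W) (pure C X Y x y) t) =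
      fn g (pure C (X \<otimes> Y) (Z \<otimes> W) (pure C X Y x y) t)"
    by (induction t rule: tensor_induct) (use assms xy in \<open>simp_all add: fn_add pure_simps\<close>)
qed

lemma tarr_comp:
  assumes "is_arr C f" "is_arr C g" "is_arr C f'" "is_arr C g'" "src f = trg f'" "src g = trg g'"
  shows "(f \<boxtimes> g) \<cdot> (f' \<boxtimes> g') = (f \<cdot> f') \<boxtimes> (g \<cdot> g')"
  by (rule tens_arr_eqI[of _ _ "src f'" "src g'"]) (use assms in auto)

lemma tarr_comp_tail:
  assumes "is_arr C f" "is_arr C g" "is_arr C f'" "is_arr C g'" "src f = trg f'" "src g = trg g'"
    "is_arr C h" "trg h = src f' \<otimes> src g'"
  shows "(f \<boxtimes> g) \<cdot> ((f' \<boxtimes> g') \<cdot> h) = ((f \<cdot> f') \<boxtimes> (g \<cdot> g')) \<cdot> h"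
  using assms tarr_comp[of f g f' g'] by (simp flip: comp_assoc)

lemma tarr_ident [simp]: "\<one> X \<boxtimes> \<one> Y = \<one> (X \<otimes> Y)"
  by (rule tens_arr_eqI[of _ _ X Y]) auto

lemma tarr_iso:
  assumes "is_iso C f" "is_iso C g"
  shows "is_iso C (f \<boxtimes> g)"
  using assms is_iso_is_arr[of f] is_iso_is_arr[of g] is_arr_inv[of f] is_arr_inv[of g]
  by (intro is_isoI[of _ "inv_arr C f \<boxtimes> inv_arr C g"])
    (auto simp: tarr_comp comp_inv inv_comp)

lemma fn_inv_assoc [simp]:
  "x \<in> und C X \<Longrightarrow> y \<in> und C Y \<Longrightarrow> z \<in> und C Z \<Longrightarrow>
    fn (inv_arr C (\<a> X Y Z)) (pure C X (Y \<otimes> Z) x (pure C Y Z y z)) = pure C (X \<otimes> Y) Z (pure C X Y x y) z"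
  by (rule fn_inv) auto

lemma fn_inv_lunit [simp]: "x \<in> und C X \<Longrightarrow> fn (inv_arr C (\<l> X)) x = pure C \<I> X (gen C) x"
  by (rule fn_inv) auto

lemma fn_inv_runit [simp]: "x \<in> und C X \<Longrightarrow> fn (inv_arr C (\<r> X)) x = pure C X \<I> x (gen C)"
  by (rule fn_inv) auto

lemma assoc_natural:
  assumes "is_arr C f" "is_arr C g" "is_arr C h"
  shows "\<a> (trg f) (trg g) (trg h) \<cdot> ((f \<boxtimes> g) \<boxtimes> h) = (f \<boxtimes> (g \<boxtimes> h)) \<cdot> \<a> (src f) (src g) (src h)"
  by (rule tens_left_arr_eqI[of _ _ "src f" "src g" "src h"]) (use assms in auto)

lemma lunit_natural:
  assumes "is_arr C f"
  shows "\<l> (trg f) \<cdot> (\<one> \<I> \<boxtimes> f) = f \<cdot> \<l> (src f)"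
proof (rule tens_arr_eqI[of _ _ "\<I>" "src f"])
  fix t x assume t: "t \<in> und C \<I>" "x \<in> und C (src f)"
  then obtain a where "t = scal C a (gen C)" by (elim unit_scalE)
  then show "fn (\<l> (trg f) \<cdot> (\<one> \<I> \<boxtimes> f)) (pure C \<I> (src f) t x) = fn (f \<cdot> \<l> (src f)) (pure C \<I> (src f) t x)"
    using t assms by (simp add: pure_simps fn_scal)
qed (use assms in auto)

lemma runit_natural:
  assumes "is_arr C f"
  shows "\<r> (trg f) \<cdot> (f \<boxtimes> \<one> \<I>) = f \<cdot> \<r> (src f)"
proof (rule tens_arr_eqI[of _ _ "src f" "\<I>"])
  fix t x assume t: "t \<in> und C \<I>" "x \<in> und C (src f)"
  then obtain a where "t = scal C a (gen C)" by (elim unit_scalE)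
  then show "fn (\<r> (trg f) \<cdot> (f \<boxtimes> \<one> \<I>)) (pure C (src f) \<I> x t) = fn (f \<cdot> \<r> (src f)) (pure C (src f) \<I> x t)"
    using t assms by (simp add: pure_simps fn_scal)
qed (use assms in auto)

lemma runit_unit: "\<r> \<I> = \<l> \<I>"
proof (rule tens_arr_eqI[of _ _ "\<I>" "\<I>"])
  fix s t assume st: "s \<in> und C \<I>" "t \<in> und C \<I>"
  obtain a b where "s = scal C a (gen C)" "t = scal C b (gen C)"
    using st by (metis unit_scalE)
  then show "fn (\<r> \<I>) (pure C \<I> \<I> s t) = fn (\<l> \<I>) (pure C \<I> \<I> s t)"
    by (simp add: pure_simps fn_scal VS.scale_left_commute)
qed auto

lemma inv_natural:
  assumes "is_iso C r" "is_iso C r'" "is_arr C f" "is_arr C g" "src g = trg r" "trg f = src r'"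
    "src f = src r" "trg g = trg r'" "r' \<cdot> f = g \<cdot> r"
  shows "inv_arr C r' \<cdot> g = f \<cdot> inv_arr C r"
proof -
  have [simp]: "is_arr C r" "is_arr C r'" "is_arr C (inv_arr C r)" "is_arr C (inv_arr C r')"
    using assms is_iso_is_arr is_arr_inv by blast+
  have "inv_arr C r' \<cdot> g = inv_arr C r' \<cdot> ((g \<cdot> r) \<cdot> inv_arr C r)"
    using assms by (simp add: comp_inv)
  also have "\<dots> = inv_arr C r' \<cdot> ((r' \<cdot> f) \<cdot> inv_arr C r)"
    using assms by metis
  also have "\<dots> = f \<cdot> inv_arr C r"
    using assms(1-8) by (simp add: inv_comp_tail)
  finally show ?thesis .
qed

lemma src_trg_regroup [simp]:
  "src (regroup C X Y Z W) = (X \<otimes> Y) \<otimes> (Z \<otimes> W)" "trg (regroup C X Y Z W) = X \<otimes> ((Y \<otimes> Z) \<otimes> W)"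
  by (simp_all add: regroup_def)

lemma regroup_iso [simp]: "is_iso C (regroup C X Y Z W)"
  unfolding regroup_def by (intro is_iso_comp tarr_iso is_iso_inv) auto

lemmas regroup_arr [simp] = regroup_iso[THEN is_iso_is_arr] regroup_iso[THEN is_arr_inv]

lemma fn_regroup [simp]:
  "x \<in> und C X \<Longrightarrow> y \<in> und C Y \<Longrightarrow> z \<in> und C Z \<Longrightarrow> w \<in> und C W \<Longrightarrow>
    fn (regroup C X Y Z W) (pure C (X \<otimes> Y) (Z \<otimes> W) (pure C X Y x y) (pure C Z W z w)) =
    pure C X ((Y \<otimes> Z) \<otimes> W) x (pure C (Y \<otimes> Z) W (pure C Y Z y z) w)"
  by (simp add: regroup_def)

lemma fn_inv_regroup [simp]:
  "x \<in> und C X \<Longrightarrow> y \<in> und C Y \<Longrightarrow> z \<in> und C Z \<Longrightarrow> w \<in> und C W \<Longrightarrow>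
    fn (inv_arr C (regroup C X Y Z W)) (pure C X ((Y \<otimes> Z) \<otimes> W) x (pure C (Y \<otimes> Z) W (pure C Y Z y z) w)) =
    pure C (X \<otimes> Y) (Z \<otimes> W) (pure C X Y x y) (pure C Z W z w)"
  by (rule fn_inv) auto

lemma regroup_natural:
  assumes "is_arr C f" "is_arr C g" "is_arr C h" "is_arr C k"
  shows "regroup C (trg f) (trg g) (trg h) (trg k) \<cdot> ((f \<boxtimes> g) \<boxtimes> (h \<boxtimes> k)) =
    (f \<boxtimes> ((g \<boxtimes> h) \<boxtimes> k)) \<cdot> regroup C (src f) (src g) (src h) (src k)"
  by (rule tens_22_arr_eqI[of _ _ "src f" "src g" "src h" "src k"]) (use assms in auto)

end

section \<open>The braiding\<close>

context concrete_braided_category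
begin

declare braiding_iso [simp]
lemmas braiding_arr [simp] = braiding_iso[THEN is_iso_is_arr]

lemma src_trg_mid_braid [simp]:
  "src (mid_braid C X Y Z W) = (X \<otimes> Y) \<otimes> (Z \<otimes> W)" "trg (mid_braid C X Y Z W) = (X \<otimes> Z) \<otimes> (Y \<otimes> W)"
  by (simp_all add: mid_braid_def)

lemma mid_braid_arr [simp]: "is_arr C (mid_braid C X Y Z W)"
  by (simp add: mid_braid_def)

lemma mid_braid_natural:
  assumes "is_arr C f" "is_arr C g" "is_arr C h" "is_arr C k"
  shows "mid_braid C (trg f) (trg g) (trg h) (trg k) \<cdot> ((f \<boxtimes> g) \<boxtimes> (h \<boxtimes> k)) =
    ((f \<boxtimes> h) \<boxtimes> (g \<boxtimes> k)) \<cdot> mid_braid C (src f) (src g) (src h) (src k)"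
proof -
  let ?R = "regroup C (src f) (src g) (src h) (src k)"
  let ?R' = "regroup C (trg f) (trg g) (trg h) (trg k)"
  let ?S = "regroup C (src f) (src h) (src g) (src k)"
  let ?S' = "regroup C (trg f) (trg h) (trg g) (trg k)"
  have nat: "\<c> (trg g) (trg h) \<cdot> (g \<boxtimes> h) = (h \<boxtimes> g) \<cdot> \<c> (src g) (src h)"
    by (rule braiding_natural) (use assms in \<open>auto intro: homI\<close>)
  have inv: "inv_arr C ?S' \<cdot> (f \<boxtimes> (h \<boxtimes> g) \<boxtimes> k) = ((f \<boxtimes> h) \<boxtimes> (g \<boxtimes> k)) \<cdot> inv_arr C ?S"
    by (rule inv_natural) (use assms regroup_natural[of f h g k] in auto)
  have "mid_braid C (trg f) (trg g) (trg h) (trg k) \<cdot> ((f \<boxtimes> g) \<boxtimes> (h \<boxtimes> k)) =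
    inv_arr C ?S' \<cdot> (\<one> (trg f) \<boxtimes> \<c> (trg g) (trg h) \<boxtimes> \<one> (trg k)) \<cdot> (f \<boxtimes> ((g \<boxtimes> h) \<boxtimes> k)) \<cdot> ?R"
    using assms by (simp add: mid_braid_def regroup_natural)
  also have "\<dots> = inv_arr C ?S' \<cdot> (f \<boxtimes> (h \<boxtimes> g) \<boxtimes> k) \<cdot> (\<one> (src f) \<boxtimes> \<c> (src g) (src h) \<boxtimes> \<one> (src k)) \<cdot> ?R"
    using assms by (simp add: tarr_comp_tail tarr_comp nat)
  also have "\<dots> = (inv_arr C ?S' \<cdot> (f \<boxtimes> (h \<boxtimes> g) \<boxtimes> k)) \<cdot> (\<one> (src f) \<boxtimes> \<c> (src g) (src h) \<boxtimes> \<one> (src k)) \<cdot> ?R"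
    using assms by simp
  also have "\<dots> = ((f \<boxtimes> h) \<boxtimes> (g \<boxtimes> k)) \<cdot> mid_braid C (src f) (src g) (src h) (src k)"
    unfolding inv mid_braid_def using assms by simp
  finally show ?thesis .
qed

text \<open>The braiding need not send pure tensors to pure tensors.  The rule applies where it does, for
  instance when one of the inner factors is the unit object.\<close>

lemma fn_mid_braid:
  assumes "x \<in> und C X" "y \<in> und C Y" "z \<in> und C Z" "w \<in> und C W" "y' \<in> und C Y" "z' \<in> und C Z"
    and "fn (\<c> Y Z) (pure C Y Z y z) = pure C Z Y z' y'"
  shows "fn (mid_braid C X Y Z W) (pure C (X \<otimes> Y) (Z \<otimes> W) (pure C X Y x y) (pure C Z W z w)) =
    pure C (X \<otimes> Z) (Y \<otimes> W) (pure C X Z x z') (pure C Y W y' w)"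
  using assms by (simp add: mid_braid_def)

text \<open>Up to the unit constraints, the braiding with the unit object is an automorphism \<open>\<phi>\<close> of \<open>X\<close>.
  The hexagon for \<open>X\<close>, \<open>\<I>\<close>, \<open>\<I>\<close> says \<open>\<phi> = \<phi> \<circ> \<phi>\<close>, so \<open>\<phi>\<close> is the identity.\<close>

lemma braiding_unit_right:
  assumes x: "x \<in> und C X"
  shows "fn (\<c> X \<I>) (pure C X \<I> x (gen C)) = pure C \<I> X (gen C) x"
proof -
  define \<phi> where "\<phi> = \<l> X \<cdot> \<c> X \<I> \<cdot> inv_arr C (\<r> X)"
  have \<phi>_iso: "is_iso C \<phi>"
    unfolding \<phi>_def by (intro is_iso_comp is_iso_inv) auto
  have [simp]: "src \<phi> = X" "trg \<phi> = X" "is_arr C \<phi>"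
    using is_iso_is_arr[OF \<phi>_iso] by (auto simp: \<phi>_def)
  have c: "\<c> X \<I> = inv_arr C (\<l> X) \<cdot> \<phi> \<cdot> \<r> X"
    by (simp add: \<phi>_def inv_comp_tail inv_comp)
  have fc: "fn (\<c> X \<I>) (pure C X \<I> x (gen C)) = pure C \<I> X (gen C) (fn \<phi> x)"
    if "x \<in> und C X" for x
    using that by (simp add: c)
  let ?L = "inv_arr C (\<l> \<I>)"
  have nat: "\<c> X (\<I> \<otimes> \<I>) \<cdot> (\<one> X \<boxtimes> ?L) = (?L \<boxtimes> \<one> X) \<cdot> \<c> X \<I>"
    by (rule braiding_natural) (auto intro: homI)
  have c2: "fn (\<c> X (\<I> \<otimes> \<I>)) (pure C X (\<I> \<otimes> \<I>) x (pure C \<I> \<I> (gen C) (gen C))) =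
      pure C (\<I> \<otimes> \<I>) X (pure C \<I> \<I> (gen C) (gen C)) (fn \<phi> x)"
    using arg_cong[OF nat, of "\<lambda>h. fn h (pure C X \<I> x (gen C))"] x by (simp add: fc)
  have "pure C \<I> (\<I> \<otimes> X) (gen C) (pure C \<I> X (gen C) (fn \<phi> x)) =
      pure C \<I> (\<I> \<otimes> X) (gen C) (pure C \<I> X (gen C) (fn \<phi> (fn \<phi> x)))"
    using arg_cong[OF hexagon1[where X = X and Y = "\<I>" and Z = "\<I>"],
        of "\<lambda>h. fn h (pure C (X \<otimes> \<I>) \<I> (pure C X \<I> x (gen C)) (gen C))"] x
    by (simp add: fc c2)
  from arg_cong[OF this, of "\<lambda>t. fn (\<l> X) (fn (\<l> (\<I> \<otimes> X)) t)"]
  have "fn \<phi> x = fn \<phi> (fn \<phi> x)" using x by simp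
  then have "fn \<phi> x = x"
    using bij_betw_imp_inj_on[OF is_iso_bij[OF \<phi>_iso]] x
    by (auto dest!: inj_onD)
  then show ?thesis using fc x by simp
qed

lemma braiding_unit_left:
  assumes x: "x \<in> und C X"
  shows "fn (\<c> \<I> X) (pure C \<I> X (gen C) x) = pure C X \<I> x (gen C)"
proof -
  define \<phi> where "\<phi> = \<r> X \<cdot> \<c> \<I> X \<cdot> inv_arr C (\<l> X)"
  have \<phi>_iso: "is_iso C \<phi>"
    unfolding \<phi>_def by (intro is_iso_comp is_iso_inv) auto
  have [simp]: "src \<phi> = X" "trg \<phi> = X" "is_arr C \<phi>"
    using is_iso_is_arr[OF \<phi>_iso] by (auto simp: \<phi>_def)
  have c: "\<c> \<I> X = inv_arr C (\<r> X) \<cdot> \<phi> \<cdot> \<l> X"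
    by (simp add: \<phi>_def inv_comp_tail inv_comp)
  have fc: "fn (\<c> \<I> X) (pure C \<I> X (gen C) x) = pure C X \<I> (fn \<phi> x) (gen C)"
    if "x \<in> und C X" for x
    using that by (simp add: c)
  let ?L = "inv_arr C (\<l> \<I>)"
  have nat: "\<c> (\<I> \<otimes> \<I>) X \<cdot> (?L \<boxtimes> \<one> X) = (\<one> X \<boxtimes> ?L) \<cdot> \<c> \<I> X"
    by (rule braiding_natural) (auto intro: homI)
  have c2: "fn (\<c> (\<I> \<otimes> \<I>) X) (pure C (\<I> \<otimes> \<I>) X (pure C \<I> \<I> (gen C) (gen C)) x) =
      pure C X (\<I> \<otimes> \<I>) (fn \<phi> x) (pure C \<I> \<I> (gen C) (gen C))"
    using arg_cong[OF nat, of "\<lambda>h. fn h (pure C \<I> X (gen C) x)"] x by (simp add: fc)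
  have "pure C (X \<otimes> \<I>) \<I> (pure C X \<I> (fn \<phi> x) (gen C)) (gen C) =
      pure C (X \<otimes> \<I>) \<I> (pure C X \<I> (fn \<phi> (fn \<phi> x)) (gen C)) (gen C)"
    using arg_cong[OF hexagon2[where X = "\<I>" and Y = "\<I>" and Z = X],
        of "\<lambda>h. fn h (pure C \<I> (\<I> \<otimes> X) (gen C) (pure C \<I> X (gen C) x))"] x
    by (simp add: fc c2)
  from arg_cong[OF this, of "\<lambda>t. fn (\<r> X) (fn (\<r> (X \<otimes> \<I>)) t)"]
  have "fn \<phi> x = fn \<phi> (fn \<phi> x)" using x by simp
  then have "fn \<phi> x = x"
    using bij_betw_imp_inj_on[OF is_iso_bij[OF \<phi>_iso]] x
    by (auto dest!: inj_onD)
  then show ?thesis using fc x by simp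
qed

end

section \<open>Bialgebras, their morphisms and antipodes\<close>

text \<open>A Hopf algebra morphism without the clause on antipodes, since the inner double cross products
  are only known to be bialgebras.\<close>

definition bialgebra_morphism ::
    "('k::field, 'o, 'v::ab_group_add, 'm) ccat_scheme \<Rightarrow> ('o, 'v) bialg \<Rightarrow> ('o, 'v) bialg \<Rightarrow> ('o, 'v) arr \<Rightarrow> bool" where
  "bialgebra_morphism C A B f \<longleftrightarrow> f \<in> hom C (obj A) (obj B) \<and>
     comp C f (mlt A) = comp C (mlt B) (tarr C f f) \<and> comp C f (unt A) = unt B \<and>
     comp C (cml B) f = comp C (tarr C f f) (cml A) \<and> comp C (cnt B) f = cnt A"

context concrete_braided_category
begin

lemma comp_tail:
  assumes "a \<cdot> b = c" "is_arr C k" "trg k = src b"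
  shows "a \<cdot> (b \<cdot> k) = c \<cdot> k"
  using assms by (simp flip: comp_assoc)

lemma split_mono_cancel:
  assumes "p \<cdot> t = \<one> X" "t \<cdot> a = t \<cdot> b" "is_arr C a" "is_arr C b" "is_arr C t" "trg a = X" "trg b = X"
    "src t = X"
  shows "a = b"
proof -
  have "a = p \<cdot> (t \<cdot> a)" using assms(3-) comp_tail[OF assms(1), of a] by simp
  also have "\<dots> = p \<cdot> (t \<cdot> b)" using assms(2) by simp
  also have "\<dots> = b" using assms(3-) comp_tail[OF assms(1), of b] by simp
  finally show ?thesis .
qed

lemma tarr_retraction:
  assumes "p \<cdot> t = \<one> (src t)" "q \<cdot> s = \<one> (src s)" "is_arr C p" "is_arr C t" "is_arr C q" "is_arr C s"
    "src p = trg t" "src q = trg s"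
  shows "(p \<boxtimes> q) \<cdot> (t \<boxtimes> s) = \<one> (src t \<otimes> src s)"
  using assms by (simp add: tarr_comp)

lemma algebraD:
  assumes "algebra C A"
  shows "is_arr C (mlt A)" "src (mlt A) = obj A \<otimes> obj A" "trg (mlt A) = obj A"
    "is_arr C (unt A)" "src (unt A) = \<I>" "trg (unt A) = obj A"
  using assms homD[of "mlt A" C] homD[of "unt A" C] by (auto simp: algebra_def)

lemma coalgebraD:
  assumes "coalgebra C A"
  shows "is_arr C (cml A)" "trg (cml A) = obj A \<otimes> obj A" "src (cml A) = obj A"
    "is_arr C (cnt A)" "trg (cnt A) = \<I>" "src (cnt A) = obj A"
  using assms homD[of "cml A" C] homD[of "cnt A" C] by (auto simp: coalgebra_def)

lemma bialgebraD:
  assumes "bialgebra C A"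
  shows "algebra C A" "coalgebra C A"
    "is_arr C (mlt A)" "src (mlt A) = obj A \<otimes> obj A" "trg (mlt A) = obj A"
    "is_arr C (unt A)" "src (unt A) = \<I>" "trg (unt A) = obj A"
    "is_arr C (cml A)" "trg (cml A) = obj A \<otimes> obj A" "src (cml A) = obj A"
    "is_arr C (cnt A)" "trg (cnt A) = \<I>" "src (cnt A) = obj A"
  using assms algebraD[of A] coalgebraD[of A] by (auto simp: bialgebra_def)

lemma bialgebra_morphismD:
  assumes "bialgebra_morphism C A B f"
  shows "is_arr C f" "src f = obj A" "trg f = obj B"
    "f \<cdot> mlt A = mlt B \<cdot> (f \<boxtimes> f)" "f \<cdot> unt A = unt B"
    "cml B \<cdot> f = (f \<boxtimes> f) \<cdot> cml A" "cnt B \<cdot> f = cnt A"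
  using assms homD[of f C "obj A" "obj B"] by (auto simp: bialgebra_morphism_def)

text \<open>With arbitrary arrows into \<open>A\<close> in place of identities, the algebra axioms can rewrite composites
  in which all tensor products of arrows have been merged.\<close>

lemma mlt_assoc:
  assumes A: "algebra C A"
    and f: "is_arr C f" "trg f = obj A" and g: "is_arr C g" "trg g = obj A"
    and h: "is_arr C h" "trg h = obj A"
  shows "mlt A \<cdot> ((mlt A \<cdot> (f \<boxtimes> g)) \<boxtimes> h) =
    mlt A \<cdot> (f \<boxtimes> (mlt A \<cdot> (g \<boxtimes> h))) \<cdot> \<a> (src f) (src g) (src h)"
proof -
  note [simp] = algebraD[OF A] f g h
  have ax: "mlt A \<cdot> (mlt A \<boxtimes> \<one> (obj A)) = mlt A \<cdot> (\<one> (obj A) \<boxtimes> mlt A) \<cdot> \<a> (obj A) (obj A) (obj A)"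
    using A by (simp add: algebra_def)
  have "mlt A \<cdot> ((mlt A \<cdot> (f \<boxtimes> g)) \<boxtimes> h) = (mlt A \<cdot> (mlt A \<boxtimes> \<one> (obj A))) \<cdot> ((f \<boxtimes> g) \<boxtimes> h)"
    by (simp add: tarr_comp)
  also have "\<dots> = mlt A \<cdot> (\<one> (obj A) \<boxtimes> mlt A) \<cdot> (f \<boxtimes> (g \<boxtimes> h)) \<cdot> \<a> (src f) (src g) (src h)"
    unfolding ax using assoc_natural[of f g h] by simp
  finally show ?thesis by (simp add: tarr_comp_tail)
qed

lemma mlt_unit_left:
  assumes A: "algebra C A" and f: "is_arr C f" "trg f = obj A"
  shows "mlt A \<cdot> (unt A \<boxtimes> f) = f \<cdot> \<l> (src f)"
proof -
  note [simp] = algebraD[OF A] f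
  have ax: "mlt A \<cdot> (unt A \<boxtimes> \<one> (obj A)) = \<l> (obj A)"
    using A by (simp add: algebra_def)
  have "mlt A \<cdot> (unt A \<boxtimes> f) = (mlt A \<cdot> (unt A \<boxtimes> \<one> (obj A))) \<cdot> (\<one> \<I> \<boxtimes> f)"
    by (simp add: tarr_comp)
  then show ?thesis unfolding ax using lunit_natural[of f] by simp
qed

lemma mlt_unit_right:
  assumes A: "algebra C A" and f: "is_arr C f" "trg f = obj A"
  shows "mlt A \<cdot> (f \<boxtimes> unt A) = f \<cdot> \<r> (src f)"
proof -
  note [simp] = algebraD[OF A] f
  have ax: "mlt A \<cdot> (\<one> (obj A) \<boxtimes> unt A) = \<r> (obj A)"
    using A by (simp add: algebra_def)
  have "mlt A \<cdot> (f \<boxtimes> unt A) = (mlt A \<cdot> (\<one> (obj A) \<boxtimes> unt A)) \<cdot> (f \<boxtimes> \<one> \<I>)"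
    by (simp add: tarr_comp)
  then show ?thesis unfolding ax using runit_natural[of f] by simp
qed

text \<open>A product of two coalgebra morphisms into a bialgebra is a coalgebra morphism on the tensor
  product: push \<open>f\<close> and \<open>g\<close> through the compatibility of \<open>\<Delta>\<close> and \<open>m\<close> in \<open>H\<close>, using naturality of the
  braiding.\<close>

lemma cml_mlt:
  assumes H: "bialgebra C H" and f: "bialgebra_morphism C A H f" and g: "bialgebra_morphism C B H g"
    and A: "coalgebra C A" and B: "coalgebra C B"
  shows "cml H \<cdot> mlt H \<cdot> (f \<boxtimes> g) =
    ((mlt H \<cdot> (f \<boxtimes> g)) \<boxtimes> (mlt H \<cdot> (f \<boxtimes> g))) \<cdot> mid_braid C (obj A) (obj A) (obj B) (obj B) \<cdot> (cml A \<boxtimes> cml B)"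
proof -
  note [simp] = bialgebraD[OF H] bialgebra_morphismD(1-3)[OF f] bialgebra_morphismD(1-3)[OF g]
    coalgebraD[OF A] coalgebraD[OF B]
  have ax: "cml H \<cdot> mlt H =
      (mlt H \<boxtimes> mlt H) \<cdot> mid_braid C (obj H) (obj H) (obj H) (obj H) \<cdot> (cml H \<boxtimes> cml H)"
    using H by (simp add: bialgebra_def)
  have "cml H \<cdot> mlt H \<cdot> (f \<boxtimes> g) = (mlt H \<boxtimes> mlt H) \<cdot> mid_braid C (obj H) (obj H) (obj H) (obj H) \<cdot>
      ((cml H \<cdot> f) \<boxtimes> (cml H \<cdot> g))"
    using comp_tail[OF ax, of "f \<boxtimes> g"] by (simp add: tarr_comp)
  also have "\<dots> = (mlt H \<boxtimes> mlt H) \<cdot> mid_braid C (obj H) (obj H) (obj H) (obj H) \<cdot>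
      ((f \<boxtimes> f) \<boxtimes> (g \<boxtimes> g)) \<cdot> (cml A \<boxtimes> cml B)"
    using bialgebra_morphismD(6)[OF f] bialgebra_morphismD(6)[OF g] by (simp add: tarr_comp)
  also have "\<dots> = (mlt H \<boxtimes> mlt H) \<cdot> ((f \<boxtimes> g) \<boxtimes> (f \<boxtimes> g)) \<cdot>
       mid_braid C (obj A) (obj A) (obj B) (obj B) \<cdot> (cml A \<boxtimes> cml B)"
    using comp_tail[OF mid_braid_natural[of f f g g], of "cml A \<boxtimes> cml B"] by simp
  finally show ?thesis by (simp add: tarr_comp_tail)
qed

lemma cnt_mlt:
  assumes H: "bialgebra C H" and f: "bialgebra_morphism C A H f" and g: "bialgebra_morphism C B H g"
  shows "cnt H \<cdot> mlt H \<cdot> (f \<boxtimes> g) = \<l> \<I> \<cdot> (cnt A \<boxtimes> cnt B)"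
proof -
  note [simp] = bialgebraD[OF H] bialgebra_morphismD(1-3)[OF f] bialgebra_morphismD(1-3)[OF g]
  have ax: "cnt H \<cdot> mlt H = \<l> \<I> \<cdot> (cnt H \<boxtimes> cnt H)"
    using H by (simp add: bialgebra_def)
  show ?thesis
    using comp_tail[OF ax, of "f \<boxtimes> g"] bialgebra_morphismD(7)[OF f] bialgebra_morphismD(7)[OF g]
    by (simp add: tarr_comp)
qed

text \<open>Each axiom for \<open>B\<close> becomes the corresponding axiom of \<open>H\<close> after composition with a tensor
  power of \<open>t\<close>.  Those tensor powers can be cancelled because the retraction \<open>p\<close> has tensor powers
  as well.\<close>

lemma bialgebra_transport:
  assumes H: "bialgebra C H" and t: "bialgebra_morphism C B H t"
    and p: "p \<in> hom C (obj H) (obj B)" "p \<cdot> t = \<one> (obj B)"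
    and B: "mlt B \<in> hom C (obj B \<otimes> obj B) (obj B)" "unt B \<in> hom C \<I> (obj B)"
      "cml B \<in> hom C (obj B) (obj B \<otimes> obj B)" "cnt B \<in> hom C (obj B) \<I>"
  shows "bialgebra C B"
proof -
  note [simp] = homD[OF B(1)] homD[OF B(2)] homD[OF B(3)] homD[OF B(4)] homD[OF p(1)] bialgebraD[OF H]
    bialgebra_morphismD(1-3)[OF t]
  note tm = bialgebra_morphismD(4)[OF t] and tu = bialgebra_morphismD(5)[OF t]
    and td = bialgebra_morphismD(6)[OF t] and te = bialgebra_morphismD(7)[OF t]
  note tm' = comp_tail[OF tm]
  note cancel = split_mono_cancel[OF p(2)]
  have pt2: "(p \<boxtimes> p) \<cdot> (t \<boxtimes> t) = \<one> (obj B \<otimes> obj B)"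
    using tarr_retraction[of p t p t] p(2) by simp
  have pt3: "(p \<boxtimes> p \<boxtimes> p) \<cdot> (t \<boxtimes> t \<boxtimes> t) = \<one> (obj B \<otimes> obj B \<otimes> obj B)"
    using tarr_retraction[of p t "p \<boxtimes> p" "t \<boxtimes> t"] p(2) pt2 by simp
  have ass: "mlt B \<cdot> (mlt B \<boxtimes> \<one> (obj B)) = mlt B \<cdot> (\<one> (obj B) \<boxtimes> mlt B) \<cdot> \<a> (obj B) (obj B) (obj B)"
    by (rule cancel) (use mlt_assoc[of H t t t] in \<open>auto simp: tm' tm tarr_comp tarr_comp_tail\<close>)
  have ul: "mlt B \<cdot> (unt B \<boxtimes> \<one> (obj B)) = \<l> (obj B)"
    by (rule cancel) (use mlt_unit_left[of H t] in \<open>auto simp: tm' tu tarr_comp\<close>)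
  have ur: "mlt B \<cdot> (\<one> (obj B) \<boxtimes> unt B) = \<r> (obj B)"
    by (rule cancel) (use mlt_unit_right[of H t] in \<open>auto simp: tm' tu tarr_comp\<close>)
  have Hco: "\<a> (obj H) (obj H) (obj H) \<cdot> (cml H \<boxtimes> \<one> (obj H)) \<cdot> cml H = (\<one> (obj H) \<boxtimes> cml H) \<cdot> cml H"
    "\<l> (obj H) \<cdot> (cnt H \<boxtimes> \<one> (obj H)) \<cdot> cml H = \<one> (obj H)"
    "\<r> (obj H) \<cdot> (\<one> (obj H) \<boxtimes> cnt H) \<cdot> cml H = \<one> (obj H)"
    using bialgebraD(2)[OF H] by (simp_all add: coalgebra_def)
  have co: "\<a> (obj B) (obj B) (obj B) \<cdot> (cml B \<boxtimes> \<one> (obj B)) \<cdot> cml B = (\<one> (obj B) \<boxtimes> cml B) \<cdot> cml B"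
  proof (rule split_mono_cancel[OF pt3])
    have "(t \<boxtimes> t \<boxtimes> t) \<cdot> \<a> (obj B) (obj B) (obj B) \<cdot> (cml B \<boxtimes> \<one> (obj B)) \<cdot> cml B =
        \<a> (obj H) (obj H) (obj H) \<cdot> ((t \<boxtimes> t) \<boxtimes> t) \<cdot> (cml B \<boxtimes> \<one> (obj B)) \<cdot> cml B"
      using comp_tail[OF assoc_natural[of t t t, symmetric], of "(cml B \<boxtimes> \<one> (obj B)) \<cdot> cml B"] by simp
    also have "\<dots> = \<a> (obj H) (obj H) (obj H) \<cdot> (((t \<boxtimes> t) \<cdot> cml B) \<boxtimes> t) \<cdot> cml B"
      by (simp add: tarr_comp_tail)
    also have "\<dots> = \<a> (obj H) (obj H) (obj H) \<cdot> (cml H \<boxtimes> \<one> (obj H)) \<cdot> (t \<boxtimes> t) \<cdot> cml B"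
      by (simp add: tarr_comp_tail td)
    also have "\<dots> = (\<one> (obj H) \<boxtimes> cml H) \<cdot> (t \<boxtimes> t) \<cdot> cml B"
      using comp_tail[OF Hco(1), of t] by (simp flip: td)
    also have "\<dots> = (t \<boxtimes> ((t \<boxtimes> t) \<cdot> cml B)) \<cdot> cml B"
      by (simp add: tarr_comp_tail td)
    finally show "(t \<boxtimes> t \<boxtimes> t) \<cdot> \<a> (obj B) (obj B) (obj B) \<cdot> (cml B \<boxtimes> \<one> (obj B)) \<cdot> cml B =
        (t \<boxtimes> t \<boxtimes> t) \<cdot> (\<one> (obj B) \<boxtimes> cml B) \<cdot> cml B"
      by (simp add: tarr_comp_tail)
  qed auto
  have cl: "\<l> (obj B) \<cdot> (cnt B \<boxtimes> \<one> (obj B)) \<cdot> cml B = \<one> (obj B)"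
  proof (rule cancel)
    have "t \<cdot> \<l> (obj B) \<cdot> (cnt B \<boxtimes> \<one> (obj B)) \<cdot> cml B = \<l> (obj H) \<cdot> ((cnt H \<cdot> t) \<boxtimes> t) \<cdot> cml B"
      using comp_tail[OF lunit_natural[of t, symmetric], of "(cnt B \<boxtimes> \<one> (obj B)) \<cdot> cml B"]
      by (simp add: tarr_comp_tail te)
    also have "\<dots> = \<l> (obj H) \<cdot> (cnt H \<boxtimes> \<one> (obj H)) \<cdot> (t \<boxtimes> t) \<cdot> cml B"
      by (simp add: tarr_comp_tail)
    also have "\<dots> = t"
      using comp_tail[OF Hco(2), of t] by (simp flip: td)
    finally show "t \<cdot> \<l> (obj B) \<cdot> (cnt B \<boxtimes> \<one> (obj B)) \<cdot> cml B = t \<cdot> \<one> (obj B)" by simp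
  qed auto
  have cr: "\<r> (obj B) \<cdot> (\<one> (obj B) \<boxtimes> cnt B) \<cdot> cml B = \<one> (obj B)"
  proof (rule cancel)
    have "t \<cdot> \<r> (obj B) \<cdot> (\<one> (obj B) \<boxtimes> cnt B) \<cdot> cml B = \<r> (obj H) \<cdot> (t \<boxtimes> (cnt H \<cdot> t)) \<cdot> cml B"
      using comp_tail[OF runit_natural[of t, symmetric], of "(\<one> (obj B) \<boxtimes> cnt B) \<cdot> cml B"]
      by (simp add: tarr_comp_tail te)
    also have "\<dots> = \<r> (obj H) \<cdot> (\<one> (obj H) \<boxtimes> cnt H) \<cdot> (t \<boxtimes> t) \<cdot> cml B"
      by (simp add: tarr_comp_tail)
    also have "\<dots> = t"
      using comp_tail[OF Hco(3), of t] by (simp flip: td)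
    finally show "t \<cdot> \<r> (obj B) \<cdot> (\<one> (obj B) \<boxtimes> cnt B) \<cdot> cml B = t \<cdot> \<one> (obj B)" by simp
  qed auto
  have coB: "coalgebra C B" using B co cl cr by (simp add: coalgebra_def)
  have bi: "cml B \<cdot> mlt B =
      (mlt B \<boxtimes> mlt B) \<cdot> mid_braid C (obj B) (obj B) (obj B) (obj B) \<cdot> (cml B \<boxtimes> cml B)"
  proof (rule split_mono_cancel[OF pt2])
    have "(t \<boxtimes> t) \<cdot> cml B \<cdot> mlt B = cml H \<cdot> mlt H \<cdot> (t \<boxtimes> t)"
      using comp_tail[OF td, of "mlt B"] tm by simp
    also have "\<dots> = (t \<boxtimes> t) \<cdot> (mlt B \<boxtimes> mlt B) \<cdot> mid_braid C (obj B) (obj B) (obj B) (obj B) \<cdot> (cml B \<boxtimes> cml B)"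
      unfolding cml_mlt[OF H t t coB coB] by (simp add: tarr_comp_tail tm)
    finally show "(t \<boxtimes> t) \<cdot> cml B \<cdot> mlt B =
        (t \<boxtimes> t) \<cdot> (mlt B \<boxtimes> mlt B) \<cdot> mid_braid C (obj B) (obj B) (obj B) (obj B) \<cdot> (cml B \<boxtimes> cml B)" .
  qed auto
  have Hun: "cml H \<cdot> unt H = (unt H \<boxtimes> unt H) \<cdot> inv_arr C (\<l> \<I>)" "cnt H \<cdot> unt H = \<one> \<I>"
    using H by (simp_all add: bialgebra_def)
  have un: "cml B \<cdot> unt B = (unt B \<boxtimes> unt B) \<cdot> inv_arr C (\<l> \<I>)"
  proof (rule split_mono_cancel[OF pt2])
    show "(t \<boxtimes> t) \<cdot> cml B \<cdot> unt B = (t \<boxtimes> t) \<cdot> (unt B \<boxtimes> unt B) \<cdot> inv_arr C (\<l> \<I>)"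
      using comp_tail[OF td, of "unt B"] tu Hun by (simp add: tarr_comp_tail)
  qed auto
  have ce: "cnt B \<cdot> mlt B = \<l> \<I> \<cdot> (cnt B \<boxtimes> cnt B)"
    using cnt_mlt[OF H t t] comp_tail[OF te, of "mlt B"] tm by simp
  have eu: "cnt B \<cdot> unt B = \<one> \<I>"
    using comp_tail[OF te, of "unt B"] tu Hun by simp
  show ?thesis
    using B ass ul ur coB bi un ce eu by (simp add: bialgebra_def algebra_def)
qed

text \<open>Antipodes are convolution inverses of the identity, so \<open>T = (S * id) * T = S * (id * T) = S\<close>.\<close>

lemma antipode_unique:
  assumes H: "bialgebra C H" and S: "antipode C H S" and T: "antipode C H T"
  shows "S = T"
proof -
  have Sh: "S \<in> hom C (obj H) (obj H)" and Th: "T \<in> hom C (obj H) (obj H)"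
    using S T by (auto simp: antipode_def)
  note [simp] = bialgebraD[OF H] homD[OF Sh] homD[OF Th]
  have Hco: "\<a> (obj H) (obj H) (obj H) \<cdot> (cml H \<boxtimes> \<one> (obj H)) \<cdot> cml H = (\<one> (obj H) \<boxtimes> cml H) \<cdot> cml H"
    "\<l> (obj H) \<cdot> (cnt H \<boxtimes> \<one> (obj H)) \<cdot> cml H = \<one> (obj H)"
    "\<r> (obj H) \<cdot> (\<one> (obj H) \<boxtimes> cnt H) \<cdot> cml H = \<one> (obj H)"
    using bialgebraD(2)[OF H] by (simp_all add: coalgebra_def)
  have S1: "mlt H \<cdot> (S \<boxtimes> \<one> (obj H)) \<cdot> cml H = unt H \<cdot> cnt H"
    and T2: "mlt H \<cdot> (\<one> (obj H) \<boxtimes> T) \<cdot> cml H = unt H \<cdot> cnt H"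
    using S T by (auto simp: antipode_def)
  have a1: "mlt H \<cdot> ((mlt H \<cdot> (S \<boxtimes> \<one> (obj H))) \<boxtimes> T) =
      mlt H \<cdot> (S \<boxtimes> (mlt H \<cdot> (\<one> (obj H) \<boxtimes> T))) \<cdot> \<a> (obj H) (obj H) (obj H)"
    using mlt_assoc[of H S "\<one> (obj H)" T] by simp
  have l0: "mlt H \<cdot> ((unt H \<cdot> cnt H) \<boxtimes> T) = T \<cdot> \<l> (obj H) \<cdot> (cnt H \<boxtimes> \<one> (obj H))"
    using comp_tail[OF mlt_unit_left[of H T], of "cnt H \<boxtimes> \<one> (obj H)"] by (simp add: tarr_comp)
  have r0: "mlt H \<cdot> (S \<boxtimes> (unt H \<cdot> cnt H)) = S \<cdot> \<r> (obj H) \<cdot> (\<one> (obj H) \<boxtimes> cnt H)"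
    using comp_tail[OF mlt_unit_right[of H S], of "\<one> (obj H) \<boxtimes> cnt H"] by (simp add: tarr_comp)
  have "T = T \<cdot> \<l> (obj H) \<cdot> (cnt H \<boxtimes> \<one> (obj H)) \<cdot> cml H"
    by (simp add: Hco)
  also have "\<dots> = mlt H \<cdot> ((mlt H \<cdot> (S \<boxtimes> \<one> (obj H)) \<cdot> cml H) \<boxtimes> T) \<cdot> cml H"
    unfolding S1 using comp_tail[OF l0, of "cml H"] by simp
  also have "\<dots> = (mlt H \<cdot> ((mlt H \<cdot> (S \<boxtimes> \<one> (obj H))) \<boxtimes> T)) \<cdot> (cml H \<boxtimes> \<one> (obj H)) \<cdot> cml H"
    by (simp add: tarr_comp_tail)
  also have "\<dots> = mlt H \<cdot> (S \<boxtimes> (mlt H \<cdot> (\<one> (obj H) \<boxtimes> T))) \<cdot> (\<one> (obj H) \<boxtimes> cml H) \<cdot> cml H"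
    unfolding a1 by (simp add: Hco)
  also have "\<dots> = mlt H \<cdot> (S \<boxtimes> (mlt H \<cdot> (\<one> (obj H) \<boxtimes> T) \<cdot> cml H)) \<cdot> cml H"
    by (simp add: tarr_comp_tail)
  also have "\<dots> = S \<cdot> \<r> (obj H) \<cdot> (\<one> (obj H) \<boxtimes> cnt H) \<cdot> cml H"
    unfolding T2 using comp_tail[OF r0, of "cml H"] by simp
  finally show ?thesis by (simp add: Hco)
qed

text \<open>Conjugating an antipode by an isomorphism of bialgebras gives an antipode.  By uniqueness,
  such an isomorphism is then compatible with all antipodes.\<close>

lemma antipode_transport:
  assumes A: "bialgebra C A" and B: "bialgebra C B" and t: "bialgebra_morphism C A B t" "is_iso C t"
    and S: "antipode C A S"
  shows "antipode C B (t \<cdot> S \<cdot> inv_arr C t)"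
proof -
  note [simp] = bialgebraD[OF A] bialgebraD[OF B] bialgebra_morphismD(1-3)[OF t(1)]
    is_arr_inv[OF t(2)]
  have Sh: "S \<in> hom C (obj A) (obj A)" using S by (auto simp: antipode_def)
  note [simp] = homD[OF Sh]
  note tD = bialgebra_morphismD[OF t(1)]
  let ?q = "inv_arr C t"
  have tq: "t \<cdot> ?q = \<one> (obj B)" using comp_inv[OF t(2)] by simp
  have "(t \<boxtimes> t) \<cdot> cml A \<cdot> ?q = cml B"
    using comp_tail[OF tD(6), of ?q] tq by simp
  then have dB: "cml B = (t \<boxtimes> t) \<cdot> cml A \<cdot> ?q" by simp
  have qt: "?q \<cdot> t = \<one> (obj A)" using inv_comp[OF t(2)] by simp
  have "cnt A \<cdot> ?q = cnt B" using comp_tail[OF tD(7), of ?q] tq by simp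
  then have ue: "t \<cdot> unt A \<cdot> cnt A \<cdot> ?q = unt B \<cdot> cnt B"
    using comp_tail[OF tD(5), of "cnt B"] by simp
  have 1: "mlt B \<cdot> ((t \<cdot> S \<cdot> ?q) \<boxtimes> \<one> (obj B)) \<cdot> cml B = unt B \<cdot> cnt B"
  proof -
    have "mlt B \<cdot> ((t \<cdot> S \<cdot> ?q) \<boxtimes> \<one> (obj B)) \<cdot> cml B = mlt B \<cdot> ((t \<cdot> S) \<boxtimes> t) \<cdot> cml A \<cdot> ?q"
      unfolding dB by (simp add: tarr_comp_tail qt)
    also have "\<dots> = mlt B \<cdot> (t \<boxtimes> t) \<cdot> (S \<boxtimes> \<one> (obj A)) \<cdot> cml A \<cdot> ?q"
      by (simp add: tarr_comp_tail)
    also have "\<dots> = t \<cdot> mlt A \<cdot> (S \<boxtimes> \<one> (obj A)) \<cdot> cml A \<cdot> ?q"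
      using comp_tail[OF tD(4), of "(S \<boxtimes> \<one> (obj A)) \<cdot> cml A \<cdot> ?q"] by simp
    also have "\<dots> = t \<cdot> (mlt A \<cdot> (S \<boxtimes> \<one> (obj A)) \<cdot> cml A) \<cdot> ?q"
      by simp
    also have "\<dots> = t \<cdot> (unt A \<cdot> cnt A) \<cdot> ?q"
      using S unfolding antipode_def by metis
    finally show ?thesis using ue by simp
  qed
  have 2: "mlt B \<cdot> (\<one> (obj B) \<boxtimes> (t \<cdot> S \<cdot> ?q)) \<cdot> cml B = unt B \<cdot> cnt B"
  proof -
    have "mlt B \<cdot> (\<one> (obj B) \<boxtimes> (t \<cdot> S \<cdot> ?q)) \<cdot> cml B = mlt B \<cdot> (t \<boxtimes> (t \<cdot> S)) \<cdot> cml A \<cdot> ?q"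
      unfolding dB by (simp add: tarr_comp_tail qt)
    also have "\<dots> = mlt B \<cdot> (t \<boxtimes> t) \<cdot> (\<one> (obj A) \<boxtimes> S) \<cdot> cml A \<cdot> ?q"
      by (simp add: tarr_comp_tail)
    also have "\<dots> = t \<cdot> mlt A \<cdot> (\<one> (obj A) \<boxtimes> S) \<cdot> cml A \<cdot> ?q"
      using comp_tail[OF tD(4), of "(\<one> (obj A) \<boxtimes> S) \<cdot> cml A \<cdot> ?q"] by simp
    also have "\<dots> = t \<cdot> (mlt A \<cdot> (\<one> (obj A) \<boxtimes> S) \<cdot> cml A) \<cdot> ?q"
      by simp
    also have "\<dots> = t \<cdot> (unt A \<cdot> cnt A) \<cdot> ?q"
      using S unfolding antipode_def by metis
    finally show ?thesis using ue by simp
  qed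
  show ?thesis using 1 2 by (auto simp: antipode_def intro!: homI)
qed

lemma bialgebra_morphism_inv:
  assumes A: "bialgebra C A" and B: "bialgebra C B" and t: "bialgebra_morphism C A B t" "is_iso C t"
  shows "bialgebra_morphism C B A (inv_arr C t)"
proof -
  note [simp] = bialgebraD[OF A] bialgebraD[OF B] bialgebra_morphismD(1-3)[OF t(1)]
    is_arr_inv[OF t(2)]
  note tD = bialgebra_morphismD[OF t(1)]
  let ?q = "inv_arr C t"
  have tq: "t \<cdot> ?q = \<one> (obj B)" using comp_inv[OF t(2)] by simp
  have qt: "?q \<cdot> t = \<one> (obj A)" using inv_comp[OF t(2)] by simp
  have tq': "t \<cdot> ?q \<cdot> h = h" if "is_arr C h" "trg h = obj B" for h
    using comp_tail[OF tq, of h] that by simp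
  have qt': "?q \<cdot> t \<cdot> h = h" if "is_arr C h" "trg h = obj A" for h
    using comp_tail[OF qt, of h] that by simp
  have "?q \<cdot> mlt B = ?q \<cdot> mlt B \<cdot> (t \<boxtimes> t) \<cdot> (?q \<boxtimes> ?q)" by (simp add: tarr_comp tq)
  also have "\<dots> = ?q \<cdot> t \<cdot> mlt A \<cdot> (?q \<boxtimes> ?q)"
    using comp_tail[OF tD(4), of "?q \<boxtimes> ?q"] by simp
  finally have 1: "?q \<cdot> mlt B = mlt A \<cdot> (?q \<boxtimes> ?q)" by (simp add: qt')
  have 2: "?q \<cdot> unt B = unt A" using tD(5) qt' by (metis bialgebraD(6,8)[OF A])
  have "(?q \<boxtimes> ?q) \<cdot> cml B = (?q \<boxtimes> ?q) \<cdot> cml B \<cdot> t \<cdot> ?q" by (simp add: tq)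
  also have "\<dots> = (?q \<boxtimes> ?q) \<cdot> (t \<boxtimes> t) \<cdot> cml A \<cdot> ?q"
    using comp_tail[OF tD(6), of ?q] by simp
  finally have 3: "(?q \<boxtimes> ?q) \<cdot> cml B = cml A \<cdot> ?q" by (simp add: tarr_comp_tail qt)
  have 4: "cnt A \<cdot> ?q = cnt B" using comp_tail[OF tD(7), of ?q] tq by simp
  show ?thesis using 1 2 3 4 by (auto simp: bialgebra_morphism_def intro!: homI)
qed

lemma hopf_isomorphismI:
  assumes A: "bialgebra C A" and H: "hopf_algebra C H" and t: "bialgebra_morphism C A H t" "is_iso C t"
  shows "hopf_isomorphism C A H t"
proof -
  have HB: "bialgebra C H" using H by (simp add: hopf_algebra_def)
  note [simp] = bialgebra_morphismD(1-3)[OF t(1)] is_arr_inv[OF t(2)]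
  obtain T where T: "antipode C H T" using H by (auto simp: hopf_algebra_def)
  have "\<exists>S. antipode C A S"
    using antipode_transport[OF HB A bialgebra_morphism_inv[OF A HB t] is_iso_inv[OF t(2)] T] by blast
  moreover have "t \<cdot> S = U \<cdot> t" if S: "antipode C A S" and U: "antipode C H U" for S U
  proof -
    have "S \<in> hom C (obj A) (obj A)" using S by (auto simp: antipode_def)
    note [simp] = homD[OF this]
    have "U = t \<cdot> S \<cdot> inv_arr C t"
      using antipode_unique[OF HB U antipode_transport[OF A HB t S]] .
    then show ?thesis using inv_comp[OF t(2)] by simp
  qed
  ultimately show ?thesis
    using assms by (auto simp: hopf_isomorphism_def hopf_algebra_def hopf_morphism_def bialgebra_morphism_def)
qed

section \<open>Multiplication of elements\<close>

lemma mul_in [simp]: "algebra C A \<Longrightarrow> x \<in> und C (obj A) \<Longrightarrow> y \<in> und C (obj A) \<Longrightarrow> mul C A x y \<in> und C (obj A)"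
  using algebraD[of A] by (simp add: mul_def)

lemma mul_add:
  assumes "algebra C A" "x \<in> und C (obj A)" "y \<in> und C (obj A)" "z \<in> und C (obj A)"
  shows "mul C A (x + z) y = mul C A x y + mul C A z y" "mul C A x (y + z) = mul C A x y + mul C A x z"
  using assms algebraD[OF assms(1)] by (auto simp: mul_def pure_simps fn_add)

lemma mul_scal:
  assumes "algebra C A" "x \<in> und C (obj A)" "y \<in> und C (obj A)"
  shows "mul C A (scal C a x) y = scal C a (mul C A x y)" "mul C A x (scal C a y) = scal C a (mul C A x y)"
  using assms algebraD[OF assms(1)] by (auto simp: mul_def pure_simps fn_scal)

lemma mul_assoc:
  assumes A: "algebra C A" and "x \<in> und C (obj A)" "y \<in> und C (obj A)" "z \<in> und C (obj A)"
  shows "mul C A (mul C A x y) z = mul C A x (mul C A y z)"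
proof -
  note [simp] = algebraD[OF A]
  have "mlt A \<cdot> (mlt A \<boxtimes> \<one> (obj A)) = mlt A \<cdot> (\<one> (obj A) \<boxtimes> mlt A) \<cdot> \<a> (obj A) (obj A) (obj A)"
    using A by (simp add: algebra_def)
  from arg_cong[OF this, of "\<lambda>h. fn h (pure C (obj A \<otimes> obj A) (obj A) (pure C (obj A) (obj A) x y) z)"]
  show ?thesis using assms by (simp add: mul_def)
qed

lemma unit_in [simp]: "algebra C A \<Longrightarrow> fn (unt A) (gen C) \<in> und C (obj A)"
  using algebraD[of A] by simp

lemma mul_unit:
  assumes A: "algebra C A" and x: "x \<in> und C (obj A)"
  shows "mul C A (fn (unt A) (gen C)) x = x" "mul C A x (fn (unt A) (gen C)) = x"
proof -
  note [simp] = algebraD[OF A]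
  have "mlt A \<cdot> (unt A \<boxtimes> \<one> (obj A)) = \<l> (obj A)" "mlt A \<cdot> (\<one> (obj A) \<boxtimes> unt A) = \<r> (obj A)"
    using A by (simp_all add: algebra_def)
  from arg_cong[OF this(1), of "\<lambda>h. fn h (pure C \<I> (obj A) (gen C) x)"]
    arg_cong[OF this(2), of "\<lambda>h. fn h (pure C (obj A) \<I> x (gen C))"]
  show "mul C A (fn (unt A) (gen C)) x = x" "mul C A x (fn (unt A) (gen C)) = x"
    using x by (simp_all add: mul_def)
qed

lemma fn_mlt_tarr:
  assumes "is_arr C f" "is_arr C g" "trg f = obj A" "trg g = obj A" "algebra C A"
    "src f = X" "src g = Y" "x \<in> und C X" "y \<in> und C Y"
  shows "fn (mlt A \<cdot> (f \<boxtimes> g)) (pure C X Y x y) = mul C A (fn f x) (fn g y)"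
  using assms algebraD[of A] by (simp add: mul_def)

lemma morphism_mul:
  assumes f: "bialgebra_morphism C A B f" and A: "algebra C A" and B: "algebra C B"
    and "x \<in> und C (obj A)" "y \<in> und C (obj A)"
  shows "fn f (mul C A x y) = mul C B (fn f x) (fn f y)"
proof -
  note [simp] = algebraD[OF A] algebraD[OF B] bialgebra_morphismD(1-3)[OF f]
  from arg_cong[OF bialgebra_morphismD(4)[OF f], of "\<lambda>h. fn h (pure C (obj A) (obj A) x y)"]
  show ?thesis using assms by (simp add: mul_def)
qed

lemma morphism_unit:
  assumes f: "bialgebra_morphism C A B f" and A: "algebra C A"
  shows "fn f (fn (unt A) (gen C)) = fn (unt B) (gen C)"
  using arg_cong[OF bialgebra_morphismD(5)[OF f], of "\<lambda>h. fn h (gen C)"] algebraD[OF A] by simp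

lemma cnt_unit:
  assumes A: "bialgebra C A"
  shows "fn (cnt A) (fn (unt A) (gen C)) = gen C"
proof -
  have "cnt A \<cdot> unt A = \<one> \<I>" using A by (simp add: bialgebra_def)
  from arg_cong[OF this, of "\<lambda>h. fn h (gen C)"] show ?thesis using bialgebraD[OF A] by simp
qed

lemma cnt_cml:
  assumes "bialgebra C A"
  shows "(cnt A \<boxtimes> \<one> (obj A)) \<cdot> cml A = inv_arr C (\<l> (obj A))"
    "(\<one> (obj A) \<boxtimes> cnt A) \<cdot> cml A = inv_arr C (\<r> (obj A))"
    "(cnt A \<boxtimes> cnt A) \<cdot> cml A = inv_arr C (\<l> \<I>) \<cdot> cnt A"
proof -
  note [simp] = bialgebraD[OF assms]
  have co: "\<l> (obj A) \<cdot> (cnt A \<boxtimes> \<one> (obj A)) \<cdot> cml A = \<one> (obj A)"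
    "\<r> (obj A) \<cdot> (\<one> (obj A) \<boxtimes> cnt A) \<cdot> cml A = \<one> (obj A)"
    using bialgebraD(2)[OF assms] by (simp_all add: coalgebra_def)
  show 1: "(cnt A \<boxtimes> \<one> (obj A)) \<cdot> cml A = inv_arr C (\<l> (obj A))"
    using arg_cong[OF co(1), of "\<lambda>h. inv_arr C (\<l> (obj A)) \<cdot> h"] by (simp add: inv_comp_tail)
  show "(\<one> (obj A) \<boxtimes> cnt A) \<cdot> cml A = inv_arr C (\<r> (obj A))"
    using arg_cong[OF co(2), of "\<lambda>h. inv_arr C (\<r> (obj A)) \<cdot> h"] by (simp add: inv_comp_tail)
  have "(cnt A \<boxtimes> cnt A) \<cdot> cml A = (\<one> \<I> \<boxtimes> cnt A) \<cdot> (cnt A \<boxtimes> \<one> (obj A)) \<cdot> cml A"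
    by (simp add: tarr_comp_tail)
  also have "\<dots> = inv_arr C (\<l> \<I>) \<cdot> cnt A"
    unfolding 1 by (rule arr_eqI) auto
  finally show "(cnt A \<boxtimes> cnt A) \<cdot> cml A = inv_arr C (\<l> \<I>) \<cdot> cnt A" .
qed

lemma \<kappa>_cnt_mul:
  assumes A: "bialgebra C A" and xy: "x \<in> und C (obj A)" "y \<in> und C (obj A)"
  shows "\<kappa> (fn (cnt A) (mul C A x y)) = \<kappa> (fn (cnt A) x) * \<kappa> (fn (cnt A) y)"
proof -
  note [simp] = bialgebraD[OF A]
  obtain a where a: "fn (cnt A) x = scal C a (gen C)"
    using xy unit_scalE[of "fn (cnt A) x"] by auto
  obtain b where b: "fn (cnt A) y = scal C b (gen C)"
    using xy unit_scalE[of "fn (cnt A) y"] by auto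
  note ab = a b
  have "cnt A \<cdot> mlt A = \<l> \<I> \<cdot> (cnt A \<boxtimes> cnt A)"
    using A by (simp add: bialgebra_def)
  from arg_cong[OF this, of "\<lambda>h. fn h (pure C (obj A) (obj A) x y)"]
  have "fn (cnt A) (mul C A x y) = scal C (a * b) (gen C)"
    using xy by (simp add: mul_def ab pure_simps fn_scal mult.commute)
  then show ?thesis by (simp add: ab)
qed

text \<open>Grouping as \<open>(a b) (c d) = a ((b c) d)\<close>, which brings the two inner factors together to be
  interchanged.\<close>

lemma mlt_quad:
  assumes A: "algebra C A"
    and "is_arr C f" "trg f = obj A" "is_arr C g" "trg g = obj A"
    and "is_arr C h" "trg h = obj A" "is_arr C k" "trg k = obj A"
  shows "mlt A \<cdot> ((mlt A \<cdot> (f \<boxtimes> g)) \<boxtimes> (mlt A \<cdot> (h \<boxtimes> k))) =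
    mlt A \<cdot> (f \<boxtimes> (mlt A \<cdot> ((mlt A \<cdot> (g \<boxtimes> h)) \<boxtimes> k))) \<cdot> regroup C (src f) (src g) (src h) (src k)"
proof (rule tens_22_arr_eqI[of _ _ "src f" "src g" "src h" "src k"])
  note [simp] = algebraD[OF A]
  fix x y z w
  assume "x \<in> und C (src f)" "y \<in> und C (src g)" "z \<in> und C (src h)" "w \<in> und C (src k)"
  then show "fn (mlt A \<cdot> ((mlt A \<cdot> (f \<boxtimes> g)) \<boxtimes> (mlt A \<cdot> (h \<boxtimes> k))))
      (pure C (src f \<otimes> src g) (src h \<otimes> src k) (pure C (src f) (src g) x y) (pure C (src h) (src k) z w)) =
    fn (mlt A \<cdot> (f \<boxtimes> (mlt A \<cdot> ((mlt A \<cdot> (g \<boxtimes> h)) \<boxtimes> k))) \<cdot> regroup C (src f) (src g) (src h) (src k))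
      (pure C (src f \<otimes> src g) (src h \<otimes> src k) (pure C (src f) (src g) x y) (pure C (src h) (src k) z w))"
    using assms
    by (simp add: mul_assoc flip: mul_def)
qed (use assms algebraD[OF A] in auto)

end

section \<open>The double cross product of two factors\<close>

text \<open>The product map of the two morphisms has a retraction \<open>p\<close>, and \<open>swap\<close> expresses that its image
  \<open>XY\<close> contains \<open>YX\<close>, since \<open>p\<close> followed by the product map fixes exactly the elements of \<open>XY\<close>.
  The product map may fail to be onto, as happens for inner brackets.\<close>

locale split_product = concrete_braided_category C
  for C :: "('k::field, 'o, 'v::ab_group_add, 'm) ccat_scheme" (structure) +
  fixes H X Y :: "('o, 'v) bialg" and f g p :: "('o, 'v) arr"
  assumes H: "bialgebra C H" and X: "bialgebra C X" and Y: "bialgebra C Y"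
    and f: "bialgebra_morphism C X H f" and g: "bialgebra_morphism C Y H g"
    and p: "p \<in> hom C (obj H) (obj X \<otimes> obj Y)"
    and retract: "p \<cdot> mlt H \<cdot> (f \<boxtimes> g) = \<one> (obj X \<otimes> obj Y)"
    and swap: "(mlt H \<cdot> (f \<boxtimes> g)) \<cdot> p \<cdot> mlt H \<cdot> (g \<boxtimes> f) = mlt H \<cdot> (g \<boxtimes> f)"
begin

text \<open>\<open>\<zeta>\<close> rewrites \<open>y x\<close> as a sum of products of elements of \<open>X\<close> and \<open>Y\<close>, in this order; the two
  actions are its components.\<close>

definition \<theta> where "\<theta> = mlt H \<cdot> (f \<boxtimes> g)"
definition \<zeta> where "\<zeta> = p \<cdot> mlt H \<cdot> (g \<boxtimes> f)"
definition \<pi>\<^sub>X where "\<pi>\<^sub>X = \<r> (obj X) \<cdot> (\<one> (obj X) \<boxtimes> cnt Y)"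
definition \<pi>\<^sub>Y where "\<pi>\<^sub>Y = \<l> (obj Y) \<cdot> (cnt X \<boxtimes> \<one> (obj Y))"
definition \<alpha> where "\<alpha> = \<pi>\<^sub>X \<cdot> \<zeta>"
definition \<beta> where "\<beta> = \<pi>\<^sub>Y \<cdot> \<zeta>"

abbreviation "\<Delta>\<^sub>X\<^sub>Y \<equiv> mid_braid C (obj X) (obj X) (obj Y) (obj Y) \<cdot> (cml X \<boxtimes> cml Y)"
abbreviation "\<Delta>\<^sub>Y\<^sub>X \<equiv> mid_braid C (obj Y) (obj Y) (obj X) (obj X) \<cdot> (cml Y \<boxtimes> cml X)"

lemmas typing [simp] = bialgebraD[OF H] bialgebraD[OF X] bialgebraD[OF Y]
  bialgebra_morphismD(1-3)[OF f] bialgebra_morphismD(1-3)[OF g] homD[OF p]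

lemma typing' [simp]:
  "is_arr C \<theta>" "src \<theta> = obj X \<otimes> obj Y" "trg \<theta> = obj H"
  "is_arr C \<zeta>" "src \<zeta> = obj Y \<otimes> obj X" "trg \<zeta> = obj X \<otimes> obj Y"
  "is_arr C \<pi>\<^sub>X" "src \<pi>\<^sub>X = obj X \<otimes> obj Y" "trg \<pi>\<^sub>X = obj X"
  "is_arr C \<pi>\<^sub>Y" "src \<pi>\<^sub>Y = obj X \<otimes> obj Y" "trg \<pi>\<^sub>Y = obj Y"
  "is_arr C \<alpha>" "src \<alpha> = obj Y \<otimes> obj X" "trg \<alpha> = obj X"
  "is_arr C \<beta>" "src \<beta> = obj Y \<otimes> obj X" "trg \<beta> = obj Y"
  by (simp_all add: \<theta>_def \<zeta>_def \<pi>\<^sub>X_def \<pi>\<^sub>Y_def \<alpha>_def \<beta>_def)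

lemma p_\<theta>: "p \<cdot> \<theta> = \<one> (obj X \<otimes> obj Y)"
  using retract by (simp add: \<theta>_def)

lemma \<theta>_\<zeta>: "\<theta> \<cdot> \<zeta> = mlt H \<cdot> (g \<boxtimes> f)"
  using swap by (simp add: \<theta>_def \<zeta>_def)

lemma cml_\<theta>: "cml H \<cdot> \<theta> = (\<theta> \<boxtimes> \<theta>) \<cdot> \<Delta>\<^sub>X\<^sub>Y"
  unfolding \<theta>_def using cml_mlt[OF H f g] by simp

lemma cnt_\<theta>: "cnt H \<cdot> \<theta> = \<l> \<I> \<cdot> (cnt X \<boxtimes> cnt Y)"
  unfolding \<theta>_def using cnt_mlt[OF H f g] by simp

text \<open>\<open>\<zeta>\<close> is a coalgebra morphism, because \<open>\<theta>\<close> and \<open>\<theta> \<cdot> \<zeta>\<close> are and \<open>\<theta> \<boxtimes> \<theta>\<close> can be cancelled.\<close>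

lemma cml_\<zeta>: "\<Delta>\<^sub>X\<^sub>Y \<cdot> \<zeta> = (\<zeta> \<boxtimes> \<zeta>) \<cdot> \<Delta>\<^sub>Y\<^sub>X"
proof (rule split_mono_cancel)
  show "(p \<boxtimes> p) \<cdot> (\<theta> \<boxtimes> \<theta>) = \<one> ((obj X \<otimes> obj Y) \<otimes> (obj X \<otimes> obj Y))"
    using tarr_retraction[of p \<theta> p \<theta>] p_\<theta> by simp
  have "(\<theta> \<boxtimes> \<theta>) \<cdot> \<Delta>\<^sub>X\<^sub>Y \<cdot> \<zeta> = cml H \<cdot> \<theta> \<cdot> \<zeta>"
    using comp_tail[OF cml_\<theta>, of \<zeta>] by simp
  also have "\<dots> = (\<theta> \<boxtimes> \<theta>) \<cdot> (\<zeta> \<boxtimes> \<zeta>) \<cdot> \<Delta>\<^sub>Y\<^sub>X"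
    using cml_mlt[OF H g f] by (simp add: \<theta>_\<zeta> tarr_comp_tail)
  finally show "(\<theta> \<boxtimes> \<theta>) \<cdot> \<Delta>\<^sub>X\<^sub>Y \<cdot> \<zeta> = (\<theta> \<boxtimes> \<theta>) \<cdot> (\<zeta> \<boxtimes> \<zeta>) \<cdot> \<Delta>\<^sub>Y\<^sub>X" .
qed auto

lemma cnt_\<zeta>: "\<l> \<I> \<cdot> (cnt X \<boxtimes> cnt Y) \<cdot> \<zeta> = \<l> \<I> \<cdot> (cnt Y \<boxtimes> cnt X)"
proof -
  have "\<l> \<I> \<cdot> (cnt X \<boxtimes> cnt Y) \<cdot> \<zeta> = cnt H \<cdot> \<theta> \<cdot> \<zeta>"
    using comp_tail[OF cnt_\<theta>, of \<zeta>] by simp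
  then show ?thesis using cnt_mlt[OF H g f] by (simp add: \<theta>_\<zeta>)
qed

text \<open>Naturality moves the counit of \<open>Y\<close> through the middle braiding, which thereby becomes a braiding
  with the unit object.\<close>

lemma cml_\<pi>\<^sub>X: "cml X \<cdot> \<pi>\<^sub>X = (\<pi>\<^sub>X \<boxtimes> \<pi>\<^sub>X) \<cdot> \<Delta>\<^sub>X\<^sub>Y"
proof -
  have "(\<pi>\<^sub>X \<boxtimes> \<pi>\<^sub>X) \<cdot> \<Delta>\<^sub>X\<^sub>Y = (\<r> (obj X) \<boxtimes> \<r> (obj X)) \<cdot>
      ((\<one> (obj X) \<boxtimes> cnt Y) \<boxtimes> (\<one> (obj X) \<boxtimes> cnt Y)) \<cdot> \<Delta>\<^sub>X\<^sub>Y"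
    by (simp add: \<pi>\<^sub>X_def tarr_comp_tail)
  also have "\<dots> = (\<r> (obj X) \<boxtimes> \<r> (obj X)) \<cdot> mid_braid C (obj X) (obj X) \<I> \<I> \<cdot>
      (cml X \<boxtimes> (inv_arr C (\<l> \<I>) \<cdot> cnt Y))"
    using comp_tail[OF mid_braid_natural[of "\<one> (obj X)" "\<one> (obj X)" "cnt Y" "cnt Y", symmetric],
        of "cml X \<boxtimes> cml Y"]
    by (simp add: tarr_comp cnt_cml[OF Y])
  also have "\<dots> = ((\<r> (obj X) \<boxtimes> \<r> (obj X)) \<cdot> mid_braid C (obj X) (obj X) \<I> \<I> \<cdot>
      (\<one> (obj X \<otimes> obj X) \<boxtimes> inv_arr C (\<l> \<I>))) \<cdot> (cml X \<boxtimes> cnt Y)"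
    by (simp add: tarr_comp)
  also have "(\<r> (obj X) \<boxtimes> \<r> (obj X)) \<cdot> mid_braid C (obj X) (obj X) \<I> \<I> \<cdot>
      (\<one> (obj X \<otimes> obj X) \<boxtimes> inv_arr C (\<l> \<I>)) = \<r> (obj X \<otimes> obj X)"
  proof (rule tens_left_arr_eqI[of _ _ "obj X" "obj X" "\<I>"])
    fix x y t assume xy: "x \<in> und C (obj X)" "y \<in> und C (obj X)" and "t \<in> und C \<I>"
    then obtain a where a: "t = scal C a (gen C)" by (elim unit_scalE)
    show "fn ((\<r> (obj X) \<boxtimes> \<r> (obj X)) \<cdot> mid_braid C (obj X) (obj X) \<I> \<I> \<cdot>
      (\<one> (obj X \<otimes> obj X) \<boxtimes> inv_arr C (\<l> \<I>))) (pure C (obj X \<otimes> obj X) \<I> (pure C (obj X) (obj X) x y) t) =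
      fn (\<r> (obj X \<otimes> obj X)) (pure C (obj X \<otimes> obj X) \<I> (pure C (obj X) (obj X) x y) t)"
      using xy by (simp add: a pure_simps fn_scal fn_mid_braid[OF _ _ _ _ _ _ braiding_unit_right])
  qed auto
  also have "\<r> (obj X \<otimes> obj X) \<cdot> (cml X \<boxtimes> cnt Y) = cml X \<cdot> \<r> (obj X) \<cdot> (\<one> (obj X) \<boxtimes> cnt Y)"
    using comp_tail[OF runit_natural[of "cml X"], of "\<one> (obj X) \<boxtimes> cnt Y"] by (simp add: tarr_comp)
  finally show ?thesis by (simp add: \<pi>\<^sub>X_def)
qed

lemma cml_\<pi>\<^sub>Y: "cml Y \<cdot> \<pi>\<^sub>Y = (\<pi>\<^sub>Y \<boxtimes> \<pi>\<^sub>Y) \<cdot> \<Delta>\<^sub>X\<^sub>Y"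
proof -
  have "(\<pi>\<^sub>Y \<boxtimes> \<pi>\<^sub>Y) \<cdot> \<Delta>\<^sub>X\<^sub>Y = (\<l> (obj Y) \<boxtimes> \<l> (obj Y)) \<cdot>
      ((cnt X \<boxtimes> \<one> (obj Y)) \<boxtimes> (cnt X \<boxtimes> \<one> (obj Y))) \<cdot> \<Delta>\<^sub>X\<^sub>Y"
    by (simp add: \<pi>\<^sub>Y_def tarr_comp_tail)
  also have "\<dots> = (\<l> (obj Y) \<boxtimes> \<l> (obj Y)) \<cdot> mid_braid C \<I> \<I> (obj Y) (obj Y) \<cdot>
      ((inv_arr C (\<l> \<I>) \<cdot> cnt X) \<boxtimes> cml Y)"
    using comp_tail[OF mid_braid_natural[of "cnt X" "cnt X" "\<one> (obj Y)" "\<one> (obj Y)", symmetric],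
        of "cml X \<boxtimes> cml Y"]
    by (simp add: tarr_comp cnt_cml[OF X])
  also have "\<dots> = ((\<l> (obj Y) \<boxtimes> \<l> (obj Y)) \<cdot> mid_braid C \<I> \<I> (obj Y) (obj Y) \<cdot>
      (inv_arr C (\<l> \<I>) \<boxtimes> \<one> (obj Y \<otimes> obj Y))) \<cdot> (cnt X \<boxtimes> cml Y)"
    by (simp add: tarr_comp)
  also have "(\<l> (obj Y) \<boxtimes> \<l> (obj Y)) \<cdot> mid_braid C \<I> \<I> (obj Y) (obj Y) \<cdot>
      (inv_arr C (\<l> \<I>) \<boxtimes> \<one> (obj Y \<otimes> obj Y)) = \<l> (obj Y \<otimes> obj Y)"
  proof (rule tens_arr_eqI[of _ _ "\<I>" "obj Y \<otimes> obj Y"])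
    fix t s assume s: "s \<in> und C (obj Y \<otimes> obj Y)" and "t \<in> und C \<I>"
    then obtain a where a: "t = scal C a (gen C)" by (elim unit_scalE)
    from s show "fn ((\<l> (obj Y) \<boxtimes> \<l> (obj Y)) \<cdot> mid_braid C \<I> \<I> (obj Y) (obj Y) \<cdot>
      (inv_arr C (\<l> \<I>) \<boxtimes> \<one> (obj Y \<otimes> obj Y))) (pure C \<I> (obj Y \<otimes> obj Y) t s) =
      fn (\<l> (obj Y \<otimes> obj Y)) (pure C \<I> (obj Y \<otimes> obj Y) t s)"
    proof (induction s rule: tensor_induct)
      case (pure x y)
      then show ?case
        by (simp add: a pure_simps fn_scal fn_mid_braid[OF _ _ _ _ _ _ braiding_unit_left])
    next
      case (add s s')
      then show ?case by (simp add: a pure_simps fn_add)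
    qed
  qed auto
  also have "\<l> (obj Y \<otimes> obj Y) \<cdot> (cnt X \<boxtimes> cml Y) = cml Y \<cdot> \<l> (obj Y) \<cdot> (cnt X \<boxtimes> \<one> (obj Y))"
    using comp_tail[OF lunit_natural[of "cml Y"], of "cnt X \<boxtimes> \<one> (obj Y)"] by (simp add: tarr_comp)
  finally show ?thesis by (simp add: \<pi>\<^sub>Y_def)
qed

lemma projections_cml: "(\<pi>\<^sub>X \<boxtimes> \<pi>\<^sub>Y) \<cdot> \<Delta>\<^sub>X\<^sub>Y = \<one> (obj X \<otimes> obj Y)"
proof -
  have "(\<pi>\<^sub>X \<boxtimes> \<pi>\<^sub>Y) \<cdot> \<Delta>\<^sub>X\<^sub>Y = (\<r> (obj X) \<boxtimes> \<l> (obj Y)) \<cdot>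
      ((\<one> (obj X) \<boxtimes> cnt Y) \<boxtimes> (cnt X \<boxtimes> \<one> (obj Y))) \<cdot> \<Delta>\<^sub>X\<^sub>Y"
    by (simp add: \<pi>\<^sub>X_def \<pi>\<^sub>Y_def tarr_comp_tail)
  also have "\<dots> = (\<r> (obj X) \<boxtimes> \<l> (obj Y)) \<cdot> mid_braid C (obj X) \<I> \<I> (obj Y) \<cdot>
      (inv_arr C (\<r> (obj X)) \<boxtimes> inv_arr C (\<l> (obj Y)))"
    using comp_tail[OF mid_braid_natural[of "\<one> (obj X)" "cnt X" "cnt Y" "\<one> (obj Y)", symmetric],
        of "cml X \<boxtimes> cml Y"]
    by (simp add: tarr_comp cnt_cml[OF X] cnt_cml[OF Y])
  also have "\<dots> = \<one> (obj X \<otimes> obj Y)"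
    by (rule tens_arr_eqI[of _ _ "obj X" "obj Y"])
      (auto simp: fn_mid_braid[OF _ _ _ _ _ _ braiding_unit_right])
  finally show ?thesis .
qed

text \<open>A coalgebra morphism into \<open>X \<otimes> Y\<close> is determined by its components, by \<open>projections_cml\<close>.\<close>

lemma \<zeta>_actions: "(\<alpha> \<boxtimes> \<beta>) \<cdot> \<Delta>\<^sub>Y\<^sub>X = \<zeta>"
proof -
  have "(\<alpha> \<boxtimes> \<beta>) \<cdot> \<Delta>\<^sub>Y\<^sub>X = (\<pi>\<^sub>X \<boxtimes> \<pi>\<^sub>Y) \<cdot> (\<zeta> \<boxtimes> \<zeta>) \<cdot> \<Delta>\<^sub>Y\<^sub>X"
    by (simp add: \<alpha>_def \<beta>_def tarr_comp_tail)
  also have "\<dots> = (\<pi>\<^sub>X \<boxtimes> \<pi>\<^sub>Y) \<cdot> \<Delta>\<^sub>X\<^sub>Y \<cdot> \<zeta>" using cml_\<zeta> by simp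
  also have "\<dots> = \<zeta>" using comp_tail[OF projections_cml, of \<zeta>] by simp
  finally show ?thesis .
qed

lemma cml_\<alpha>: "cml X \<cdot> \<alpha> = (\<alpha> \<boxtimes> \<alpha>) \<cdot> \<Delta>\<^sub>Y\<^sub>X"
proof -
  have "cml X \<cdot> \<alpha> = (\<pi>\<^sub>X \<boxtimes> \<pi>\<^sub>X) \<cdot> \<Delta>\<^sub>X\<^sub>Y \<cdot> \<zeta>"
    using comp_tail[OF cml_\<pi>\<^sub>X, of \<zeta>] by (simp add: \<alpha>_def)
  also have "\<dots> = (\<pi>\<^sub>X \<boxtimes> \<pi>\<^sub>X) \<cdot> (\<zeta> \<boxtimes> \<zeta>) \<cdot> \<Delta>\<^sub>Y\<^sub>X" using cml_\<zeta> by simp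
  finally show ?thesis by (simp add: \<alpha>_def tarr_comp_tail)
qed

lemma cml_\<beta>: "cml Y \<cdot> \<beta> = (\<beta> \<boxtimes> \<beta>) \<cdot> \<Delta>\<^sub>Y\<^sub>X"
proof -
  have "cml Y \<cdot> \<beta> = (\<pi>\<^sub>Y \<boxtimes> \<pi>\<^sub>Y) \<cdot> \<Delta>\<^sub>X\<^sub>Y \<cdot> \<zeta>"
    using comp_tail[OF cml_\<pi>\<^sub>Y, of \<zeta>] by (simp add: \<beta>_def)
  also have "\<dots> = (\<pi>\<^sub>Y \<boxtimes> \<pi>\<^sub>Y) \<cdot> (\<zeta> \<boxtimes> \<zeta>) \<cdot> \<Delta>\<^sub>Y\<^sub>X" using cml_\<zeta> by simp
  finally show ?thesis by (simp add: \<beta>_def tarr_comp_tail)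
qed

lemma cnt_\<alpha>: "cnt X \<cdot> \<alpha> = \<l> \<I> \<cdot> (cnt Y \<boxtimes> cnt X)"
proof -
  have "cnt X \<cdot> \<alpha> = \<l> \<I> \<cdot> (cnt X \<boxtimes> \<one> \<I>) \<cdot> (\<one> (obj X) \<boxtimes> cnt Y) \<cdot> \<zeta>"
    using comp_tail[OF runit_natural[of "cnt X"], of "(\<one> (obj X) \<boxtimes> cnt Y) \<cdot> \<zeta>"]
    by (simp add: \<alpha>_def \<pi>\<^sub>X_def runit_unit)
  then show ?thesis using cnt_\<zeta> by (simp add: tarr_comp_tail)
qed

lemma cnt_\<beta>: "cnt Y \<cdot> \<beta> = \<l> \<I> \<cdot> (cnt Y \<boxtimes> cnt X)"
proof -
  have "cnt Y \<cdot> \<beta> = \<l> \<I> \<cdot> (\<one> \<I> \<boxtimes> cnt Y) \<cdot> (cnt X \<boxtimes> \<one> (obj Y)) \<cdot> \<zeta>"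
    using comp_tail[OF lunit_natural[of "cnt Y"], of "(cnt X \<boxtimes> \<one> (obj Y)) \<cdot> \<zeta>"]
    by (simp add: \<beta>_def \<pi>\<^sub>Y_def)
  then show ?thesis using cnt_\<zeta> by (simp add: tarr_comp_tail)
qed

abbreviation prod (infixl "\<star>" 70) where "x \<star> y \<equiv> mul C H x y"

lemma fn_\<theta>: "x \<in> und C (obj X) \<Longrightarrow> y \<in> und C (obj Y) \<Longrightarrow>
    fn \<theta> (pure C (obj X) (obj Y) x y) = fn f x \<star> fn g y"
  unfolding \<theta>_def by (rule fn_mlt_tarr) auto

lemma fn_\<theta>_\<zeta>: "x \<in> und C (obj X) \<Longrightarrow> y \<in> und C (obj Y) \<Longrightarrow>
    fn \<theta> (fn \<zeta> (pure C (obj Y) (obj X) y x)) = fn g y \<star> fn f x"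
  using arg_cong[OF \<theta>_\<zeta>, of "\<lambda>h. fn h (pure C (obj Y) (obj X) y x)"]
    fn_mlt_tarr[of g f H "obj Y" "obj X" y x] by simp

lemma fn_p_\<theta>: "t \<in> und C (obj X \<otimes> obj Y) \<Longrightarrow> fn p (fn \<theta> t) = t"
  using arg_cong[OF p_\<theta>, of "\<lambda>h. fn h t"] by simp

lemma \<zeta>_eqI:
  assumes "x \<in> und C (obj X)" "y \<in> und C (obj Y)" "t \<in> und C (obj X \<otimes> obj Y)"
    "fn \<theta> t = fn g y \<star> fn f x"
  shows "fn \<zeta> (pure C (obj Y) (obj X) y x) = t"
  using assms fn_\<theta>_\<zeta>[OF assms(1,2)] fn_p_\<theta>[of t] fn_p_\<theta>[of "fn \<zeta> (pure C (obj Y) (obj X) y x)"]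
  by simp

lemma fn_\<pi>\<^sub>X: "x \<in> und C (obj X) \<Longrightarrow> y \<in> und C (obj Y) \<Longrightarrow>
    fn \<pi>\<^sub>X (pure C (obj X) (obj Y) x y) = scal C (\<kappa> (fn (cnt Y) y)) x"
proof -
  assume xy: "x \<in> und C (obj X)" "y \<in> und C (obj Y)"
  obtain a where a: "fn (cnt Y) y = scal C a (gen C)"
    using xy unit_scalE[of "fn (cnt Y) y"] by auto
  show ?thesis using xy by (simp add: \<pi>\<^sub>X_def a pure_simps fn_scal)
qed

lemma fn_\<pi>\<^sub>Y: "x \<in> und C (obj X) \<Longrightarrow> y \<in> und C (obj Y) \<Longrightarrow>
    fn \<pi>\<^sub>Y (pure C (obj X) (obj Y) x y) = scal C (\<kappa> (fn (cnt X) x)) y"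
proof -
  assume xy: "x \<in> und C (obj X)" "y \<in> und C (obj Y)"
  obtain a where a: "fn (cnt X) x = scal C a (gen C)"
    using xy unit_scalE[of "fn (cnt X) x"] by auto
  show ?thesis using xy by (simp add: \<pi>\<^sub>Y_def a pure_simps fn_scal)
qed

text \<open>The projection of \<open>XY\<close> to \<open>X\<close> sees a right factor from \<open>Y\<close> only through its counit, and dually
  on the left.  This is why the components of \<open>\<zeta>\<close> are actions.\<close>

lemma \<theta>_mul_right:
  assumes t: "t \<in> und C (obj X \<otimes> obj Y)" and y: "y \<in> und C (obj Y)"
  shows "fn \<theta> t \<star> fn g y \<in> fn \<theta> ` und C (obj X \<otimes> obj Y) \<and>
    fn \<pi>\<^sub>X (fn p (fn \<theta> t \<star> fn g y)) = scal C (\<kappa> (fn (cnt Y) y)) (fn \<pi>\<^sub>X t)"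
  using t
proof (induction t rule: tensor_induct)
  case (pure x y')
  have eq: "fn \<theta> (pure C (obj X) (obj Y) x y') \<star> fn g y = fn \<theta> (pure C (obj X) (obj Y) x (mul C Y y' y))"
    using pure y by (simp add: fn_\<theta> mul_assoc morphism_mul[OF g])
  show ?case unfolding eq
    using pure y by (intro conjI imageI) (simp_all add: fn_p_\<theta> fn_\<pi>\<^sub>X \<kappa>_cnt_mul[OF Y] mult.commute)
next
  case (add s t)
  have eq: "fn \<theta> (s + t) \<star> fn g y = fn \<theta> s \<star> fn g y + fn \<theta> t \<star> fn g y"
    using add y by (simp add: fn_add mul_add)
  obtain u v where "u \<in> und C (obj X \<otimes> obj Y)" "fn \<theta> s \<star> fn g y = fn \<theta> u"
    "v \<in> und C (obj X \<otimes> obj Y)" "fn \<theta> t \<star> fn g y = fn \<theta> v"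
    using add by blast
  then have "fn \<theta> s \<star> fn g y + fn \<theta> t \<star> fn g y = fn \<theta> (u + v)" "u + v \<in> und C (obj X \<otimes> obj Y)"
    by (auto simp: fn_add)
  moreover have "fn \<pi>\<^sub>X (fn p (fn \<theta> s \<star> fn g y + fn \<theta> t \<star> fn g y)) =
      fn \<pi>\<^sub>X (fn p (fn \<theta> s \<star> fn g y)) + fn \<pi>\<^sub>X (fn p (fn \<theta> t \<star> fn g y))"
    using add y by (simp add: fn_add)
  ultimately show ?case unfolding eq using add by (auto simp: fn_add VS.scale_right_distrib)
qed

lemma \<theta>_mul_left:
  assumes t: "t \<in> und C (obj X \<otimes> obj Y)" and x: "x \<in> und C (obj X)"
  shows "fn f x \<star> fn \<theta> t \<in> fn \<theta> ` und C (obj X \<otimes> obj Y) \<and>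
    fn \<pi>\<^sub>Y (fn p (fn f x \<star> fn \<theta> t)) = scal C (\<kappa> (fn (cnt X) x)) (fn \<pi>\<^sub>Y t)"
  using t
proof (induction t rule: tensor_induct)
  case (pure x' y)
  have eq: "fn f x \<star> fn \<theta> (pure C (obj X) (obj Y) x' y) = fn \<theta> (pure C (obj X) (obj Y) (mul C X x x') y)"
    using pure x by (simp add: fn_\<theta> mul_assoc morphism_mul[OF f])
  show ?case unfolding eq
    using pure x by (intro conjI imageI) (simp_all add: fn_p_\<theta> fn_\<pi>\<^sub>Y \<kappa>_cnt_mul[OF X])
next
  case (add s t)
  have eq: "fn f x \<star> fn \<theta> (s + t) = fn f x \<star> fn \<theta> s + fn f x \<star> fn \<theta> t"
    using add x by (simp add: fn_add mul_add)
  obtain u v where "u \<in> und C (obj X \<otimes> obj Y)" "fn f x \<star> fn \<theta> s = fn \<theta> u"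
    "v \<in> und C (obj X \<otimes> obj Y)" "fn f x \<star> fn \<theta> t = fn \<theta> v"
    using add by blast
  then have "fn f x \<star> fn \<theta> s + fn f x \<star> fn \<theta> t = fn \<theta> (u + v)" "u + v \<in> und C (obj X \<otimes> obj Y)"
    by (auto simp: fn_add)
  moreover have "fn \<pi>\<^sub>Y (fn p (fn f x \<star> fn \<theta> s + fn f x \<star> fn \<theta> t)) =
      fn \<pi>\<^sub>Y (fn p (fn f x \<star> fn \<theta> s)) + fn \<pi>\<^sub>Y (fn p (fn f x \<star> fn \<theta> t))"
    using add x by (simp add: fn_add)
  ultimately show ?case unfolding eq using add by (auto simp: fn_add VS.scale_right_distrib)
qed

lemma fn_\<alpha>_\<zeta>: "x \<in> und C (obj X) \<Longrightarrow> y \<in> und C (obj Y) \<Longrightarrow>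
    fn \<alpha> (pure C (obj Y) (obj X) y x) = fn \<pi>\<^sub>X (fn \<zeta> (pure C (obj Y) (obj X) y x))"
  by (simp add: \<alpha>_def)

lemma fn_\<beta>_\<zeta>: "x \<in> und C (obj X) \<Longrightarrow> y \<in> und C (obj Y) \<Longrightarrow>
    fn \<beta> (pure C (obj Y) (obj X) y x) = fn \<pi>\<^sub>Y (fn \<zeta> (pure C (obj Y) (obj X) y x))"
  by (simp add: \<beta>_def)

lemma fn_\<alpha>: "x \<in> und C (obj X) \<Longrightarrow> y \<in> und C (obj Y) \<Longrightarrow>
    fn \<alpha> (pure C (obj Y) (obj X) y x) = fn \<pi>\<^sub>X (fn p (fn g y \<star> fn f x))"
  using fn_\<theta>_\<zeta>[of x y] fn_p_\<theta>[of "fn \<zeta> (pure C (obj Y) (obj X) y x)"] by (simp add: \<alpha>_def)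

lemma fn_\<beta>: "x \<in> und C (obj X) \<Longrightarrow> y \<in> und C (obj Y) \<Longrightarrow>
    fn \<beta> (pure C (obj Y) (obj X) y x) = fn \<pi>\<^sub>Y (fn p (fn g y \<star> fn f x))"
  using fn_\<theta>_\<zeta>[of x y] fn_p_\<theta>[of "fn \<zeta> (pure C (obj Y) (obj X) y x)"] by (simp add: \<beta>_def)

text \<open>Inside \<open>\<alpha>\<close> an element of \<open>XY\<close> may be replaced by its projection to \<open>X\<close>, since the part in \<open>Y\<close>
  is projected away in the end; applied to \<open>y' x\<close> this is the module axiom.\<close>

lemma \<alpha>_absorb:
  assumes t: "t \<in> und C (obj X \<otimes> obj Y)" and y: "y \<in> und C (obj Y)"
  shows "fn \<pi>\<^sub>X (fn p (fn g y \<star> fn f (fn \<pi>\<^sub>X t))) = fn \<pi>\<^sub>X (fn p (fn g y \<star> fn \<theta> t))"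
  using t
proof (induction t rule: tensor_induct)
  case (pure x y')
  let ?s = "fn \<zeta> (pure C (obj Y) (obj X) y x)"
  have "fn g y \<star> fn \<theta> (pure C (obj X) (obj Y) x y') = fn \<theta> ?s \<star> fn g y'"
    using pure y by (simp add: fn_\<theta> fn_\<theta>_\<zeta> mul_assoc)
  then have "fn \<pi>\<^sub>X (fn p (fn g y \<star> fn \<theta> (pure C (obj X) (obj Y) x y'))) =
      scal C (\<kappa> (fn (cnt Y) y')) (fn \<pi>\<^sub>X ?s)"
    using \<theta>_mul_right[of ?s y'] pure y by simp
  moreover have "fn \<pi>\<^sub>X (fn p (fn g y \<star> fn f x)) = fn \<pi>\<^sub>X ?s"
    using fn_\<alpha>[of x y] pure y by (simp add: \<alpha>_def)
  ultimately show ?case using pure y by (simp add: fn_\<pi>\<^sub>X fn_scal mul_scal)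
next
  case (add s t)
  then show ?case using y by (simp add: fn_add mul_add)
qed

lemma \<beta>_absorb:
  assumes t: "t \<in> und C (obj X \<otimes> obj Y)" and x: "x \<in> und C (obj X)"
  shows "fn \<pi>\<^sub>Y (fn p (fn g (fn \<pi>\<^sub>Y t) \<star> fn f x)) = fn \<pi>\<^sub>Y (fn p (fn \<theta> t \<star> fn f x))"
  using t
proof (induction t rule: tensor_induct)
  case (pure x' y)
  let ?s = "fn \<zeta> (pure C (obj Y) (obj X) y x)"
  have "fn \<theta> (pure C (obj X) (obj Y) x' y) \<star> fn f x = fn f x' \<star> fn \<theta> ?s"
    using pure x by (simp add: fn_\<theta> fn_\<theta>_\<zeta> mul_assoc)
  then have "fn \<pi>\<^sub>Y (fn p (fn \<theta> (pure C (obj X) (obj Y) x' y) \<star> fn f x)) =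
      scal C (\<kappa> (fn (cnt X) x')) (fn \<pi>\<^sub>Y ?s)"
    using \<theta>_mul_left[of ?s x'] pure x by simp
  moreover have "fn \<pi>\<^sub>Y (fn p (fn g y \<star> fn f x)) = fn \<pi>\<^sub>Y ?s"
    using fn_\<beta>[of x y] pure x by (simp add: \<beta>_def)
  ultimately show ?case using pure x by (simp add: fn_\<pi>\<^sub>Y fn_scal mul_scal)
next
  case (add s t)
  then show ?case using x by (simp add: fn_add mul_add)
qed

lemma left_module_coalgebra: "left_module_coalgebra C Y X \<alpha>"
proof -
  have act: "\<alpha> \<cdot> (mlt Y \<boxtimes> \<one> (obj X)) = \<alpha> \<cdot> (\<one> (obj Y) \<boxtimes> \<alpha>) \<cdot> \<a> (obj Y) (obj Y) (obj X)"
  proof (rule tens_left_arr_eqI[of _ _ "obj Y" "obj Y" "obj X"])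
    fix y y' x assume xy: "y \<in> und C (obj Y)" "y' \<in> und C (obj Y)" "x \<in> und C (obj X)"
    let ?s = "fn \<zeta> (pure C (obj Y) (obj X) y' x)"
    have "fn \<alpha> (pure C (obj Y) (obj X) y (fn \<alpha> (pure C (obj Y) (obj X) y' x))) =
        fn \<pi>\<^sub>X (fn p (fn g y \<star> fn f (fn \<pi>\<^sub>X ?s)))"
      using xy fn_\<alpha>_\<zeta>[of x y'] by (simp add: fn_\<alpha>[of "fn \<pi>\<^sub>X ?s"])
    also have "\<dots> = fn \<pi>\<^sub>X (fn p (fn g y \<star> (fn g y' \<star> fn f x)))"
      using xy by (simp add: \<alpha>_absorb fn_\<theta>_\<zeta>)
    also have "\<dots> = fn \<alpha> (pure C (obj Y) (obj X) (mul C Y y y') x)"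
      using xy by (simp add: fn_\<alpha> morphism_mul[OF g] mul_assoc)
    finally show "fn (\<alpha> \<cdot> (mlt Y \<boxtimes> \<one> (obj X))) (pure C (obj Y \<otimes> obj Y) (obj X) (pure C (obj Y) (obj Y) y y') x) =
      fn (\<alpha> \<cdot> (\<one> (obj Y) \<boxtimes> \<alpha>) \<cdot> \<a> (obj Y) (obj Y) (obj X)) (pure C (obj Y \<otimes> obj Y) (obj X) (pure C (obj Y) (obj Y) y y') x)"
      using xy by (simp add: mul_def)
  qed auto
  have unit: "\<alpha> \<cdot> (unt Y \<boxtimes> \<one> (obj X)) = \<l> (obj X)"
  proof (rule tens_arr_eqI[of _ _ "\<I>" "obj X"])
    fix t x assume x: "x \<in> und C (obj X)" and "t \<in> und C \<I>"
    then obtain a where a: "t = scal C a (gen C)" by (elim unit_scalE)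
    have "fn \<zeta> (pure C (obj Y) (obj X) (fn (unt Y) (gen C)) x) = pure C (obj X) (obj Y) x (fn (unt Y) (gen C))"
      using x by (intro \<zeta>_eqI) (auto simp: fn_\<theta> morphism_unit[OF g] mul_unit)
    then have "fn \<alpha> (pure C (obj Y) (obj X) (fn (unt Y) (gen C)) x) = x"
      using x by (simp add: \<alpha>_def fn_\<pi>\<^sub>X cnt_unit[OF Y])
    then show "fn (\<alpha> \<cdot> (unt Y \<boxtimes> \<one> (obj X))) (pure C \<I> (obj X) t x) = fn (\<l> (obj X)) (pure C \<I> (obj X) t x)"
      using x by (simp add: a pure_simps fn_scal)
  qed auto
  show ?thesis
    unfolding left_module_coalgebra_def using act unit cml_\<alpha> cnt_\<alpha> by (auto intro: homI)
qed

lemma right_module_coalgebra: "right_module_coalgebra C X Y \<beta>"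
proof -
  have act: "\<beta> \<cdot> (\<beta> \<boxtimes> \<one> (obj X)) = \<beta> \<cdot> (\<one> (obj Y) \<boxtimes> mlt X) \<cdot> \<a> (obj Y) (obj X) (obj X)"
  proof (rule tens_left_arr_eqI[of _ _ "obj Y" "obj X" "obj X"])
    fix y x x' assume xy: "y \<in> und C (obj Y)" "x \<in> und C (obj X)" "x' \<in> und C (obj X)"
    let ?s = "fn \<zeta> (pure C (obj Y) (obj X) y x)"
    have "fn \<beta> (pure C (obj Y) (obj X) (fn \<beta> (pure C (obj Y) (obj X) y x)) x') =
        fn \<pi>\<^sub>Y (fn p (fn g (fn \<pi>\<^sub>Y ?s) \<star> fn f x'))"
      using xy fn_\<beta>_\<zeta>[of x y] by (simp add: fn_\<beta>[of x' "fn \<pi>\<^sub>Y ?s"])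
    also have "\<dots> = fn \<pi>\<^sub>Y (fn p ((fn g y \<star> fn f x) \<star> fn f x'))"
      using xy by (simp add: \<beta>_absorb fn_\<theta>_\<zeta>)
    also have "\<dots> = fn \<beta> (pure C (obj Y) (obj X) y (mul C X x x'))"
      using xy by (simp add: fn_\<beta> morphism_mul[OF f] mul_assoc)
    finally show "fn (\<beta> \<cdot> (\<beta> \<boxtimes> \<one> (obj X))) (pure C (obj Y \<otimes> obj X) (obj X) (pure C (obj Y) (obj X) y x) x') =
      fn (\<beta> \<cdot> (\<one> (obj Y) \<boxtimes> mlt X) \<cdot> \<a> (obj Y) (obj X) (obj X)) (pure C (obj Y \<otimes> obj X) (obj X) (pure C (obj Y) (obj X) y x) x')"
      using xy by (simp add: mul_def)
  qed auto
  have unit: "\<beta> \<cdot> (\<one> (obj Y) \<boxtimes> unt X) = \<r> (obj Y)"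
  proof (rule tens_arr_eqI[of _ _ "obj Y" "\<I>"])
    fix t y assume y: "y \<in> und C (obj Y)" and "t \<in> und C \<I>"
    then obtain a where a: "t = scal C a (gen C)" by (elim unit_scalE)
    have "fn \<zeta> (pure C (obj Y) (obj X) y (fn (unt X) (gen C))) = pure C (obj X) (obj Y) (fn (unt X) (gen C)) y"
      using y by (intro \<zeta>_eqI) (auto simp: fn_\<theta> morphism_unit[OF f] mul_unit)
    then have "fn \<beta> (pure C (obj Y) (obj X) y (fn (unt X) (gen C))) = y"
      using y by (simp add: \<beta>_def fn_\<pi>\<^sub>Y cnt_unit[OF X])
    then show "fn (\<beta> \<cdot> (\<one> (obj Y) \<boxtimes> unt X)) (pure C (obj Y) \<I> y t) = fn (\<r> (obj Y)) (pure C (obj Y) \<I> y t)"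
      using y by (simp add: a pure_simps fn_scal)
  qed auto
  show ?thesis
    unfolding right_module_coalgebra_def using act unit cml_\<beta> cnt_\<beta> by (auto intro: homI)
qed

abbreviation dcp where "dcp \<equiv> double_cross_product C X \<alpha> \<beta> Y"

lemma dcp_sel:
  "obj dcp = obj X \<otimes> obj Y"
  "unt dcp = (unt X \<boxtimes> unt Y) \<cdot> inv_arr C (\<l> \<I>)"
  "cml dcp = \<Delta>\<^sub>X\<^sub>Y"
  "cnt dcp = \<l> \<I> \<cdot> (cnt X \<boxtimes> cnt Y)"
  by (simp_all add: double_cross_product_def)

text \<open>The three middle maps in the definition of the multiplication compose to \<open>\<zeta>\<close>.\<close>

lemma mlt_dcp: "mlt dcp = (mlt X \<boxtimes> mlt Y) \<cdot> inv_arr C (regroup C (obj X) (obj X) (obj Y) (obj Y)) \<cdot>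
    (\<one> (obj X) \<boxtimes> \<zeta> \<boxtimes> \<one> (obj Y)) \<cdot> regroup C (obj X) (obj Y) (obj X) (obj Y)"
  by (simp add: double_cross_product_def tarr_comp_tail tarr_comp \<zeta>_actions)

text \<open>Both sides multiply four elements of \<open>H\<close>, as \<open>x (y x') y'\<close> with \<open>y x'\<close> rewritten by \<open>\<zeta>\<close>, and as
  \<open>(x y) (x' y')\<close>.\<close>

lemma \<theta>_mlt: "\<theta> \<cdot> mlt dcp = mlt H \<cdot> (\<theta> \<boxtimes> \<theta>)"
proof -
  let ?S = "regroup C (obj X) (obj X) (obj Y) (obj Y)" and ?R = "regroup C (obj X) (obj Y) (obj X) (obj Y)"
  have "\<theta> \<cdot> mlt dcp = mlt H \<cdot> ((mlt H \<cdot> (f \<boxtimes> f)) \<boxtimes> (mlt H \<cdot> (g \<boxtimes> g))) \<cdot> inv_arr C ?S \<cdot>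
      (\<one> (obj X) \<boxtimes> \<zeta> \<boxtimes> \<one> (obj Y)) \<cdot> ?R"
    by (simp add: mlt_dcp \<theta>_def tarr_comp_tail bialgebra_morphismD(4)[OF f] bialgebra_morphismD(4)[OF g])
  also have "\<dots> = mlt H \<cdot> (f \<boxtimes> (mlt H \<cdot> (\<theta> \<boxtimes> g))) \<cdot> (\<one> (obj X) \<boxtimes> \<zeta> \<boxtimes> \<one> (obj Y)) \<cdot> ?R"
    using comp_tail[OF mlt_quad[of H f f g g], of "inv_arr C ?S \<cdot> (\<one> (obj X) \<boxtimes> \<zeta> \<boxtimes> \<one> (obj Y)) \<cdot> ?R"]
    by (simp add: \<theta>_def comp_inv_tail)
  also have "\<dots> = mlt H \<cdot> (f \<boxtimes> (mlt H \<cdot> ((mlt H \<cdot> (g \<boxtimes> f)) \<boxtimes> g))) \<cdot> ?R"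
    by (simp add: tarr_comp_tail tarr_comp \<theta>_\<zeta>)
  also have "\<dots> = mlt H \<cdot> (\<theta> \<boxtimes> \<theta>)"
    using mlt_quad[of H f g f g] by (simp add: \<theta>_def)
  finally show ?thesis .
qed

lemma \<theta>_unt: "\<theta> \<cdot> unt dcp = unt H"
proof -
  have "\<theta> \<cdot> unt dcp = mlt H \<cdot> (unt H \<boxtimes> unt H) \<cdot> inv_arr C (\<l> \<I>)"
    by (simp add: \<theta>_def dcp_sel tarr_comp_tail bialgebra_morphismD(5)[OF f] bialgebra_morphismD(5)[OF g])
  then show ?thesis
    using comp_tail[OF mlt_unit_left[of H "unt H"], of "inv_arr C (\<l> \<I>)"] by (simp add: comp_inv)
qed

lemma \<theta>_morphism: "bialgebra_morphism C dcp H \<theta>"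
  unfolding bialgebra_morphism_def
  using \<theta>_mlt \<theta>_unt cml_\<theta> cnt_\<theta> by (auto simp: dcp_sel intro: homI)

lemma bialgebra_dcp: "bialgebra C dcp"
  by (rule bialgebra_transport[OF H \<theta>_morphism])
    (use p p_\<theta> in \<open>auto simp: dcp_sel mlt_dcp intro!: homI\<close>)

end

section \<open>Dimensions\<close>

context concrete_tensor_category
begin

lemma fin_dim_basis:
  assumes "fin_dim C X"
  obtains B where "finite B" "B \<subseteq> und C X" "VS.independent B" "VS.span B = und C X" "card B = vdim C X"
proof -
  obtain G where G: "finite G" "und C X = VS.span G"
    using assms by (auto simp: fin_dim_def)
  obtain B where B: "B \<subseteq> und C X" "VS.independent B" "und C X \<subseteq> VS.span B" "card B = VS.dim (und C X)"
    by (rule VS.basis_exists)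
  have "finite B" using VS.independent_span_bound[OF G(1) B(2)] B(1) G(2) by auto
  moreover have "VS.span B = und C X" using B VS.span_minimal[OF B(1)] by auto
  ultimately show thesis using that B by (simp add: vdim_def)
qed

lemma vdim_eq_card: "VS.independent B \<Longrightarrow> VS.span B = und C X \<Longrightarrow> vdim C X = card B"
  unfolding vdim_def by (metis VS.dim_eq_card VS.span_span)

lemma tensor_basis:
  assumes X: "finite B" "VS.independent B" "VS.span B = und C X"
    and Y: "finite D" "VS.independent D" "VS.span D = und C Y"
  defines "T \<equiv> (\<lambda>(b, d). pure C X Y b d) ` (B \<times> D)"
  shows "VS.independent T" "VS.span T = und C (X \<otimes> Y)" "card T = card B * card D"
proof -
  have BX: "b \<in> und C X" if "b \<in> B" for b using that X(3) VS.span_base by blast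
  have DY: "d \<in> und C Y" if "d \<in> D" for d using that Y(3) VS.span_base by blast
  (* The coordinate of a tensor at (b0, d0), as a multiple of gen, comes from the bilinear map
     that multiplies the coordinate at b0 with the one at d0. *)
  have coord: "\<exists>h. Vector_Spaces.linear (scal C) (scal C) h \<and> (\<forall>b\<in>B. \<forall>d\<in>D.
      h (pure C X Y b d) = (if b = b0 \<and> d = d0 then gen C else 0))" if bd: "b0 \<in> B" "d0 \<in> D" for b0 d0
  proof -
    let ?rx = "\<lambda>x. VS.representation B x b0" and ?ry = "\<lambda>y. VS.representation D y d0"
    have "bilinear_on C (und C X) (und C Y) (\<lambda>x y. scal C (?rx x * ?ry y) (gen C))"
      by (intro bilinear_onI)
        (simp_all add: X(3) Y(3) VS.representation_add[OF X(2)] VS.representation_add[OF Y(2)]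
          VS.representation_scale[OF X(2)] VS.representation_scale[OF Y(2)]
          distrib_left distrib_right VS.scale_left_distrib mult.left_commute mult.assoc)
    then obtain h where h: "h \<in> linmaps C (und C (X \<otimes> Y)) UNIV"
      "\<And>x y. x \<in> und C X \<Longrightarrow> y \<in> und C Y \<Longrightarrow> h (pure C X Y x y) = scal C (?rx x * ?ry y) (gen C)"
      by (rule bilinear_lift[where W = UNIV]) auto
    obtain k where k: "Vector_Spaces.linear (scal C) (scal C) k" "\<And>t. t \<in> und C (X \<otimes> Y) \<Longrightarrow> k t = h t"
      by (rule linmaps_extend[OF h(1)]) auto
    have "k (pure C X Y b d) = (if b = b0 \<and> d = d0 then gen C else 0)" if "b \<in> B" "d \<in> D" for b d
      using that by (auto simp: BX DY k(2) h(2) VS.representation_basis[OF X(2)] VS.representation_basis[OF Y(2)])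
    then show ?thesis using k(1) by blast
  qed
  have inj: "inj_on (\<lambda>(b, d). pure C X Y b d) (B \<times> D)"
  proof (rule inj_onI, clarify)
    fix b d b' d' assume *: "b \<in> B" "d \<in> D" "b' \<in> B" "d' \<in> D" "pure C X Y b d = pure C X Y b' d'"
    obtain h where "\<forall>x\<in>B. \<forall>y\<in>D. h (pure C X Y x y) = (if x = b \<and> y = d then gen C else 0)"
      using coord[OF *(1,2)] by blast
    then have "(if b' = b \<and> d' = d then gen C else 0) = gen C" using * by metis
    then show "b = b' \<and> d = d'" using gen_nonzero by (auto split: if_splits)
  qed
  then show "card T = card B * card D"
    unfolding T_def by (simp add: card_image card_cartesian_product)
  have finT: "finite T" unfolding T_def using X Y by simp
  show "VS.independent T"
  proof (rule VS.independent_if_scalars_zero[OF finT])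
    fix u t0 assume s: "(\<Sum>t\<in>T. scal C (u t) t) = 0" and t0: "t0 \<in> T"
    obtain b0 d0 where bd: "b0 \<in> B" "d0 \<in> D" "t0 = pure C X Y b0 d0" using t0 by (auto simp: T_def)
    obtain h where h: "Vector_Spaces.linear (scal C) (scal C) h"
      "\<forall>x\<in>B. \<forall>y\<in>D. h (pure C X Y x y) = (if x = b0 \<and> y = d0 then gen C else 0)"
      using coord[OF bd(1,2)] by blast
    have ht: "h t = (if t = t0 then gen C else 0)" if tT: "t \<in> T" for t
    proof -
      obtain b d where t: "b \<in> B" "d \<in> D" "t = pure C X Y b d" using tT by (auto simp: T_def)
      have "t = t0 \<longleftrightarrow> b = b0 \<and> d = d0"
        using inj_onD[OF inj, of "(b, d)" "(b0, d0)"] t bd by auto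
      then show ?thesis using h(2) t by simp
    qed
    have "0 = h (\<Sum>t\<in>T. scal C (u t) t)" using s VP.linear_0[OF h(1)] by simp
    also have "\<dots> = (\<Sum>t\<in>T. scal C (u t) (h t))"
      by (simp add: VP.linear_sum[OF h(1)] VP.linear_scale[OF h(1)])
    also have "\<dots> = (\<Sum>t\<in>T. if t = t0 then scal C (u t) (gen C) else 0)"
      by (rule sum.cong) (auto simp: ht)
    also have "\<dots> = scal C (u t0) (gen C)" using finT t0 by simp
    finally show "u t0 = 0" using gen_nonzero by simp
  qed
  have TX: "T \<subseteq> und C (X \<otimes> Y)" unfolding T_def using BX DY by auto
  have 1: "pure C X Y x d \<in> VS.span T" if d: "d \<in> D" and x: "x \<in> und C X" for x d
  proof -
    have "VS.subspace {x \<in> und C X. pure C X Y x d \<in> VS.span T}"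
      unfolding VS.subspace_def using DY[OF d] pure_simps(3)[of 0 X d Y 0]
      by (auto simp: pure_simps VS.span_add VS.span_scale VS.span_zero)
    moreover have "B \<subseteq> {x \<in> und C X. pure C X Y x d \<in> VS.span T}"
      using BX d by (auto simp: T_def intro!: VS.span_base)
    ultimately have "VS.span B \<subseteq> {x \<in> und C X. pure C X Y x d \<in> VS.span T}"
      by (rule VS.span_minimal[rotated])
    then show ?thesis using x X(3) by blast
  qed
  have 2: "pure C X Y x y \<in> VS.span T" if x: "x \<in> und C X" and y: "y \<in> und C Y" for x y
  proof -
    have "VS.subspace {y \<in> und C Y. pure C X Y x y \<in> VS.span T}"
      unfolding VS.subspace_def using x pure_simps(4)[of x X 0 Y 0]
      by (auto simp: pure_simps VS.span_add VS.span_scale VS.span_zero)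
    moreover have "D \<subseteq> {y \<in> und C Y. pure C X Y x y \<in> VS.span T}"
      using DY 1 x by auto
    ultimately have "VS.span D \<subseteq> {y \<in> und C Y. pure C X Y x y \<in> VS.span T}"
      by (rule VS.span_minimal[rotated])
    then show ?thesis using y Y(3) by blast
  qed
  have "VS.span T \<subseteq> und C (X \<otimes> Y)" by (rule VS.span_minimal[OF TX]) auto
  moreover have "und C (X \<otimes> Y) \<subseteq> VS.span T"
    unfolding und_tensor by (rule VS.span_minimal) (use 2 in auto)
  ultimately show "VS.span T = und C (X \<otimes> Y)" by blast
qed

lemma fin_dim_tensor:
  assumes "fin_dim C X" "fin_dim C Y"
  shows "fin_dim C (X \<otimes> Y)" "vdim C (X \<otimes> Y) = vdim C X * vdim C Y"
proof -
  obtain B where B: "finite B" "B \<subseteq> und C X" "VS.independent B" "VS.span B = und C X" "card B = vdim C X"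
    using fin_dim_basis[OF assms(1)] .
  obtain D where D: "finite D" "D \<subseteq> und C Y" "VS.independent D" "VS.span D = und C Y" "card D = vdim C Y"
    using fin_dim_basis[OF assms(2)] .
  let ?T = "(\<lambda>(b, d). pure C X Y b d) ` (B \<times> D)"
  note T = tensor_basis[OF B(1,3,4) D(1,3,4)]
  have "finite ?T" using B(1) D(1) by simp
  moreover have "?T \<subseteq> und C (X \<otimes> Y)" using VS.span_superset[of ?T] unfolding T(2) .
  ultimately show "fin_dim C (X \<otimes> Y)" unfolding fin_dim_def using T(2)[symmetric] by blast
  show "vdim C (X \<otimes> Y) = vdim C X * vdim C Y"
    using vdim_eq_card[OF T(1,2)] T(3) B(5) D(5) by simp
qed

lemma arr_extend:
  assumes "is_arr C f"
  obtains h where "Vector_Spaces.linear (scal C) (scal C) h" "\<And>x. x \<in> und C (src f) \<Longrightarrow> h x = fn f x"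
  using linmaps_extend[OF is_arr_linmaps[OF assms]] by auto

lemma image_span:
  assumes f: "is_arr C f" and P: "und C (src f) = VS.span P"
  shows "fn f ` und C (src f) = VS.span (fn f ` P)"
proof -
  obtain h where h: "Vector_Spaces.linear (scal C) (scal C) h" "\<And>x. x \<in> und C (src f) \<Longrightarrow> h x = fn f x"
    using arr_extend[OF f] by blast
  have "P \<subseteq> und C (src f)" using P VS.span_superset by blast
  then have "fn f ` P = h ` P" "fn f ` und C (src f) = h ` VS.span P" using h(2) P by (auto intro!: image_cong)
  then show ?thesis using VP.linear_span_image[OF h(1)] by simp
qed

lemma injective_image_independent:
  assumes f: "is_arr C f" "inj_on (fn f) (und C (src f))" and B: "VS.independent B" "VS.span B = und C (src f)"
  shows "VS.independent (fn f ` B)"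
proof -
  obtain h where h: "Vector_Spaces.linear (scal C) (scal C) h" "\<And>x. x \<in> und C (src f) \<Longrightarrow> h x = fn f x"
    using arr_extend[OF f(1)] by blast
  have "B \<subseteq> und C (src f)" using B VS.span_superset by blast
  then have "fn f ` B = h ` B" using h(2) by (auto intro!: image_cong)
  moreover have "inj_on h (VS.span B)" using f(2) h(2) inj_on_cong[of "und C (src f)" h "fn f"] by (simp add: B(2))
  ultimately show ?thesis using VP.linear_independent_injective_image[OF h(1) B(1)] by simp
qed

lemma fin_dim_inj:
  assumes f: "is_arr C f" "inj_on (fn f) (und C (src f))" and fin: "fin_dim C (trg f)"
  shows "fin_dim C (src f)"
proof -
  obtain G where G: "finite G" "und C (trg f) = VS.span G" using fin by (auto simp: fin_dim_def)
  obtain B where B: "B \<subseteq> und C (src f)" "VS.independent B" "und C (src f) \<subseteq> VS.span B"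
    using VS.maximal_independent_subset by blast
  have sp: "VS.span B = und C (src f)" using B VS.span_minimal[OF B(1)] by auto
  have "fn f ` B \<subseteq> VS.span G" using B(1) f(1) G(2)[symmetric] by auto
  then have "finite (fn f ` B)"
    using VS.independent_span_bound[OF G(1) injective_image_independent[OF f B(2) sp]] by blast
  then have "finite B" using inj_on_subset[OF f(2) B(1)] by (simp add: finite_image_iff)
  then show ?thesis unfolding fin_dim_def using B(1) sp[symmetric] by blast
qed

lemma vdim_bij:
  assumes f: "is_arr C f" "bij_betw (fn f) (und C (src f)) (und C (trg f))" and fin: "fin_dim C (src f)"
  shows "vdim C (src f) = vdim C (trg f)"
proof -
  obtain B where B: "finite B" "B \<subseteq> und C (src f)" "VS.independent B" "VS.span B = und C (src f)"
    "card B = vdim C (src f)"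
    using fin_dim_basis[OF fin] .
  have inj: "inj_on (fn f) (und C (src f))" using f(2) by (simp add: bij_betw_def)
  have "vdim C (trg f) = card (fn f ` B)"
    using vdim_eq_card[OF injective_image_independent[OF f(1) inj B(3,4)], of "trg f"]
      image_span[OF f(1), of B] B(4) f(2) by (simp add: bij_betw_def)
  also have "\<dots> = card B" using inj B(2) by (metis card_image inj_on_subset)
  finally show ?thesis using B(5) by simp
qed

text \<open>The image of a basis spans a space of the same dimension, so it is again a basis.\<close>

lemma surjective_bij:
  assumes f: "is_arr C f" "fn f ` und C (src f) = und C (trg f)"
    and fin: "fin_dim C (src f)" and dim: "vdim C (src f) = vdim C (trg f)"
  shows "bij_betw (fn f) (und C (src f)) (und C (trg f))"
proof -
  obtain B where B: "finite B" "B \<subseteq> und C (src f)" "VS.independent B" "VS.span B = und C (src f)"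
    "card B = vdim C (src f)"
    using fin_dim_basis[OF fin] .
  obtain h where h: "Vector_Spaces.linear (scal C) (scal C) h" "\<And>x. x \<in> und C (src f) \<Longrightarrow> h x = fn f x"
    using arr_extend[OF f(1)] by blast
  have hB: "fn f ` B = h ` B" using h(2) B(2) by (auto intro!: image_cong)
  have sp: "VS.span (h ` B) = und C (trg f)" using image_span[OF f(1), of B] B(4) f(2) hB by simp
  (* A basis E chosen among the image vectors has as many elements as B, so it contains them all. *)
  obtain E where E: "E \<subseteq> h ` B" "VS.independent E" "h ` B \<subseteq> VS.span E"
    using VS.maximal_independent_subset by blast
  have "VS.span E = und C (trg f)"
    using sp VS.span_mono[OF E(1)] VS.span_minimal[OF E(3) VS.subspace_span] by auto
  then have cE: "card E = card B" using vdim_eq_card[OF E(2)] dim B(5) by simp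
  have "card (h ` B) \<le> card B" using B(1) by (rule card_image_le)
  then have EhB: "E = h ` B"
    using card_subset_eq[of "h ` B" E] E(1) cE B(1) card_mono[of "h ` B" E] by simp
  then have "inj_on h B" using cE B(1) by (simp add: eq_card_imp_inj_on)
  then have "inj_on h (VS.span B)"
    using VP.linear_inj_on_span_independent_image[OF h(1)] E(2) EhB by blast
  then have "inj_on (fn f) (und C (src f))" using h(2) inj_on_cong[of "und C (src f)" h "fn f"] by (simp add: B(4))
  then show ?thesis using f(2) by (simp add: bij_betw_def)
qed

end

section \<open>Bracketed products of several factors\<close>

lemma factors_pos [simp]: "factors \<tau> \<noteq> 0" "0 < factors \<tau>"
  by (induction \<tau>) auto

lemma upt_factors: "[l..<l + factors (Pair \<sigma> \<tau>)] = [l..<l + factors \<sigma>] @ [l + factors \<sigma>..<l + factors \<sigma> + factors \<tau>]"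
  using upt_add_eq_append[of l "l + factors \<sigma>" "factors \<tau>"] by (simp add: add.assoc)

lemma listset_append: "listset (Vs @ Ws) = {xs @ ys | xs ys. xs \<in> listset Vs \<and> ys \<in> listset Ws}"
  by (induction Vs) (auto simp: set_Cons_def, metis append_Cons, blast)

lemma listset_length: "xs \<in> listset Vs \<Longrightarrow> length xs = length Vs"
  by (induction Vs arbitrary: xs) (auto simp: set_Cons_def)

lemma listset_set: "xs \<in> listset Vs \<Longrightarrow> set xs \<subseteq> \<Union> (set Vs)"
  by (induction Vs arbitrary: xs) (fastforce simp: set_Cons_def)+

text \<open>Only the actions whose index belongs to a symbol between two factors of \<open>\<tau>\<close> occur.  This permits
  to merge independently chosen actions for the two parts of a bracket.\<close>

lemma multi_dcp_cong:
  assumes "\<And>i. l \<le> i \<Longrightarrow> Suc i < l + factors \<tau> \<Longrightarrow> \<alpha> i = \<alpha>' i \<and> \<beta> i = \<beta>' i"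
  shows "multi_dcp C A \<alpha> \<beta> l \<tau> = multi_dcp C A \<alpha>' \<beta>' l \<tau>"
    "multi_dcp_defined C A \<alpha> \<beta> l \<tau> = multi_dcp_defined C A \<alpha>' \<beta>' l \<tau>"
proof -
  have "multi_dcp C A \<alpha> \<beta> l \<tau> = multi_dcp C A \<alpha>' \<beta>' l \<tau> \<and>
    multi_dcp_defined C A \<alpha> \<beta> l \<tau> = multi_dcp_defined C A \<alpha>' \<beta>' l \<tau>"
    using assms
  proof (induction \<tau> arbitrary: l)
    case (Pair \<sigma> \<tau>)
    have "multi_dcp C A \<alpha> \<beta> l \<sigma> = multi_dcp C A \<alpha>' \<beta>' l \<sigma> \<and>
      multi_dcp_defined C A \<alpha> \<beta> l \<sigma> = multi_dcp_defined C A \<alpha>' \<beta>' l \<sigma>"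
      by (rule Pair.IH(1)) (use Pair.prems in auto)
    moreover have "multi_dcp C A \<alpha> \<beta> (l + factors \<sigma>) \<tau> = multi_dcp C A \<alpha>' \<beta>' (l + factors \<sigma>) \<tau> \<and>
      multi_dcp_defined C A \<alpha> \<beta> (l + factors \<sigma>) \<tau> = multi_dcp_defined C A \<alpha>' \<beta>' (l + factors \<sigma>) \<tau>"
      by (rule Pair.IH(2)) (use Pair.prems in auto)
    moreover have "\<alpha> (l + factors \<sigma> - 1) = \<alpha>' (l + factors \<sigma> - 1) \<and> \<beta> (l + factors \<sigma> - 1) = \<beta>' (l + factors \<sigma> - 1)"
      by (rule Pair.prems) (use factors_pos[of \<sigma>] factors_pos[of \<tau>] in \<open>auto simp del: factors_pos\<close>)
    ultimately show ?case by (simp add: Let_def)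
  qed simp
  then show "multi_dcp C A \<alpha> \<beta> l \<tau> = multi_dcp C A \<alpha>' \<beta>' l \<tau>"
    "multi_dcp_defined C A \<alpha> \<beta> l \<tau> = multi_dcp_defined C A \<alpha>' \<beta>' l \<tau>" by auto
qed

lemma obj_multi_dcp [simp]: "obj (multi_dcp C A \<alpha> \<beta> l \<tau>) = multi_obj C A l \<tau>"
  by (induction \<tau> arbitrary: l) (simp_all add: double_cross_product_def)

context concrete_braided_category
begin

lemma fin_dim_multi_obj:
  assumes "\<And>i. i \<in> {l..<l + factors \<tau>} \<Longrightarrow> fin_dim C (obj (A i))"
  shows "fin_dim C (multi_obj C A l \<tau>)"
    "vdim C (multi_obj C A l \<tau>) = (\<Prod>i\<in>{l..<l + factors \<tau>}. vdim C (obj (A i)))"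
proof -
  have "fin_dim C (multi_obj C A l \<tau>) \<and>
    vdim C (multi_obj C A l \<tau>) = (\<Prod>i\<in>{l..<l + factors \<tau>}. vdim C (obj (A i)))"
    using assms
  proof (induction \<tau> arbitrary: l)
    case (Pair \<sigma> \<tau>)
    have "{l..<l + factors (Pair \<sigma> \<tau>)} = {l..<l + factors \<sigma>} \<union> {l + factors \<sigma>..<l + factors \<sigma> + factors \<tau>}"
      by auto
    then have "(\<Prod>i\<in>{l..<l + factors (Pair \<sigma> \<tau>)}. vdim C (obj (A i))) =
      (\<Prod>i\<in>{l..<l + factors \<sigma>}. vdim C (obj (A i))) *
      (\<Prod>i\<in>{l + factors \<sigma>..<l + factors \<sigma> + factors \<tau>}. vdim C (obj (A i)))"
      by (simp add: prod.union_disjoint)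
    then show ?case
      using Pair.IH(1)[of l] Pair.IH(2)[of "l + factors \<sigma>"] Pair.prems fin_dim_tensor by simp
  qed simp
  then show "fin_dim C (multi_obj C A l \<tau>)"
    "vdim C (multi_obj C A l \<tau>) = (\<Prod>i\<in>{l..<l + factors \<tau>}. vdim C (obj (A i)))" by auto
qed

lemma mult_on_Factor:
  assumes "is_arr C (j l)" "trg (j l) = obj H"
  shows "mult_on C H j l Factor = j l"
  using assms by (simp add: mult_on_def)

lemma mult_on_typing:
  assumes H: "algebra C H"
    and j: "\<And>i. i \<in> {l..<l + factors \<tau>} \<Longrightarrow> j i \<in> hom C (obj (A i)) (obj H)"
  shows "is_arr C (mult_on C H j l \<tau>)" "src (mult_on C H j l \<tau>) = multi_obj C A l \<tau>"
    "trg (mult_on C H j l \<tau>) = obj H"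
    "is_arr C (multi_mult C H \<tau>)" "is_arr C (multi_arr C j l \<tau>)"
    "src (multi_mult C H \<tau>) = trg (multi_arr C j l \<tau>)"
proof -
  note [simp] = algebraD[OF H]
  have "is_arr C (multi_mult C H \<tau>) \<and> is_arr C (multi_arr C j l \<tau>) \<and> trg (multi_mult C H \<tau>) = obj H \<and>
    src (multi_arr C j l \<tau>) = multi_obj C A l \<tau> \<and> src (multi_mult C H \<tau>) = trg (multi_arr C j l \<tau>)"
    using j
  proof (induction \<tau> arbitrary: l)
    case Factor
    then show ?case using homD[of "j l" C "obj (A l)" "obj H"] by auto
  next
    case (Pair \<sigma> \<tau>)
    then have 1: "\<And>i. i \<in> {l..<l + factors \<sigma>} \<Longrightarrow> j i \<in> hom C (obj (A i)) (obj H)"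
      and 2: "\<And>i. i \<in> {l + factors \<sigma>..<l + factors \<sigma> + factors \<tau>} \<Longrightarrow> j i \<in> hom C (obj (A i)) (obj H)"
      by auto
    show ?case using Pair.IH(1)[OF 1] Pair.IH(2)[OF 2] by simp
  qed
  then show "is_arr C (mult_on C H j l \<tau>)" "src (mult_on C H j l \<tau>) = multi_obj C A l \<tau>"
    "trg (mult_on C H j l \<tau>) = obj H"
    "is_arr C (multi_mult C H \<tau>)" "is_arr C (multi_arr C j l \<tau>)"
    "src (multi_mult C H \<tau>) = trg (multi_arr C j l \<tau>)"
    by (auto simp: mult_on_def)
qed

lemma mult_on_Pair:
  fixes A :: "nat \<Rightarrow> ('b, 'c) bialg"
  assumes H: "algebra C H"
    and j: "\<And>i. i \<in> {l..<l + factors (Pair \<sigma> \<tau>)} \<Longrightarrow> j i \<in> hom C (obj (A i)) (obj H)"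
  shows "mult_on C H j l (Pair \<sigma> \<tau>) = mlt H \<cdot> (mult_on C H j l \<sigma> \<boxtimes> mult_on C H j (l + factors \<sigma>) \<tau>)"
proof -
  note [simp] = algebraD[OF H]
  have 1: "\<And>i. i \<in> {l..<l + factors \<sigma>} \<Longrightarrow> j i \<in> hom C (obj (A i)) (obj H)"
    and 2: "\<And>i. i \<in> {l + factors \<sigma>..<l + factors \<sigma> + factors \<tau>} \<Longrightarrow> j i \<in> hom C (obj (A i)) (obj H)"
    using j by auto
  have "trg (multi_mult C H \<sigma>) = obj H" "trg (multi_mult C H \<tau>) = obj H"
    by (cases \<sigma>; simp) (cases \<tau>; simp)
  then show ?thesis
    using mult_on_typing(4-6)[where A = A, OF H 1] mult_on_typing(4-6)[where A = A, OF H 2]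
    unfolding mult_on_def multi_mult.simps multi_arr.simps by (simp add: tarr_comp)
qed

lemma foldl_mul:
  assumes "algebra C H" "a \<in> und C (obj H)" "b \<in> und C (obj H)" "set zs \<subseteq> und C (obj H)"
  shows "foldl (mul C H) (mul C H a b) zs = mul C H a (foldl (mul C H) b zs)"
  using assms by (induction zs arbitrary: b) (auto simp: mul_assoc)

lemma foldl_mul_in:
  assumes "algebra C H" "a \<in> und C (obj H)" "set zs \<subseteq> und C (obj H)"
  shows "foldl (mul C H) a zs \<in> und C (obj H)"
  using assms by (induction zs arbitrary: a) auto

text \<open>By associativity a left-to-right product over a concatenation splits in two.\<close>

lemma products_append:
  assumes H: "algebra C H"
    and Vs: "Vs \<noteq> []" "\<Union> (set Vs) \<subseteq> und C (obj H)" and Ws: "Ws \<noteq> []" "\<Union> (set Ws) \<subseteq> und C (obj H)"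
  defines "prods \<equiv> \<lambda>Us. (\<lambda>xs. foldl (mul C H) (hd xs) (tl xs)) ` listset Us"
  shows "prods (Vs @ Ws) = {mul C H s t | s t. s \<in> prods Vs \<and> t \<in> prods Ws}"
proof -
  let ?F = "\<lambda>xs. foldl (mul C H) (hd xs) (tl xs)"
  have inH: "xs \<noteq> [] \<and> set xs \<subseteq> und C (obj H)"
    if "xs \<in> listset Us" "Us \<noteq> []" "\<Union> (set Us) \<subseteq> und C (obj H)" for xs Us
    using listset_length[OF that(1)] listset_set[OF that(1)] that(2,3) by auto
  have app: "?F (xs @ ys) = mul C H (?F xs) (?F ys)" if "xs \<in> listset Vs" "ys \<in> listset Ws" for xs ys
  proof -
    note xs = inH[OF that(1) Vs] and ys = inH[OF that(2) Ws]
    obtain x xs' y ys' where xy: "xs = x # xs'" "ys = y # ys'"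
      using xs ys by (metis list.exhaust)
    show ?thesis
      using xs ys by (simp add: xy foldl_mul[OF H] foldl_mul_in[OF H])
  qed
  show ?thesis
  proof (intro set_eqI iffI)
    fix a assume "a \<in> prods (Vs @ Ws)"
    then obtain xs ys where "a = ?F (xs @ ys)" "xs \<in> listset Vs" "ys \<in> listset Ws"
      unfolding prods_def listset_append by blast
    then show "a \<in> {mul C H s t | s t. s \<in> prods Vs \<and> t \<in> prods Ws}"
      using app[of xs ys] unfolding prods_def by blast
  next
    fix a assume "a \<in> {mul C H s t | s t. s \<in> prods Vs \<and> t \<in> prods Ws}"
    then obtain xs ys where xy: "a = mul C H (?F xs) (?F ys)" "xs \<in> listset Vs" "ys \<in> listset Ws"
      unfolding prods_def by blast
    then have "a = ?F (xs @ ys)" "xs @ ys \<in> listset (Vs @ Ws)"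
      using app[of xs ys] by (auto simp: listset_append)
    then show "a \<in> prods (Vs @ Ws)" unfolding prods_def by blast
  qed
qed

lemma span_products:
  assumes H: "algebra C H" and S: "S \<subseteq> und C (obj H)" and T: "T \<subseteq> und C (obj H)"
  shows "VS.span {mul C H a b | a b. a \<in> VS.span S \<and> b \<in> VS.span T} = VS.span {mul C H s t | s t. s \<in> S \<and> t \<in> T}"
    (is "_ = VS.span ?P")
proof (intro antisym VS.span_minimal[OF _ VS.subspace_span])
  show "?P \<subseteq> VS.span {mul C H a b | a b. a \<in> VS.span S \<and> b \<in> VS.span T}"
    using VS.span_superset[of S] VS.span_superset[of T] by (blast intro: VS.span_base)
  have TH: "VS.span T \<subseteq> und C (obj H)" by (rule VS.span_minimal[OF T]) simp
  have s: "mul C H s b \<in> VS.span ?P" if "s \<in> S" "b \<in> VS.span T" for s b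
  proof -
    have sH: "s \<in> und C (obj H)" using that(1) S by blast
    have "VS.subspace {b \<in> und C (obj H). mul C H s b \<in> VS.span ?P}"
      unfolding VS.subspace_def using sH H mul_scal(2)[OF H sH, of 0 0]
      by (auto simp: mul_add mul_scal VS.span_add VS.span_scale VS.span_zero)
    moreover have "T \<subseteq> {b \<in> und C (obj H). mul C H s b \<in> VS.span ?P}"
      using that(1) T by (blast intro: VS.span_base)
    ultimately have "VS.span T \<subseteq> {b \<in> und C (obj H). mul C H s b \<in> VS.span ?P}"
      by (rule VS.span_minimal[rotated])
    then show ?thesis using that(2) by blast
  qed
  have "mul C H a b \<in> VS.span ?P" if "a \<in> VS.span S" "b \<in> VS.span T" for a b
  proof -
    have bH: "b \<in> und C (obj H)" using that(2) TH by blast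
    have "VS.subspace {a \<in> und C (obj H). mul C H a b \<in> VS.span ?P}"
      unfolding VS.subspace_def using bH H mul_scal(1)[OF H _ bH, of 0 0]
      by (auto simp: mul_add mul_scal VS.span_add VS.span_scale VS.span_zero)
    moreover have "S \<subseteq> {a \<in> und C (obj H). mul C H a b \<in> VS.span ?P}"
      using s that(2) S by blast
    ultimately have "VS.span S \<subseteq> {a \<in> und C (obj H). mul C H a b \<in> VS.span ?P}"
      by (rule VS.span_minimal[rotated])
    then show ?thesis using that(1) by blast
  qed
  then show "{mul C H a b | a b. a \<in> VS.span S \<and> b \<in> VS.span T} \<subseteq> VS.span ?P" by blast
qed

lemma image_mlt_tarr:
  assumes H: "algebra C H" and f: "is_arr C f" "trg f = obj H" and g: "is_arr C g" "trg g = obj H"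
  shows "fn (mlt H \<cdot> (f \<boxtimes> g)) ` und C (src f \<otimes> src g) =
    VS.span {mul C H a b | a b. a \<in> fn f ` und C (src f) \<and> b \<in> fn g ` und C (src g)}"
proof -
  note [simp] = algebraD[OF H] f g
  let ?P = "{pure C (src f) (src g) x y | x y. x \<in> und C (src f) \<and> y \<in> und C (src g)}"
  have eq: "fn (mlt H \<cdot> (f \<boxtimes> g)) (pure C (src f) (src g) x y) = mul C H (fn f x) (fn g y)"
    if "x \<in> und C (src f)" "y \<in> und C (src g)" for x y
    using fn_mlt_tarr[of f g H "src f" "src g" x y] that H by simp
  have "fn (mlt H \<cdot> (f \<boxtimes> g)) ` und C (src f \<otimes> src g) = VS.span (fn (mlt H \<cdot> (f \<boxtimes> g)) ` ?P)"
    using image_span[of "mlt H \<cdot> (f \<boxtimes> g)" ?P] by (simp add: und_tensor)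
  also have "fn (mlt H \<cdot> (f \<boxtimes> g)) ` ?P = (\<lambda>(x, y). fn (mlt H \<cdot> (f \<boxtimes> g)) (pure C (src f) (src g) x y)) `
      (und C (src f) \<times> und C (src g))"
    by auto
  also have "\<dots> = (\<lambda>(x, y). mul C H (fn f x) (fn g y)) ` (und C (src f) \<times> und C (src g))"
    by (rule image_cong[OF refl]) (use eq in auto)
  also have "\<dots> = {mul C H a b | a b. a \<in> fn f ` und C (src f) \<and> b \<in> fn g ` und C (src g)}"
    by auto
  finally show ?thesis .
qed

text \<open>The image is spanned by products bracketed by \<open>\<tau>\<close>; by associativity these are the
  left-to-right products in the definition of the right-hand side.\<close>

lemma image_mult_on:
  assumes H: "algebra C H"
    and j: "\<And>i. i \<in> {l..<l + factors \<tau>} \<Longrightarrow> j i \<in> hom C (obj (A i)) (obj H)"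
  shows "fn (mult_on C H j l \<tau>) ` und C (multi_obj C A l \<tau>) = factor_product C H A j l (factors \<tau>)"
  using j
proof (induction \<tau> arbitrary: l)
  case Factor
  note [simp] = homD[OF Factor[of l]]
  have "fn (j l) ` und C (obj (A l)) = VS.span (fn (j l) ` und C (obj (A l)))"
    using image_span[of "j l" "und C (obj (A l))"] VS.span_eq_iff[THEN iffD2, OF subspace_und[of "obj (A l)"]]
    by simp
  then show ?case
    by (simp add: mult_on_Factor factor_product_def subspace_product_def image_image)
next
  case (Pair \<sigma> \<tau>)
  let ?r = "l + factors \<sigma>"
  have 1: "\<And>i. i \<in> {l..<?r} \<Longrightarrow> j i \<in> hom C (obj (A i)) (obj H)"
    and 2: "\<And>i. i \<in> {?r..<?r + factors \<tau>} \<Longrightarrow> j i \<in> hom C (obj (A i)) (obj H)"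
    using Pair.prems by auto
  let ?f = "mult_on C H j l \<sigma>" and ?g = "mult_on C H j ?r \<tau>"
  let ?Vs = "map (\<lambda>i. fn (j i) ` und C (obj (A i))) [l..<?r]"
  let ?Ws = "map (\<lambda>i. fn (j i) ` und C (obj (A i))) [?r..<?r + factors \<tau>]"
  let ?prods = "\<lambda>Us. (\<lambda>xs. foldl (mul C H) (hd xs) (tl xs)) ` listset Us"
  note f = mult_on_typing(1-3)[where A = A, OF H 1] and g = mult_on_typing(1-3)[where A = A, OF H 2]
  have imf: "fn ?f ` und C (multi_obj C A l \<sigma>) = VS.span (?prods ?Vs)"
    using Pair.IH(1)[OF 1] by (simp add: factor_product_def subspace_product_def)
  have img: "fn ?g ` und C (multi_obj C A ?r \<tau>) = VS.span (?prods ?Ws)"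
    using Pair.IH(2)[OF 2] by (simp add: factor_product_def subspace_product_def)
  have "VS.span (?prods ?Vs) \<subseteq> und C (obj H)" "VS.span (?prods ?Ws) \<subseteq> und C (obj H)"
    unfolding imf[symmetric] img[symmetric] using f g by auto
  then have SH: "?prods ?Vs \<subseteq> und C (obj H)" "?prods ?Ws \<subseteq> und C (obj H)"
    using VS.span_superset by blast+
  have VH: "fn (j i) ` und C (obj (A i)) \<subseteq> und C (obj H)" if "i \<in> {l..<?r + factors \<tau>}" for i
  proof -
    have "j i \<in> hom C (obj (A i)) (obj H)" by (rule Pair.prems) (use that in auto)
    from homD[OF this] show ?thesis by auto
  qed
  have Vs: "?Vs \<noteq> []" "\<Union> (set ?Vs) \<subseteq> und C (obj H)"
    unfolding set_map set_upt by (simp, intro UN_least VH) auto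
  have Ws: "?Ws \<noteq> []" "\<Union> (set ?Ws) \<subseteq> und C (obj H)"
    unfolding set_map set_upt by (simp, intro UN_least VH) auto
  have "fn (mult_on C H j l (Pair \<sigma> \<tau>)) ` und C (multi_obj C A l (Pair \<sigma> \<tau>)) =
      VS.span {mul C H a b | a b. a \<in> VS.span (?prods ?Vs) \<and> b \<in> VS.span (?prods ?Ws)}"
    using image_mlt_tarr[OF H f(1,3) g(1,3)]
    by (simp only: mult_on_Pair[where A = A, OF H Pair.prems] f g multi_obj.simps imf img)
  also have "\<dots> = VS.span (?prods (?Vs @ ?Ws))"
    unfolding span_products[OF H SH] products_append[OF H Vs Ws] ..
  finally show ?case
    unfolding factor_product_def subspace_product_def upt_factors map_append .
qed

lemma sub_hopf_subspace_mul:
  assumes H: "algebra C H" and V: "sub_hopf_subspace C H V" "a \<in> V" "b \<in> V"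
  shows "mul C H a b \<in> V"
proof -
  obtain B j where B: "sub_hopf C H B j" "fn j ` und C (obj B) = V"
    using V by (auto simp: sub_hopf_subspace_def)
  have j: "bialgebra_morphism C B H j" and Ba: "algebra C B"
    using B by (auto simp: sub_hopf_def hopf_morphism_def bialgebra_morphism_def hopf_algebra_def bialgebra_def)
  obtain x y where xy: "x \<in> und C (obj B)" "y \<in> und C (obj B)" "a = fn j x" "b = fn j y"
    using V B by blast
  then have "mul C H a b = fn j (mul C B x y)" using morphism_mul[OF j Ba H] by simp
  then show ?thesis using B(2) xy Ba by auto
qed

end

locale sub_bialgebras = concrete_braided_category C
  for C :: "('k::field, 'o, 'v::ab_group_add, 'm) ccat_scheme" (structure) +
  fixes H :: "('o, 'v) bialg" and A :: "nat \<Rightarrow> ('o, 'v) bialg" and j :: "nat \<Rightarrow> ('o, 'v) arr" and I :: "nat set"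
  assumes H: "bialgebra C H"
    and A: "i \<in> I \<Longrightarrow> bialgebra C (A i)"
    and j: "i \<in> I \<Longrightarrow> bialgebra_morphism C (A i) H (j i)"
begin

abbreviation P where "P l \<tau> \<equiv> multi_obj C A l \<tau>"
abbreviation \<mu> where "\<mu> l \<tau> \<equiv> mult_on C H j l \<tau>"
abbreviation one where "one \<equiv> fn (unt H) (gen C)"

lemmas Ha [simp] = bialgebraD[OF H]

lemma j_hom: "i \<in> I \<Longrightarrow> j i \<in> hom C (obj (A i)) (obj H)"
  using j by (auto simp: bialgebra_morphism_def)

lemma \<mu>_typing:
  assumes "{l..<l + factors \<tau>} \<subseteq> I"
  shows "is_arr C (\<mu> l \<tau>)" "src (\<mu> l \<tau>) = P l \<tau>" "trg (\<mu> l \<tau>) = obj H"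
  using mult_on_typing(1-3)[where A = A, OF bialgebraD(1)[OF H]] j_hom assms by blast+

lemma \<mu>_Pair:
  assumes "{l..<l + factors (Pair \<sigma> \<tau>)} \<subseteq> I"
  shows "\<mu> l (Pair \<sigma> \<tau>) = mlt H \<cdot> (\<mu> l \<sigma> \<boxtimes> \<mu> (l + factors \<sigma>) \<tau>)"
  using mult_on_Pair[where A = A, OF bialgebraD(1)[OF H]] j_hom assms by blast

lemma subset_Pair:
  assumes "{l..<l + factors (Pair \<sigma> \<tau>)} \<subseteq> I"
  shows "{l..<l + factors \<sigma>} \<subseteq> I" "{l + factors \<sigma>..<l + factors \<sigma> + factors \<tau>} \<subseteq> I"
  using assms by auto

lemma fn_\<mu>_Pair:
  assumes I: "{l..<l + factors (Pair \<sigma> \<tau>)} \<subseteq> I" and "x \<in> und C (P l \<sigma>)" "y \<in> und C (P (l + factors \<sigma>) \<tau>)"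
  shows "fn (\<mu> l (Pair \<sigma> \<tau>)) (pure C (P l \<sigma>) (P (l + factors \<sigma>) \<tau>) x y) =
    mul C H (fn (\<mu> l \<sigma>) x) (fn (\<mu> (l + factors \<sigma>) \<tau>) y)"
  unfolding \<mu>_Pair[OF I]
  by (rule fn_mlt_tarr) (use \<mu>_typing subset_Pair[OF I] assms in auto)

text \<open>The witness is \<open>1 \<otimes> \<dots> \<otimes> 1\<close>.\<close>

lemma unit_in_image:
  assumes "{l..<l + factors \<tau>} \<subseteq> I"
  obtains u where "u \<in> und C (P l \<tau>)" "fn (\<mu> l \<tau>) u = one"
proof -
  have "\<exists>u\<in>und C (P l \<tau>). fn (\<mu> l \<tau>) u = one"
    using assms
  proof (induction \<tau> arbitrary: l)
    case Factor
    then have l: "l \<in> I" by auto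
    have "fn (j l) (fn (unt (A l)) (gen C)) = one"
      using morphism_unit[OF j[OF l]] bialgebraD(1)[OF A[OF l]] by simp
    then show ?case
      using mult_on_Factor[of j l H] bialgebra_morphismD(1-3)[OF j[OF l]] unit_in[OF bialgebraD(1)[OF A[OF l]]]
      by auto
  next
    case (Pair \<sigma> \<tau>)
    note I = subset_Pair[OF Pair.prems]
    obtain u where u: "u \<in> und C (P l \<sigma>)" "fn (\<mu> l \<sigma>) u = one"
      using Pair.IH(1)[OF I(1)] by blast
    obtain v where v: "v \<in> und C (P (l + factors \<sigma>) \<tau>)" "fn (\<mu> (l + factors \<sigma>) \<tau>) v = one"
      using Pair.IH(2)[OF I(2)] by blast
    have "fn (\<mu> l (Pair \<sigma> \<tau>)) (pure C (P l \<sigma>) (P (l + factors \<sigma>) \<tau>) u v) = one"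
      using fn_\<mu>_Pair[OF Pair.prems u(1) v(1)] u v by (simp add: mul_unit)
    then show ?case using u v by (intro bexI) auto
  qed
  then show thesis using that by blast
qed

text \<open>The counit of \<open>H\<close>, pulled back along the multiplication map, serves as counit of
  \<open>P l \<tau>\<close>, on which no bialgebra structure has been constructed yet.\<close>

definition left_proj where "left_proj l \<sigma> \<tau> =
  \<r> (P l \<sigma>) \<cdot> (\<one> (P l \<sigma>) \<boxtimes> (cnt H \<cdot> \<mu> (l + factors \<sigma>) \<tau>))"

definition right_proj where "right_proj l \<sigma> \<tau> =
  \<l> (P (l + factors \<sigma>) \<tau>) \<cdot> ((cnt H \<cdot> \<mu> l \<sigma>) \<boxtimes> \<one> (P (l + factors \<sigma>) \<tau>))"

lemma left_proj:
  assumes I: "{l..<l + factors (Pair \<sigma> \<tau>)} \<subseteq> I" and u: "u \<in> und C (P (l + factors \<sigma>) \<tau>)"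
    "fn (\<mu> (l + factors \<sigma>) \<tau>) u = one" and x: "x \<in> und C (P l \<sigma>)"
  shows "left_proj l \<sigma> \<tau> \<in> hom C (P l (Pair \<sigma> \<tau>)) (P l \<sigma>)"
    "fn (left_proj l \<sigma> \<tau>) (pure C (P l \<sigma>) (P (l + factors \<sigma>) \<tau>) x u) = x"
    "fn (\<mu> l (Pair \<sigma> \<tau>)) (pure C (P l \<sigma>) (P (l + factors \<sigma>) \<tau>) x u) = fn (\<mu> l \<sigma>) x"
proof -
  note [simp] = \<mu>_typing[OF subset_Pair(1)[OF I]] \<mu>_typing[OF subset_Pair(2)[OF I]]
  show "left_proj l \<sigma> \<tau> \<in> hom C (P l (Pair \<sigma> \<tau>)) (P l \<sigma>)"
    by (rule homI) (simp_all add: left_proj_def)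
  show "fn (left_proj l \<sigma> \<tau>) (pure C (P l \<sigma>) (P (l + factors \<sigma>) \<tau>) x u) = x"
    using u x by (simp add: left_proj_def cnt_unit[OF H])
  show "fn (\<mu> l (Pair \<sigma> \<tau>)) (pure C (P l \<sigma>) (P (l + factors \<sigma>) \<tau>) x u) = fn (\<mu> l \<sigma>) x"
    using fn_\<mu>_Pair[OF I x u(1)] u(2) x by (simp add: mul_unit)
qed

lemma right_proj:
  assumes I: "{l..<l + factors (Pair \<sigma> \<tau>)} \<subseteq> I" and u: "u \<in> und C (P l \<sigma>)"
    "fn (\<mu> l \<sigma>) u = one" and y: "y \<in> und C (P (l + factors \<sigma>) \<tau>)"
  shows "right_proj l \<sigma> \<tau> \<in> hom C (P l (Pair \<sigma> \<tau>)) (P (l + factors \<sigma>) \<tau>)"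
    "fn (right_proj l \<sigma> \<tau>) (pure C (P l \<sigma>) (P (l + factors \<sigma>) \<tau>) u y) = y"
    "fn (\<mu> l (Pair \<sigma> \<tau>)) (pure C (P l \<sigma>) (P (l + factors \<sigma>) \<tau>) u y) = fn (\<mu> (l + factors \<sigma>) \<tau>) y"
proof -
  note [simp] = \<mu>_typing[OF subset_Pair(1)[OF I]] \<mu>_typing[OF subset_Pair(2)[OF I]]
  show "right_proj l \<sigma> \<tau> \<in> hom C (P l (Pair \<sigma> \<tau>)) (P (l + factors \<sigma>) \<tau>)"
    by (rule homI) (simp_all add: right_proj_def)
  show "fn (right_proj l \<sigma> \<tau>) (pure C (P l \<sigma>) (P (l + factors \<sigma>) \<tau>) u y) = y"
    using u y by (simp add: right_proj_def cnt_unit[OF H])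
  show "fn (\<mu> l (Pair \<sigma> \<tau>)) (pure C (P l \<sigma>) (P (l + factors \<sigma>) \<tau>) u y) = fn (\<mu> (l + factors \<sigma>) \<tau>) y"
    using fn_\<mu>_Pair[OF I u(1) y] u(2) y by (simp add: mul_unit)
qed

text \<open>A coincidence in an inner bracket gives a coincidence for the surrounding bracket after tensoring
  with the preimage of \<open>1\<close>, and the projections remove that preimage again.\<close>

lemma inj_on_brackets:
  assumes "{l..<l + factors \<tau>} \<subseteq> I" "inj_on (fn (\<mu> l \<tau>)) (und C (P l \<tau>))" "(k, \<rho>) \<in> brackets l \<tau>"
  shows "inj_on (fn (\<mu> k \<rho>)) (und C (P k \<rho>)) \<and> {k..<k + factors \<rho>} \<subseteq> {l..<l + factors \<tau>}"
  using assms
proof (induction \<tau> arbitrary: l)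
  case (Pair \<sigma> \<tau>)
  note I = Pair.prems(1) and I' = subset_Pair[OF Pair.prems(1)]
  let ?r = "l + factors \<sigma>"
  obtain u where u: "u \<in> und C (P l \<sigma>)" "fn (\<mu> l \<sigma>) u = one"
    using unit_in_image[OF I'(1)] .
  obtain v where v: "v \<in> und C (P ?r \<tau>)" "fn (\<mu> ?r \<tau>) v = one"
    using unit_in_image[OF I'(2)] .
  note inj = inj_onD[OF Pair.prems(2)]
  have 1: "inj_on (fn (\<mu> l \<sigma>)) (und C (P l \<sigma>))"
  proof (rule inj_onI)
    fix x y assume xy: "x \<in> und C (P l \<sigma>)" "y \<in> und C (P l \<sigma>)" "fn (\<mu> l \<sigma>) x = fn (\<mu> l \<sigma>) y"
    have "pure C (P l \<sigma>) (P ?r \<tau>) x v = pure C (P l \<sigma>) (P ?r \<tau>) y v"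
      by (rule inj) (use xy v left_proj(3)[OF I v] in auto)
    then show "x = y" using left_proj(2)[OF I v] xy(1,2) by metis
  qed
  have 2: "inj_on (fn (\<mu> ?r \<tau>)) (und C (P ?r \<tau>))"
  proof (rule inj_onI)
    fix x y assume xy: "x \<in> und C (P ?r \<tau>)" "y \<in> und C (P ?r \<tau>)" "fn (\<mu> ?r \<tau>) x = fn (\<mu> ?r \<tau>) y"
    have "pure C (P l \<sigma>) (P ?r \<tau>) u x = pure C (P l \<sigma>) (P ?r \<tau>) u y"
      by (rule inj) (use xy u right_proj(3)[OF I u] in auto)
    then show "x = y" using right_proj(2)[OF I u] xy(1,2) by metis
  qed
  from Pair.prems(3) consider "k = l \<and> \<rho> = Pair \<sigma> \<tau>" | "(k, \<rho>) \<in> brackets l \<sigma>" | "(k, \<rho>) \<in> brackets ?r \<tau>"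
    by auto
  then show ?case
  proof cases
    case 1
    then show ?thesis using Pair.prems(2) by auto
  next
    case 2
    then show ?thesis using Pair.IH(1)[OF I'(1) \<open>inj_on (fn (\<mu> l \<sigma>)) (und C (P l \<sigma>))\<close>] by auto
  next
    case 3
    then show ?thesis using Pair.IH(2)[OF I'(2) \<open>inj_on (fn (\<mu> ?r \<tau>)) (und C (P ?r \<tau>))\<close>] by auto
  qed
qed simp

text \<open>Induction along the bracketing.  A retraction for a bracket, composed with the projections,
  gives retractions for its two parts, so that the retraction on the outermost level is the only
  one that has to be found.  Closure under multiplication enters at each bracket as \<open>swap\<close>.\<close>

lemma ex_multi_dcp:
  assumes "{l..<l + factors \<tau>} \<subseteq> I" "p \<in> hom C (obj H) (P l \<tau>)" "p \<cdot> \<mu> l \<tau> = \<one> (P l \<tau>)"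
    and "\<And>k \<rho> a b. (k, \<rho>) \<in> brackets l \<tau> \<Longrightarrow> a \<in> fn (\<mu> k \<rho>) ` und C (P k \<rho>) \<Longrightarrow>
      b \<in> fn (\<mu> k \<rho>) ` und C (P k \<rho>) \<Longrightarrow> mul C H a b \<in> fn (\<mu> k \<rho>) ` und C (P k \<rho>)"
  shows "\<exists>\<alpha> \<beta>. multi_dcp_defined C A \<alpha> \<beta> l \<tau> \<and> bialgebra C (multi_dcp C A \<alpha> \<beta> l \<tau>) \<and>
    bialgebra_morphism C (multi_dcp C A \<alpha> \<beta> l \<tau>) H (\<mu> l \<tau>)"
  using assms
proof (induction \<tau> arbitrary: l p)
  case Factor
  then have l: "l \<in> I" by auto
  show ?case
    using A[OF l] j[OF l] mult_on_Factor[of j l H] bialgebra_morphismD(1-3)[OF j[OF l]] by simp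
next
  case (Pair \<sigma> \<tau>)
  note I = Pair.prems(1) and I' = subset_Pair[OF Pair.prems(1)]
  let ?r = "l + factors \<sigma>"
  let ?f = "\<mu> l \<sigma>" and ?g = "\<mu> ?r \<tau>"
  note [simp] = \<mu>_typing[OF I'(1)] \<mu>_typing[OF I'(2)] homD[OF Pair.prems(2)]
  obtain u where u: "u \<in> und C (P l \<sigma>)" "fn ?f u = one"
    using unit_in_image[OF I'(1)] .
  obtain v where v: "v \<in> und C (P ?r \<tau>)" "fn ?g v = one"
    using unit_in_image[OF I'(2)] .
  note L = left_proj[OF I v] and R = right_proj[OF I u]
  note [simp] = homD[OF L(1)[OF und_zero]] homD[OF R(1)[OF und_zero]]
  note \<mu>P = \<mu>_typing[OF I]
  have pm: "fn p (fn (\<mu> l (Pair \<sigma> \<tau>)) t) = t" if "t \<in> und C (P l (Pair \<sigma> \<tau>))" for t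
    using arg_cong[OF Pair.prems(3), of "\<lambda>h. fn h t"] that \<mu>P by simp
  have "\<exists>\<alpha> \<beta>. multi_dcp_defined C A \<alpha> \<beta> l \<sigma> \<and> bialgebra C (multi_dcp C A \<alpha> \<beta> l \<sigma>) \<and>
    bialgebra_morphism C (multi_dcp C A \<alpha> \<beta> l \<sigma>) H ?f"
  proof (rule Pair.IH(1)[OF I'(1), of "left_proj l \<sigma> \<tau> \<cdot> p"])
    show "left_proj l \<sigma> \<tau> \<cdot> p \<in> hom C (obj H) (P l \<sigma>)" by (rule homI) auto
    show "(left_proj l \<sigma> \<tau> \<cdot> p) \<cdot> ?f = \<one> (P l \<sigma>)"
    proof (rule arr_eqI)
      fix x assume "x \<in> und C (src ((left_proj l \<sigma> \<tau> \<cdot> p) \<cdot> ?f))"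
      then have x: "x \<in> und C (P l \<sigma>)" by simp
      then show "fn ((left_proj l \<sigma> \<tau> \<cdot> p) \<cdot> ?f) x = fn (\<one> (P l \<sigma>)) x"
        using L(2)[OF x] L(3)[OF x, symmetric] pm v by simp
    qed auto
  qed (use Pair.prems(4) in auto)
  then obtain \<alpha>1 \<beta>1 where 1: "multi_dcp_defined C A \<alpha>1 \<beta>1 l \<sigma>" "bialgebra C (multi_dcp C A \<alpha>1 \<beta>1 l \<sigma>)"
    "bialgebra_morphism C (multi_dcp C A \<alpha>1 \<beta>1 l \<sigma>) H ?f" by blast
  have "\<exists>\<alpha> \<beta>. multi_dcp_defined C A \<alpha> \<beta> ?r \<tau> \<and> bialgebra C (multi_dcp C A \<alpha> \<beta> ?r \<tau>) \<and>
    bialgebra_morphism C (multi_dcp C A \<alpha> \<beta> ?r \<tau>) H ?g"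
  proof (rule Pair.IH(2)[OF I'(2), of "right_proj l \<sigma> \<tau> \<cdot> p"])
    show "right_proj l \<sigma> \<tau> \<cdot> p \<in> hom C (obj H) (P ?r \<tau>)" by (rule homI) auto
    show "(right_proj l \<sigma> \<tau> \<cdot> p) \<cdot> ?g = \<one> (P ?r \<tau>)"
    proof (rule arr_eqI)
      fix y assume "y \<in> und C (src ((right_proj l \<sigma> \<tau> \<cdot> p) \<cdot> ?g))"
      then have y: "y \<in> und C (P ?r \<tau>)" by simp
      then show "fn ((right_proj l \<sigma> \<tau> \<cdot> p) \<cdot> ?g) y = fn (\<one> (P ?r \<tau>)) y"
        using R(2)[OF y] R(3)[OF y, symmetric] pm u by simp
    qed auto
  qed (use Pair.prems(4) in auto)
  then obtain \<alpha>2 \<beta>2 where 2: "multi_dcp_defined C A \<alpha>2 \<beta>2 ?r \<tau>" "bialgebra C (multi_dcp C A \<alpha>2 \<beta>2 ?r \<tau>)"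
    "bialgebra_morphism C (multi_dcp C A \<alpha>2 \<beta>2 ?r \<tau>) H ?g" by blast
  let ?X = "multi_dcp C A \<alpha>1 \<beta>1 l \<sigma>" and ?Y = "multi_dcp C A \<alpha>2 \<beta>2 ?r \<tau>"
  have closed: "mul C H (fn ?g y) (fn ?f x) \<in> fn (\<mu> l (Pair \<sigma> \<tau>)) ` und C (P l (Pair \<sigma> \<tau>))"
    if x: "x \<in> und C (P l \<sigma>)" and y: "y \<in> und C (P ?r \<tau>)" for x y
  proof (rule Pair.prems(4))
    show "(l, Pair \<sigma> \<tau>) \<in> brackets l (Pair \<sigma> \<tau>)" by simp
    show "fn ?g y \<in> fn (\<mu> l (Pair \<sigma> \<tau>)) ` und C (P l (Pair \<sigma> \<tau>))"
      using imageI[of "pure C (P l \<sigma>) (P ?r \<tau>) u y" "und C (P l (Pair \<sigma> \<tau>))" "fn (\<mu> l (Pair \<sigma> \<tau>))"]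
        R(3)[OF y] u y by simp
    show "fn ?f x \<in> fn (\<mu> l (Pair \<sigma> \<tau>)) ` und C (P l (Pair \<sigma> \<tau>))"
      using imageI[of "pure C (P l \<sigma>) (P ?r \<tau>) x v" "und C (P l (Pair \<sigma> \<tau>))" "fn (\<mu> l (Pair \<sigma> \<tau>))"]
        L(3)[OF x] v x by simp
  qed
  interpret S: split_product C H ?X ?Y ?f ?g p
  proof
    show "p \<in> hom C (obj H) (obj ?X \<otimes> obj ?Y)" using Pair.prems(2) by simp
    show "p \<cdot> mlt H \<cdot> (?f \<boxtimes> ?g) = \<one> (obj ?X \<otimes> obj ?Y)"
      using Pair.prems(3) by (simp add: \<mu>_Pair[OF I])
    show "(mlt H \<cdot> (?f \<boxtimes> ?g)) \<cdot> p \<cdot> mlt H \<cdot> (?g \<boxtimes> ?f) = mlt H \<cdot> (?g \<boxtimes> ?f)"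
    proof (rule tens_arr_eqI[of _ _ "P ?r \<tau>" "P l \<sigma>"])
      fix y x assume yx: "y \<in> und C (P ?r \<tau>)" "x \<in> und C (P l \<sigma>)"
      obtain t where t: "t \<in> und C (P l (Pair \<sigma> \<tau>))" "mul C H (fn ?g y) (fn ?f x) = fn (\<mu> l (Pair \<sigma> \<tau>)) t"
        using closed[OF yx(2,1)] by blast
      have m: "fn (mlt H \<cdot> (?g \<boxtimes> ?f)) (pure C (P ?r \<tau>) (P l \<sigma>) y x) = fn (\<mu> l (Pair \<sigma> \<tau>)) t"
        using fn_mlt_tarr[of ?g ?f H "P ?r \<tau>" "P l \<sigma>" y x] yx t(2) by simp
      have "fn ((mlt H \<cdot> (?f \<boxtimes> ?g)) \<cdot> p \<cdot> mlt H \<cdot> (?g \<boxtimes> ?f)) (pure C (P ?r \<tau>) (P l \<sigma>) y x) =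
          fn (\<mu> l (Pair \<sigma> \<tau>)) (fn p (fn (mlt H \<cdot> (?g \<boxtimes> ?f)) (pure C (P ?r \<tau>) (P l \<sigma>) y x)))"
        using yx by (simp add: \<mu>_Pair[OF I])
      then show "fn ((mlt H \<cdot> (?f \<boxtimes> ?g)) \<cdot> p \<cdot> mlt H \<cdot> (?g \<boxtimes> ?f)) (pure C (P ?r \<tau>) (P l \<sigma>) y x) =
          fn (mlt H \<cdot> (?g \<boxtimes> ?f)) (pure C (P ?r \<tau>) (P l \<sigma>) y x)"
        unfolding m using pm[OF t(1)] by simp
    qed auto
  qed (use H 1 2 in auto)
  (* The symbol joining the two parts has index ?r - 1; smaller indices belong to the left part and
     larger ones to the right part. *)
  define \<alpha> where "\<alpha> i = (if Suc i < ?r then \<alpha>1 i else if Suc i = ?r then S.\<alpha> else \<alpha>2 i)" for i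
  define \<beta> where "\<beta> i = (if Suc i < ?r then \<beta>1 i else if Suc i = ?r then S.\<beta> else \<beta>2 i)" for i
  have c1: "multi_dcp C A \<alpha> \<beta> l \<sigma> = ?X" "multi_dcp_defined C A \<alpha> \<beta> l \<sigma> = multi_dcp_defined C A \<alpha>1 \<beta>1 l \<sigma>"
    by (rule multi_dcp_cong; simp add: \<alpha>_def \<beta>_def)+
  have c2: "multi_dcp C A \<alpha> \<beta> ?r \<tau> = ?Y" "multi_dcp_defined C A \<alpha> \<beta> ?r \<tau> = multi_dcp_defined C A \<alpha>2 \<beta>2 ?r \<tau>"
    by (rule multi_dcp_cong; simp add: \<alpha>_def \<beta>_def)+
  have "Suc (?r - 1) = ?r" by simp
  then have c3: "\<alpha> (?r - 1) = S.\<alpha>" "\<beta> (?r - 1) = S.\<beta>" unfolding \<alpha>_def \<beta>_def by simp_all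
  have dcp: "multi_dcp C A \<alpha> \<beta> l (Pair \<sigma> \<tau>) = S.dcp" by (simp only: multi_dcp.simps c1 c2 c3)
  have "multi_dcp_defined C A \<alpha> \<beta> l (Pair \<sigma> \<tau>)"
    unfolding multi_dcp_defined.simps Let_def c1 c2 c3
    using 1 2 S.left_module_coalgebra S.right_module_coalgebra by blast
  moreover have "bialgebra C (multi_dcp C A \<alpha> \<beta> l (Pair \<sigma> \<tau>))"
    unfolding dcp by (rule S.bialgebra_dcp)
  moreover have "bialgebra_morphism C (multi_dcp C A \<alpha> \<beta> l (Pair \<sigma> \<tau>)) H (\<mu> l (Pair \<sigma> \<tau>))"
    unfolding dcp using S.\<theta>_morphism by (simp add: \<mu>_Pair[OF I] S.\<theta>_def)
  ultimately show ?case by blast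
qed

end

section \<open>The equivalence\<close>

theorem corollary1p4:
  fixes C :: "('k::field, 'o, 'v::ab_group_add) ccat"
    and H :: "('o, 'v) bialg"
    and A :: "nat \<Rightarrow> ('o, 'v) bialg"
    and j :: "nat \<Rightarrow> ('o, 'v) arr"
    and n :: nat
    and \<sigma> :: bracketing
  assumes "concrete_braided_category C"
    and "bijective_morphisms_iso C"
    and "hopf_algebra C H"
    and "fin_dim C (obj H)"
    and "n \<ge> 2"
    and "\<And>i. i \<in> {1..n} \<Longrightarrow> sub_hopf C H (A i) (j i)"
    and "und C (obj H) = factor_product C H A j 1 n"
    and "factors \<sigma> = n"
  shows "(inner_double_factorization C H A j \<sigma> \<longleftrightarrow>
            vdim C (obj H) = (\<Prod>i=1..n. vdim C (obj (A i))) \<and> brackets_sub_hopf C H A j \<sigma>) \<and>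
         (vdim C (obj H) = (\<Prod>i=1..n. vdim C (obj (A i))) \<and> brackets_sub_hopf C H A j \<sigma> \<longleftrightarrow>
            brackets_sub_hopf C H A j \<sigma> \<and>
            (\<exists>\<alpha> \<beta>. multi_dcp_defined C A \<alpha> \<beta> 1 \<sigma> \<and>
               hopf_isomorphism C (multi_dcp C A \<alpha> \<beta> 1 \<sigma>) H (mult_on C H j 1 \<sigma>)))"
proof -
  interpret concrete_braided_category C by fact
  have HB: "bialgebra C H" using assms(3) by (simp add: hopf_algebra_def)
  interpret sub_bialgebras C H A j "{1..n}"
    using assms(6) HB
    by unfold_locales
      (auto simp: sub_hopf_def hopf_algebra_def hopf_morphism_def bialgebra_morphism_def)
  have set_n: "{1..<1 + factors \<sigma>} = {1..n}" using assms(8) by auto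
  have I: "{1..<1 + factors \<sigma>} \<subseteq> {1..n}" using set_n by simp
  let ?\<Theta> = "\<mu> 1 \<sigma>"
  note [simp] = \<mu>_typing[OF I] \<mu>_typing[OF I, unfolded One_nat_def]
  have finA: "fin_dim C (obj (A i))" if "i \<in> {1..n}" for i
    using fin_dim_inj[of "j i"] assms(6)[OF that] bialgebra_morphismD(1-3)[OF j[OF that]] assms(4)
    by (auto simp: sub_hopf_def)
  have finP: "fin_dim C (P 1 \<sigma>)"
    by (rule fin_dim_multi_obj) (use finA I in blast)
  have dimP: "vdim C (P 1 \<sigma>) = (\<Prod>i=1..n. vdim C (obj (A i)))"
    using fin_dim_multi_obj(2)[of 1 \<sigma> A, unfolded set_n, OF finA] by simp
  have img: "fn (\<mu> l \<tau>) ` und C (P l \<tau>) = factor_product C H A j l (factors \<tau>)"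
    if "{l..<l + factors \<tau>} \<subseteq> {1..n}" for l \<tau>
    by (rule image_mult_on) (use that j_hom in auto)
  have surj: "fn ?\<Theta> ` und C (P 1 \<sigma>) = und C (obj H)"
    using img[OF I] assms(7,8) by simp
  have top: "(1, \<sigma>) \<in> brackets 1 \<sigma>" using assms(5,8) by (cases \<sigma>) auto
  have sub: "{k..<k + factors \<rho>} \<subseteq> {1..n}" if "(k, \<rho>) \<in> brackets 1 \<sigma>" for k \<rho>
  proof -
    have "(k, \<rho>) \<in> brackets l \<tau> \<Longrightarrow> {k..<k + factors \<rho>} \<subseteq> {l..<l + factors \<tau>}" for l \<tau>
      by (induction \<tau> arbitrary: l) fastforce+
    then show ?thesis using that set_n by blast
  qed
  (* As the source has dimension dim A 1 * ... * dim A n and the map is onto, the dimension formula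
     is equivalent to bijectivity. *)
  have dim_bij: "vdim C (obj H) = (\<Prod>i=1..n. vdim C (obj (A i)))"
    if "bij_betw (fn ?\<Theta>) (und C (P 1 \<sigma>)) (und C (obj H))"
    using vdim_bij[of ?\<Theta>] that finP dimP by simp
  have bij_dim: "bij_betw (fn ?\<Theta>) (und C (P 1 \<sigma>)) (und C (obj H))"
    if "vdim C (obj H) = (\<Prod>i=1..n. vdim C (obj (A i)))"
    using surjective_bij[of ?\<Theta>] that finP dimP surj by simp
  have i_ii: "vdim C (obj H) = (\<Prod>i=1..n. vdim C (obj (A i))) \<and> brackets_sub_hopf C H A j \<sigma>"
    if i: "inner_double_factorization C H A j \<sigma>"
  proof
    have "bij_betw (fn ?\<Theta>) (und C (P 1 \<sigma>)) (factor_product C H A j 1 (factors \<sigma>))"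
      using i top by (auto simp: inner_double_factorization_def)
    then show "vdim C (obj H) = (\<Prod>i=1..n. vdim C (obj (A i)))"
      using dim_bij assms(7,8) by simp
    show "brackets_sub_hopf C H A j \<sigma>"
      using i by (auto simp: inner_double_factorization_def brackets_sub_hopf_def)
  qed
  have ii_i: "inner_double_factorization C H A j \<sigma>"
    if d: "vdim C (obj H) = (\<Prod>i=1..n. vdim C (obj (A i)))" and b: "brackets_sub_hopf C H A j \<sigma>"
  proof -
    have "inj_on (fn ?\<Theta>) (und C (P 1 \<sigma>))" using bij_dim[OF d] by (simp add: bij_betw_def)
    then have "bij_betw (fn (\<mu> l \<tau>)) (und C (P l \<tau>)) (factor_product C H A j l (factors \<tau>))"
      if "(l, \<tau>) \<in> brackets 1 \<sigma>" for l \<tau>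
      using inj_on_brackets[OF I _ that] img[OF sub[OF that]] by (simp add: bij_betw_def)
    then show ?thesis
      using b assms(7,8) by (auto simp: inner_double_factorization_def brackets_sub_hopf_def)
  qed
  have ii_iii: "\<exists>\<alpha> \<beta>. multi_dcp_defined C A \<alpha> \<beta> 1 \<sigma> \<and>
      hopf_isomorphism C (multi_dcp C A \<alpha> \<beta> 1 \<sigma>) H ?\<Theta>"
    if d: "vdim C (obj H) = (\<Prod>i=1..n. vdim C (obj (A i)))" and b: "brackets_sub_hopf C H A j \<sigma>"
  proof -
    have "?\<Theta> \<in> hom C (P 1 \<sigma>) (obj H)" by (rule homI) simp_all
    then have iso: "is_iso C ?\<Theta>"
      using assms(2,4) finP bij_dim[OF d] unfolding bijective_morphisms_iso_def by blast
    have "\<exists>\<alpha> \<beta>. multi_dcp_defined C A \<alpha> \<beta> 1 \<sigma> \<and> bialgebra C (multi_dcp C A \<alpha> \<beta> 1 \<sigma>) \<and>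
        bialgebra_morphism C (multi_dcp C A \<alpha> \<beta> 1 \<sigma>) H ?\<Theta>"
    proof (rule ex_multi_dcp[OF I])
      show "inv_arr C ?\<Theta> \<in> hom C (obj H) (P 1 \<sigma>)" using is_arr_inv[OF iso] by (intro homI) simp_all
      show "comp C (inv_arr C ?\<Theta>) ?\<Theta> = ident C (P 1 \<sigma>)" using inv_comp[OF iso] by simp
      fix k \<rho> x y
      assume k: "(k, \<rho>) \<in> brackets 1 \<sigma>"
        and xy: "x \<in> fn (\<mu> k \<rho>) ` und C (P k \<rho>)" "y \<in> fn (\<mu> k \<rho>) ` und C (P k \<rho>)"
      have "sub_hopf_subspace C H (fn (\<mu> k \<rho>) ` und C (P k \<rho>))"
        using b k img[OF sub[OF k]] by (auto simp: brackets_sub_hopf_def)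
      then show "mul C H x y \<in> fn (\<mu> k \<rho>) ` und C (P k \<rho>)"
        using sub_hopf_subspace_mul[OF Ha(1) _ xy] by simp
    qed
    then show ?thesis using hopf_isomorphismI[OF _ assms(3) _ iso] by blast
  qed
  have iii_ii: "vdim C (obj H) = (\<Prod>i=1..n. vdim C (obj (A i)))"
    if "hopf_isomorphism C (multi_dcp C A \<alpha> \<beta> 1 \<sigma>) H ?\<Theta>" for \<alpha> \<beta>
    using dim_bij is_iso_bij[of ?\<Theta>] that by (simp add: hopf_isomorphism_def)
  show ?thesis using i_ii ii_i ii_iii iii_ii by blast
qed

end
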